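(* Let $\xi>\xi^*:=\mu\tau$. Then there exists a constant $C>0$ such that, for all $V_0\in\mathscr{D}(\mathscr{A}_d)$, the semigroup $e^{t\mathscr{A}_d}$ generated by $\mathscr{A}_d$ on $\mathscr{H}$ satisfies $$\left\|e^{t\mathscr{A}_d}V_0\right\|_{\mathscr{H}}\le\frac{C}{\sqrt t}\,\|V_0\|_{\mathscr{D}(\mathscr{A}_d)},\qquad\forall\,t>0.$$
   Context: Setting: $\Omega\subset\mathbb{R}^n$, $n\ge2$, is an open bounded domain with boundary $\partial\Omega=\Gamma_0\cup\Gamma_1$, where $\Gamma_0,\Gamma_1$ are closed subsets of $\partial\Omega$ with $\Gamma_0\cap\Gamma_1=\emptyset$ and $\mathrm{meas}(\Gamma_0)>0$; $\nu$ is the outward unit normal. The constants $a,\mu,\tau$ are positive. $H^1_{\Gamma_0}(\Omega)=\{u\in H^1(\Omega): u|_{\Gamma_0}=0\}$ and $\gamma_1$ is the trace operator on $\Gamma_1$. Energy space: $\mathscr{H}=H^1_{\Gamma_0}(\Omega)\times L^2(\Omega)\times L^2(\Gamma_1)\times L^2(\Gamma_1\times(0,1))$, with inner product, for $V_i=(u_i,v_i,w_i,z_i)^T$, $$\langle V_1,V_2\rangle_{\mathscr{H}}=\int_\Omega\nabla u_1\cdot\nabla u_2\,dx+\int_\Omega v_1v_2\,dx+\int_{\Gamma_1}w_1w_2\,d\sigma+\xi\int_{\Gamma_1}\int_0^1 z_1z_2\,d\rho\,d\sigma .$$ Operator: $$\mathscr{A}(u,v,w,z)^T=\Big(v,\ \Delta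 u-av,\ -\tfrac{\partial u}{\partial\nu}-\mu z(\cdot,1),\ -\tfrac1\tau z_\rho\Big)^T,$$ with domain $\mathscr{D}(\mathscr{A})$ the set of $(u,v,w,z)^T\in (H^1_{\Gamma_0}(\Omega)\cap H^2(\Omega))\times H^1_{\Gamma_0}(\Omega)\times L^2(\Gamma_1)\times L^2(\Gamma_1;H^1(0,1))$ such that $w=\gamma_1(v)=z(\cdot,0)$ on $\Gamma_1$. For $\xi>\xi^*=\mu\tau$ set $\mu_1=\frac{\xi}{2\tau}+\frac{\mu}{2}$ and $\mathscr{A}_d=\mathscr{A}-\mu_1I$, with $\mathscr{D}(\mathscr{A}_d)=\mathscr{D}(\mathscr{A})$; $\mathscr{A}_d$ generates a $C_0$ semigroup of contractions $e^{t\mathscr{A}_d}$ on $\mathscr{H}$. $\|\cdot\|_{\mathscr{D}(\mathscr{A}_d)}$ is the graph norm. *)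

theory Defs
  imports "HOL-Analysis.Analysis"
begin

section \<open>Strongly continuous semigroups\<close>

text \<open>
  A normed space is given here by a carrier \<open>X\<close> of representatives, the linear combination
  \<open>lin a V b W = a V + b W\<close> and a seminorm \<open>N\<close>; representatives at distance \<open>0\<close> stand for the
  same vector. For the energy space below the elements of \<open>X\<close> are tuples of functions and distance
  \<open>0\<close> is equality almost everywhere.
\<close>

definition seq_limit ::
  "(real \<Rightarrow> 'v \<Rightarrow> real \<Rightarrow> 'v \<Rightarrow> 'v) \<Rightarrow> ('v \<Rightarrow> real) \<Rightarrow> (nat \<Rightarrow> 'v) \<Rightarrow> 'v \<Rightarrow> bool" where
  "seq_limit lin N X L \<longleftrightarrow> (\<lambda>k. N (lin 1 (X k) (-1) L)) \<longlonglongrightarrow> 0"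

definition C0_semigroup ::
  "'v set \<Rightarrow> (real \<Rightarrow> 'v \<Rightarrow> real \<Rightarrow> 'v \<Rightarrow> 'v) \<Rightarrow> ('v \<Rightarrow> real) \<Rightarrow> (real \<Rightarrow> 'v \<Rightarrow> 'v) \<Rightarrow> bool" where
  "C0_semigroup X lin N T \<longleftrightarrow>
     (\<forall>t\<ge>0. \<forall>V\<in>X. T t V \<in> X) \<and>
     (\<forall>t\<ge>0. \<forall>V\<in>X. \<forall>W\<in>X. \<forall>a b.
        N (lin 1 (T t (lin a V b W)) (-1) (lin a (T t V) b (T t W))) = 0) \<and>
     (\<forall>t\<ge>0. \<exists>M. \<forall>V\<in>X. N (T t V) \<le> M * N V) \<and>
     (\<forall>V\<in>X. N (lin 1 (T 0 V) (-1) V) = 0) \<and>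
     (\<forall>s\<ge>0. \<forall>t\<ge>0. \<forall>V\<in>X. N (lin 1 (T (s + t) V) (-1) (T s (T t V))) = 0) \<and>
     (\<forall>V\<in>X. \<forall>t\<ge>0. ((\<lambda>s. N (lin 1 (T s V) (-1) (T t V))) \<longlongrightarrow> 0) (at t within {0..}))"

text \<open>Unbounded operators are given by their graphs.\<close>

definition semigroup_generator ::
  "'v set \<Rightarrow> (real \<Rightarrow> 'v \<Rightarrow> real \<Rightarrow> 'v \<Rightarrow> 'v) \<Rightarrow> ('v \<Rightarrow> real) \<Rightarrow> (real \<Rightarrow> 'v \<Rightarrow> 'v) \<Rightarrow> ('v \<times> 'v) set"
  where
  "semigroup_generator X lin N T =
     {(V, W). V \<in> X \<and> W \<in> X \<and>
        ((\<lambda>h. N (lin 1 (lin (1 / h) (T h V) (- 1 / h) V) (-1) W)) \<longlongrightarrow> 0) (at_right 0)}"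

definition graph_closure ::
  "'v set \<Rightarrow> (real \<Rightarrow> 'v \<Rightarrow> real \<Rightarrow> 'v \<Rightarrow> 'v) \<Rightarrow> ('v \<Rightarrow> real) \<Rightarrow> ('v \<times> 'v) set \<Rightarrow> ('v \<times> 'v) set"
  where
  "graph_closure X lin N A =
     {(V, W). V \<in> X \<and> W \<in> X \<and>
        (\<exists>Vs Ws. (\<forall>k. (Vs k, Ws k) \<in> A) \<and> seq_limit lin N Vs V \<and> seq_limit lin N Ws W)}"

text \<open>
  Generators are closed, so if \<open>A\<close> itself is the generator of \<open>T\<close> then taking the closure only adds
  the other representatives of the same vectors. With the closure, \<open>A\<close> may also be prescribed on a
  core, as with the \<open>H\<^sup>2\<close> domain below.
\<close>

definition generates ::
  "'v set \<Rightarrow> (real \<Rightarrow> 'v \<Rightarrow> real \<Rightarrow> 'v \<Rightarrow> 'v) \<Rightarrow> ('v \<Rightarrow> real) \<Rightarrow>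
     ('v \<times> 'v) set \<Rightarrow> (real \<Rightarrow> 'v \<Rightarrow> 'v) \<Rightarrow> bool" where
  "generates X lin N A T \<longleftrightarrow>
     C0_semigroup X lin N T \<and> semigroup_generator X lin N T = graph_closure X lin N A"

text \<open>The image \<open>A V\<close> is determined up to distance \<open>0\<close>, hence so is the choice below.\<close>

definition graph_norm :: "('v \<Rightarrow> real) \<Rightarrow> ('v \<times> 'v) set \<Rightarrow> 'v \<Rightarrow> real" where
  "graph_norm N A V = N V + N (SOME W. (V, W) \<in> A)"


section \<open>Domains with \<open>C\<^sup>1\<close> boundary\<close>

definition C1_with_gradient :: "('a::euclidean_space \<Rightarrow> real) \<Rightarrow> ('a \<Rightarrow> 'a) \<Rightarrow> bool" where
  "C1_with_gradient f f' \<longleftrightarrow> (\<forall>x. GDERIV f x :> f' x) \<and> continuous_on UNIV f'"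

text \<open>
  Inside the open set \<open>U\<close>, \<open>\<Omega>\<close> is the part of space on one side (given by the sign \<open>s\<close>) of the graph
  of a \<open>C\<^sup>1\<close> function over the hyperplane orthogonal to the coordinate direction \<open>b\<close>.
  A function on that hyperplane is encoded as one on the whole space not depending on the coordinate \<open>b\<close>.
\<close>

definition graph_chart ::
  "'a::euclidean_space set \<Rightarrow> 'a set \<Rightarrow> 'a \<Rightarrow> real \<Rightarrow> ('a \<Rightarrow> real) \<Rightarrow> ('a \<Rightarrow> 'a) \<Rightarrow> bool" where
  "graph_chart \<Omega> U b s \<gamma> \<gamma>' \<longleftrightarrow>
     open U \<and> b \<in> Basis \<and> (s = 1 \<or> s = -1) \<and> C1_with_gradient \<gamma> \<gamma>' \<and>
     (\<forall>x. \<gamma> x = \<gamma> (x - (x \<bullet> b) *\<^sub>R b)) \<and>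
     \<Omega> \<inter> U = {x \<in> U. \<gamma> x < s * (x \<bullet> b)}"

definition C1_boundary :: "'a::euclidean_space set \<Rightarrow> bool" where
  "C1_boundary \<Omega> \<longleftrightarrow> (\<forall>p\<in>frontier \<Omega>. \<exists>U b s \<gamma> \<gamma>'. p \<in> U \<and> graph_chart \<Omega> U b s \<gamma> \<gamma>')"

definition outward_unit_normal :: "'a::euclidean_space set \<Rightarrow> ('a \<Rightarrow> 'a) \<Rightarrow> bool" where
  "outward_unit_normal \<Omega> \<nu> \<longleftrightarrow>
     (\<forall>U b s \<gamma> \<gamma>'. graph_chart \<Omega> U b s \<gamma> \<gamma>' \<longrightarrow>
        (\<forall>x\<in>frontier \<Omega> \<inter> U. \<nu> x = (\<gamma>' x - s *\<^sub>R b) /\<^sub>R sqrt (1 + (norm (\<gamma>' x))\<^sup>2)))"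

text \<open>Lebesgue measure of dimension \<open>DIM('a) - 1\<close> on the hyperplane orthogonal to \<open>b\<close>,
  constructed as \<open>lborel\<close> is, with the coordinate \<open>b\<close> left out.\<close>

definition hyperplane_lborel :: "'a::euclidean_space \<Rightarrow> 'a measure" where
  "hyperplane_lborel b =
     distr (\<Pi>\<^sub>M k\<in>Basis - {b}. (lborel :: real measure)) borel (\<lambda>f. \<Sum>k\<in>Basis - {b}. f k *\<^sub>R k)"

text \<open>
  The surface measure of the boundary, as a Borel measure on the whole space carried by
  \<open>frontier \<Omega>\<close>: in each graph chart it has the area element
  \<open>sqrt (1 + |\<nabla>\<gamma>|\<^sup>2) dy\<close>. For a \<open>C\<^sup>1\<close> boundary there is exactly one such measure.
\<close>

definition surface_measure :: "'a::euclidean_space set \<Rightarrow> 'a measure \<Rightarrow> bool" where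
  "surface_measure \<Omega> \<sigma> \<longleftrightarrow>
     sets \<sigma> = sets borel \<and> emeasure \<sigma> (- frontier \<Omega>) = 0 \<and>
     (\<forall>U b s \<gamma> \<gamma>'. graph_chart \<Omega> U b s \<gamma> \<gamma>' \<longrightarrow>
        (\<forall>A\<in>sets borel. A \<subseteq> U \<longrightarrow>
           emeasure \<sigma> (A \<inter> frontier \<Omega>) =
             (\<integral>\<^sup>+ y. indicator A (y + (s * \<gamma> y) *\<^sub>R b) * ennreal (sqrt (1 + (norm (\<gamma>' y))\<^sup>2))
                \<partial>hyperplane_lborel b)))"


section \<open>Lebesgue and Sobolev spaces\<close>

definition L2 :: "'b measure \<Rightarrow> ('b \<Rightarrow> 'c::real_normed_vector) set" where
  "L2 M = {f \<in> borel_measurable M. integrable M (\<lambda>x. (norm (f x))\<^sup>2)}"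

abbreviation leb :: "'a::euclidean_space set \<Rightarrow> 'a measure" where
  "leb \<Omega> \<equiv> restrict_space lborel \<Omega>"

text \<open>\<open>u \<in> H\<^sup>1(\<Omega>)\<close> with weak gradient \<open>g\<close>, tested against \<open>C\<^sup>1\<close> functions with compact support
  in \<open>\<Omega>\<close>.\<close>

definition H1_gradient :: "'a::euclidean_space set \<Rightarrow> ('a \<Rightarrow> real) \<Rightarrow> ('a \<Rightarrow> 'a) \<Rightarrow> bool" where
  "H1_gradient \<Omega> u g \<longleftrightarrow>
     u \<in> L2 (leb \<Omega>) \<and> g \<in> L2 (leb \<Omega>) \<and>
     (\<forall>\<phi> \<phi>' K. C1_with_gradient \<phi> \<phi>' \<and> compact K \<and> K \<subseteq> \<Omega> \<and> (\<forall>x. x \<notin> K \<longrightarrow> \<phi> x = 0) \<longrightarrow>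
        (LINT x|leb \<Omega>. u x *\<^sub>R \<phi>' x) = - (LINT x|leb \<Omega>. \<phi> x *\<^sub>R g x))"

definition H1 :: "'a::euclidean_space set \<Rightarrow> ('a \<Rightarrow> real) set" where
  "H1 \<Omega> = {u. \<exists>g. H1_gradient \<Omega> u g}"

definition weak_grad :: "'a::euclidean_space set \<Rightarrow> ('a \<Rightarrow> real) \<Rightarrow> 'a \<Rightarrow> 'a" where
  "weak_grad \<Omega> u = (SOME g. H1_gradient \<Omega> u g)"

definition weak_partial :: "'a::euclidean_space set \<Rightarrow> 'a \<Rightarrow> ('a \<Rightarrow> real) \<Rightarrow> 'a \<Rightarrow> real" where
  "weak_partial \<Omega> b u = (\<lambda>x. weak_grad \<Omega> u x \<bullet> b)"

definition H2 :: "'a::euclidean_space set \<Rightarrow> ('a \<Rightarrow> real) set" where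
  "H2 \<Omega> = {u \<in> H1 \<Omega>. \<forall>b\<in>Basis. weak_partial \<Omega> b u \<in> H1 \<Omega>}"

definition weak_laplacian :: "'a::euclidean_space set \<Rightarrow> ('a \<Rightarrow> real) \<Rightarrow> 'a \<Rightarrow> real" where
  "weak_laplacian \<Omega> u = (\<lambda>x. \<Sum>b\<in>Basis. weak_partial \<Omega> b (weak_partial \<Omega> b u) x)"

text \<open>
  Graph of the trace operator \<open>H\<^sup>1(\<Omega>) \<rightarrow> L\<^sup>2(\<partial>\<Omega>)\<close>: the extension by continuity of the restriction
  \<open>f \<mapsto> f|\<partial>\<Omega>\<close> from functions that are \<open>C\<^sup>1\<close> up to the boundary.
\<close>

definition has_trace ::
  "'a::euclidean_space set \<Rightarrow> 'a measure \<Rightarrow> ('a \<Rightarrow> real) \<Rightarrow> ('a \<Rightarrow> real) \<Rightarrow> bool" where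
  "has_trace \<Omega> \<sigma> u g \<longleftrightarrow>
     u \<in> H1 \<Omega> \<and> g \<in> L2 \<sigma> \<and>
     (\<exists>f f'. (\<forall>k::nat. C1_with_gradient (f k) (f' k)) \<and>
        (\<lambda>k. LINT x|leb \<Omega>. (f k x - u x)\<^sup>2) \<longlonglongrightarrow> 0 \<and>
        (\<lambda>k. LINT x|leb \<Omega>. (norm (f' k x - weak_grad \<Omega> u x))\<^sup>2) \<longlonglongrightarrow> 0 \<and>
        (\<lambda>k. LINT x|\<sigma>. (f k x - g x)\<^sup>2) \<longlonglongrightarrow> 0)"

definition H1_vanishing ::
  "'a::euclidean_space set \<Rightarrow> 'a measure \<Rightarrow> 'a set \<Rightarrow> ('a \<Rightarrow> real) set" where
  "H1_vanishing \<Omega> \<sigma> \<Gamma>0 = {u. \<exists>g. has_trace \<Omega> \<sigma> u g \<and> (AE x in restrict_space \<sigma> \<Gamma>0. g x = 0)}"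

definition trace_on ::
  "'a::euclidean_space set \<Rightarrow> 'a measure \<Rightarrow> 'a set \<Rightarrow> ('a \<Rightarrow> real) \<Rightarrow> ('a \<Rightarrow> real) \<Rightarrow> bool" where
  "trace_on \<Omega> \<sigma> \<Gamma> u w \<longleftrightarrow>
     (\<exists>g. has_trace \<Omega> \<sigma> u g \<and> (AE x in restrict_space \<sigma> \<Gamma>. g x = w x))"

text \<open>For \<open>u \<in> H\<^sup>2(\<Omega>)\<close>, the normal derivative is the trace of the gradient of \<open>u\<close>, dotted with \<open>\<nu>\<close>.\<close>

definition has_normal_derivative ::
  "'a::euclidean_space set \<Rightarrow> ('a \<Rightarrow> 'a) \<Rightarrow> 'a measure \<Rightarrow> ('a \<Rightarrow> real) \<Rightarrow> ('a \<Rightarrow> real) \<Rightarrow> bool" where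
  "has_normal_derivative \<Omega> \<nu> \<sigma> u d \<longleftrightarrow>
     u \<in> H2 \<Omega> \<and>
     (\<exists>G. (\<forall>b\<in>Basis. has_trace \<Omega> \<sigma> (weak_partial \<Omega> b u) (\<lambda>x. G x \<bullet> b)) \<and> d = (\<lambda>x. G x \<bullet> \<nu> x))"

abbreviation cyl :: "'a::euclidean_space measure \<Rightarrow> 'a set \<Rightarrow> ('a \<times> real) measure" where
  "cyl \<sigma> \<Gamma> \<equiv> restrict_space \<sigma> \<Gamma> \<Otimes>\<^sub>M leb {0<..<1}"

text \<open>\<open>z \<in> L\<^sup>2(\<Gamma>; H\<^sup>1(0,1))\<close> with \<open>z\<^sub>\<rho> = \<zeta>\<close>, under the identification of \<open>L\<^sup>2(\<Gamma>; L\<^sup>2(0,1))\<close>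
  with \<open>L\<^sup>2(\<Gamma> \<times> (0,1))\<close>.\<close>

definition L2_H1_derivative ::
  "'a::euclidean_space measure \<Rightarrow> 'a set \<Rightarrow> ('a \<times> real \<Rightarrow> real) \<Rightarrow> ('a \<times> real \<Rightarrow> real) \<Rightarrow> bool" where
  "L2_H1_derivative \<sigma> \<Gamma> z \<zeta> \<longleftrightarrow>
     z \<in> L2 (cyl \<sigma> \<Gamma>) \<and> \<zeta> \<in> L2 (cyl \<sigma> \<Gamma>) \<and>
     (AE x in restrict_space \<sigma> \<Gamma>. H1_gradient {0<..<1} (\<lambda>\<rho>. z (x, \<rho>)) (\<lambda>\<rho>. \<zeta> (x, \<rho>)))"

text \<open>The values at \<open>0\<close> and \<open>1\<close> of an element of \<open>H\<^sup>1(0,1)\<close> are those of its continuous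
  representative on \<open>[0,1]\<close>.\<close>

definition endpoint_values :: "(real \<Rightarrow> real) \<Rightarrow> real \<Rightarrow> real \<Rightarrow> bool" where
  "endpoint_values f c0 c1 \<longleftrightarrow>
     (\<exists>c. continuous_on {0..1} c \<and> (AE \<rho> in leb {0<..<1}. f \<rho> = c \<rho>) \<and> c 0 = c0 \<and> c 1 = c1)"


section \<open>Energy space and evolution operator\<close>

type_synonym 'a state = "('a \<Rightarrow> real) \<times> ('a \<Rightarrow> real) \<times> ('a \<Rightarrow> real) \<times> ('a \<times> real \<Rightarrow> real)"

definition energy_space ::
  "'a::euclidean_space set \<Rightarrow> 'a measure \<Rightarrow> 'a set \<Rightarrow> 'a set \<Rightarrow> 'a state set" where
  "energy_space \<Omega> \<sigma> \<Gamma>0 \<Gamma>1 =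
     H1_vanishing \<Omega> \<sigma> \<Gamma>0 \<times> L2 (leb \<Omega>) \<times> L2 (restrict_space \<sigma> \<Gamma>1) \<times> L2 (cyl \<sigma> \<Gamma>1)"

fun state_lin :: "real \<Rightarrow> 'a state \<Rightarrow> real \<Rightarrow> 'a state \<Rightarrow> 'a state" where
  "state_lin \<alpha> (u1, v1, w1, z1) \<beta> (u2, v2, w2, z2) =
     ((\<lambda>x. \<alpha> * u1 x + \<beta> * u2 x), (\<lambda>x. \<alpha> * v1 x + \<beta> * v2 x),
      (\<lambda>x. \<alpha> * w1 x + \<beta> * w2 x), (\<lambda>p. \<alpha> * z1 p + \<beta> * z2 p))"

fun energy_inner ::
  "'a::euclidean_space set \<Rightarrow> 'a measure \<Rightarrow> 'a set \<Rightarrow> real \<Rightarrow> 'a state \<Rightarrow> 'a state \<Rightarrow> real" where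
  "energy_inner \<Omega> \<sigma> \<Gamma>1 \<xi> (u1, v1, w1, z1) (u2, v2, w2, z2) =
     (LINT x|leb \<Omega>. weak_grad \<Omega> u1 x \<bullet> weak_grad \<Omega> u2 x) + (LINT x|leb \<Omega>. v1 x * v2 x) +
     (LINT x|restrict_space \<sigma> \<Gamma>1. w1 x * w2 x) +
     \<xi> * (LINT p|cyl \<sigma> \<Gamma>1. z1 p * z2 p)"

definition energy_norm ::
  "'a::euclidean_space set \<Rightarrow> 'a measure \<Rightarrow> 'a set \<Rightarrow> real \<Rightarrow> 'a state \<Rightarrow> real" where
  "energy_norm \<Omega> \<sigma> \<Gamma>1 \<xi> V = sqrt (energy_inner \<Omega> \<sigma> \<Gamma>1 \<xi> V V)"

text \<open>The graph of \<open>\<A>\<close>; its domain is \<open>Domain\<close> of this set.\<close>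

definition op_A ::
  "'a::euclidean_space set \<Rightarrow> ('a \<Rightarrow> 'a) \<Rightarrow> 'a measure \<Rightarrow> 'a set \<Rightarrow> 'a set \<Rightarrow>
     real \<Rightarrow> real \<Rightarrow> real \<Rightarrow> ('a state \<times> 'a state) set" where
  "op_A \<Omega> \<nu> \<sigma> \<Gamma>0 \<Gamma>1 a \<mu> \<tau> =
     {((u, v, w, z),
       (v, (\<lambda>x. weak_laplacian \<Omega> u x - a * v x), (\<lambda>x. - d x - \<mu> * z_1 x), (\<lambda>p. - (1 / \<tau>) * \<zeta> p)))
      | u v w z d z_1 \<zeta>.
        u \<in> H1_vanishing \<Omega> \<sigma> \<Gamma>0 \<inter> H2 \<Omega> \<and> v \<in> H1_vanishing \<Omega> \<sigma> \<Gamma>0 \<and>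
        w \<in> L2 (restrict_space \<sigma> \<Gamma>1) \<and> trace_on \<Omega> \<sigma> \<Gamma>1 v w \<and>
        has_normal_derivative \<Omega> \<nu> \<sigma> u d \<and>
        L2_H1_derivative \<sigma> \<Gamma>1 z \<zeta> \<and> z_1 \<in> L2 (restrict_space \<sigma> \<Gamma>1) \<and>
        (AE x in restrict_space \<sigma> \<Gamma>1. endpoint_values (\<lambda>\<rho>. z (x, \<rho>)) (w x) (z_1 x))}"

definition op_A_d ::
  "'a::euclidean_space set \<Rightarrow> ('a \<Rightarrow> 'a) \<Rightarrow> 'a measure \<Rightarrow> 'a set \<Rightarrow> 'a set \<Rightarrow>
     real \<Rightarrow> real \<Rightarrow> real \<Rightarrow> real \<Rightarrow> ('a state \<times> 'a state) set" where
  "op_A_d \<Omega> \<nu> \<sigma> \<Gamma>0 \<Gamma>1 a \<mu> \<tau> \<xi> =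
     {(V, state_lin 1 W (- (\<xi> / (2 * \<tau>) + \<mu> / 2)) V) | V W. (V, W) \<in> op_A \<Omega> \<nu> \<sigma> \<Gamma>0 \<Gamma>1 a \<mu> \<tau>}"

end

theory Submission
  imports Defs
begin

text \<open>
  Testing \<open>\<A> V\<close> against \<open>V\<close> in the energy inner product leaves, by Green's formula, the integral
  over \<open>\<Gamma>\<^sub>1\<close> of a quadratic form in \<open>w\<close> and \<open>z(\<cdot>, 1)\<close>, and the shift by \<open>\<mu>\<^sub>1\<close> cancels the
  term in \<open>w\<close> exactly, so that the energy controls everything but \<open>w\<close>. Replacing the weight \<open>\<xi>\<close> on
  the delay component by \<open>\<xi> - \<epsilon> (1 - \<rho>)\<close> gives an equivalent form in which \<open>w = z(\<cdot>, 0)\<close> is damped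
  too, and \<open>\<A>\<^sub>d\<close> is strictly dissipative for it: \<open>B (\<A>\<^sub>d V) V \<le> - k B V V\<close>. Hence
  the semigroup decays like \<open>exp (- k t)\<close>, which is stronger than \<open>1 / sqrt t\<close>.

  Green's formula for traces follows by density from the divergence theorem for \<open>C\<^sup>1\<close> functions.
  That \<open>v\<close> vanishes on \<open>\<Gamma>\<^sub>0\<close> and equals \<open>w\<close> on \<open>\<Gamma>\<^sub>1\<close> may be witnessed by two different traces of
  \<open>v\<close>; instead of proving that they agree, the formula is applied to each of them with a cutoff weight
  \<open>\<eta>\<close>, respectively \<open>1 - \<eta>\<close>, separating \<open>\<Gamma>\<^sub>1\<close> from \<open>\<Gamma>\<^sub>0\<close>.
\<close>

section \<open>Contraction semigroups and dissipative forms\<close>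

text \<open>The value of \<open>\<mu>1\<close> has two sources. Young's inequality for the cross
  term \<open>\<mu> z(\<cdot>, 1) w\<close> gives \<open>\<mu> / 2\<close> to both squares; the
  transport in \<rho> gives \<open>\<xi> / (2 \<tau>)\<close> to the square of \<open>w\<close> and
  takes as much from that of \<open>z(\<cdot>, 1)\<close>. So \<open>w\<close> receives exactly
  \<open>\<mu>1\<close>, and \<open>z(\<cdot>, 1)\<close> a coefficient that is negative because
  \<xi> > \<mu> \<tau>. Lowering the weight at the inflow end by \<epsilon> gains
  \<open>\<epsilon> / (2 \<tau>)\<close> on \<open>w\<close> and costs
  \<open>\<epsilon> / (2 \<tau>)\<close> on the plain norm of \<open>z\<close>, which half of the
  damping \<open>\<mu>1\<close> of the delay component absorbs for small \<epsilon>. Two features of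
  the setting shape the abstract part. Vectors are representatives, so the semigroup laws hold only
  up to distance 0 and are read through pairings. The generator is a right limit, known only as the
  closure of the graph over the \<open>H\<^sup>2\<close> domain: the inequality has to survive graph
  limits, and along an orbit only a right derivative of the squared norm is at hand.\<close>

lemma right_derivative_nonpos_imp_le:
  fixes f :: "real \<Rightarrow> real"
  assumes "a \<le> b" and cont: "continuous_on {a..b} f"
    and der: "\<And>x. a \<le> x \<Longrightarrow> x < b \<Longrightarrow> \<exists>D\<le>0. (f has_real_derivative D) (at_right x)"
  shows "f b \<le> f a"
proof (rule field_le_epsilon)
  fix e :: real assume "e > 0"
  \<comment> \<open>The summand 1 keeps the denominator positive when \<open>a = b\<close>.\<close>
  define \<epsilon> where "\<epsilon> = e / (1 + b - a)"
  have \<epsilon>: "\<epsilon> > 0" "\<epsilon> * (b - a) \<le> e"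
    using \<open>e > 0\<close> \<open>a \<le> b\<close> by (auto simp: \<epsilon>_def field_simps)
  define S where "S = {x \<in> {a..b}. f x - \<epsilon> * (x - a) \<in> {..f a}}"
  have "S = {a..b} \<inter> (\<lambda>x. f x - \<epsilon> * (x - a)) -` {..f a}" by (auto simp: S_def)
  hence "closed S"
    by (simp only:) (intro continuous_closed_preimage continuous_intros cont closed_atMost closed_atLeastAtMost)
  have "a \<in> S" using \<open>a \<le> b\<close> by (simp add: S_def)
  have "S \<subseteq> {a..b}" by (auto simp: S_def)
  hence "compact S" using \<open>closed S\<close> by (meson bounded_closed_interval bounded_subset compact_eq_bounded_closed)
  then obtain s where s: "s \<in> S" "\<And>x. x \<in> S \<Longrightarrow> x \<le> s"
    using compact_attains_sup[of S] \<open>a \<in> S\<close> by blast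
  \<comment> \<open>At a largest point \<open>s < b\<close> of \<open>S\<close> the right derivative
    is at most 0, hence below the slope \<epsilon>, so the bound defining \<open>S\<close> persists
    a little to the right of \<open>s\<close>.\<close>
  have "s = b"
  proof (rule ccontr)
    assume "s \<noteq> b"
    hence sb: "a \<le> s" "s < b" using s(1) by (auto simp: S_def)
    obtain D where "D \<le> 0" and D: "(f has_real_derivative D) (at_right s)"
      using der[OF sb] by blast
    have "((\<lambda>y. (f y - f s) / (y - s)) \<longlongrightarrow> D) (at_right s)"
      using D by (simp add: has_field_derivative_iff)
    hence "\<forall>\<^sub>F y in at_right s. (f y - f s) / (y - s) < \<epsilon>"
      using \<open>D \<le> 0\<close> \<epsilon>(1) by (elim order_tendstoD(2)) auto
    moreover have "\<forall>\<^sub>F y in at_right s. s < y \<and> y < b"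
      using sb(2) by (auto simp: eventually_at_right_field)
    ultimately have "\<forall>\<^sub>F y in at_right s. (f y - f s) / (y - s) < \<epsilon> \<and> s < y \<and> y < b"
      by eventually_elim auto
    then obtain y where y: "(f y - f s) / (y - s) < \<epsilon>" "s < y" "y < b"
      by (metis (no_types, lifting) eventually_happens trivial_limit_at_right_real)
    have "f y - f s \<le> \<epsilon> * (y - s)" using y by (simp add: field_simps)
    moreover have "f s \<le> f a + \<epsilon> * (s - a)" using s(1) by (auto simp: S_def)
    ultimately have "y \<in> S" using y sb by (auto simp: S_def algebra_simps)
    thus False using s(2) y(2) by fastforce
  qed
  thus "f b \<le> f a + e" using s(1) \<epsilon> by (auto simp: S_def)
qed

lemma tendsto_if_dist_le:
  fixes f :: "'b \<Rightarrow> real"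
  assumes "(g \<longlongrightarrow> 0) F" "\<forall>\<^sub>F x in F. \<bar>f x - l\<bar> \<le> g x"
  shows "(f \<longlongrightarrow> l) F"
  by (rule LIM_zero_cancel, rule Lim_null_comparison[OF _ assms(1)]) (use assms(2) in simp)

text \<open>Definiteness is left out because representatives that agree almost everywhere have
  distance 0, and the operations are relative to a carrier because the elements are tuples of
  functions. The locale is instantiated with the weighted energy and with \<open>L2\<close>.\<close>

locale semi_inner_product =
  fixes X :: "'v set" and lin :: "real \<Rightarrow> 'v \<Rightarrow> real \<Rightarrow> 'v \<Rightarrow> 'v" and B :: "'v \<Rightarrow> 'v \<Rightarrow> real"
  assumes lin_closed: "V \<in> X \<Longrightarrow> W \<in> X \<Longrightarrow> lin \<alpha> V \<beta> W \<in> X"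
    and sym: "V \<in> X \<Longrightarrow> W \<in> X \<Longrightarrow> B V W = B W V"
    and lin_left: "V \<in> X \<Longrightarrow> W \<in> X \<Longrightarrow> U \<in> X \<Longrightarrow> B (lin \<alpha> V \<beta> W) U = \<alpha> * B V U + \<beta> * B W U"
    and nonneg: "V \<in> X \<Longrightarrow> 0 \<le> B V V"
begin

lemma lin_right: "V \<in> X \<Longrightarrow> W \<in> X \<Longrightarrow> U \<in> X \<Longrightarrow> B U (lin \<alpha> V \<beta> W) = \<alpha> * B U V + \<beta> * B U W"
  using lin_left[of V W U] sym lin_closed by metis

definition form_norm :: "'v \<Rightarrow> real" where "form_norm V = sqrt (B V V)"

lemma form_norm_nonneg: "V \<in> X \<Longrightarrow> 0 \<le> form_norm V" by (simp add: form_norm_def nonneg)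

lemma form_norm_square: "V \<in> X \<Longrightarrow> (form_norm V)\<^sup>2 = B V V" by (simp add: form_norm_def nonneg)

text \<open>The quadratic form on the span of \<open>V\<close> and \<open>W\<close> is nonnegative.
  If \<open>B W W = 0\<close> it is affine in the coefficient of \<open>W\<close>, and an affine
  function bounded below has slope 0; this replaces the appeal to definiteness.\<close>

lemma Cauchy_Schwarz:
  assumes "V \<in> X" "W \<in> X" shows "\<bar>B V W\<bar> \<le> form_norm V * form_norm W"
proof -
  let ?a = "B V V" and ?b = "B W W" and ?c = "B V W"
  have quad: "0 \<le> s * (s * ?a + r * ?c) + r * (s * ?c + r * ?b)" for s r
  proof -
    have "B (lin s V r W) (lin s V r W) = s * (s * ?a + r * ?c) + r * (s * ?c + r * ?b)"
      using assms by (simp add: lin_left lin_right lin_closed sym[of W V] algebra_simps)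
    thus ?thesis using nonneg[OF lin_closed[OF assms, of s r]] by simp
  qed
  have "?c\<^sup>2 \<le> ?a * ?b"
  proof (cases "?b = 0")
    case True
    have *: "0 \<le> ?a + 2 * r * ?c" for r using quad[of 1 r] True by (simp add: algebra_simps)
    have "?c = 0"
    proof (rule ccontr)
      assume "?c \<noteq> 0"
      \<comment> \<open>For this \<open>r\<close> the affine expression
        \<open>?a + 2 * r * ?c\<close> equals -1.\<close>
      thus False using *[of "- (?a + 1) / (2 * ?c)"] by (simp add: field_simps)
    qed
    thus ?thesis using True by simp
  next
    case False
    hence b: "?b > 0" using nonneg[OF assms(2)] by simp
    have "0 \<le> ?b * (?a * ?b - ?c\<^sup>2)"
      using quad[of ?b "- ?c"] by (simp add: power2_eq_square algebra_simps)
    thus ?thesis using b by (simp add: zero_le_mult_iff)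
  qed
  hence "sqrt (?c\<^sup>2) \<le> sqrt (?a * ?b)" by (rule real_sqrt_le_mono)
  thus ?thesis by (simp add: form_norm_def real_sqrt_mult)
qed

lemma triangle:
  assumes "V \<in> X" "W \<in> X" shows "form_norm (lin \<alpha> V \<beta> W) \<le> \<bar>\<alpha>\<bar> * form_norm V + \<bar>\<beta>\<bar> * form_norm W"
proof (rule power2_le_imp_le)
  have "(form_norm (lin \<alpha> V \<beta> W))\<^sup>2 = \<alpha> * (\<alpha> * B V V + \<beta> * B V W) + \<beta> * (\<alpha> * B V W + \<beta> * B W W)"
    unfolding form_norm_square[OF lin_closed[OF assms]] using assms
    by (simp add: lin_left lin_right lin_closed sym[of W V] algebra_simps)
  also have "\<dots> = \<alpha>\<^sup>2 * (form_norm V)\<^sup>2 + 2 * ((\<alpha> * \<beta>) * B V W) + \<beta>\<^sup>2 * (form_norm W)\<^sup>2"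
    unfolding form_norm_square[OF assms(1)] form_norm_square[OF assms(2)] by (simp add: power2_eq_square algebra_simps)
  also have "(\<alpha> * \<beta>) * B V W \<le> \<bar>\<alpha> * \<beta>\<bar> * (form_norm V * form_norm W)"
    using mult_left_mono[OF Cauchy_Schwarz[OF assms], of "\<bar>\<alpha> * \<beta>\<bar>"]
      abs_ge_self[of "(\<alpha> * \<beta>) * B V W"] unfolding abs_mult by simp
  finally show "(form_norm (lin \<alpha> V \<beta> W))\<^sup>2 \<le> (\<bar>\<alpha>\<bar> * form_norm V + \<bar>\<beta>\<bar> * form_norm W)\<^sup>2"
    by (simp add: power2_sum power_mult_distrib abs_mult mult_ac)
qed (use assms in \<open>auto intro!: add_nonneg_nonneg mult_nonneg_nonneg form_norm_nonneg\<close>)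

text \<open>Equality in the quotient by null vectors, phrased through pairings: equivalence and
  compatibility with \<open>lin\<close> then follow from linearity alone, and Cauchy-Schwarz derives
  it from distance 0.\<close>

definition same :: "'v \<Rightarrow> 'v \<Rightarrow> bool" where
  "same V W \<longleftrightarrow> (\<forall>U\<in>X. B V U = B W U)"

lemma same_if_dist_0:
  assumes "V \<in> X" "W \<in> X" "form_norm (lin 1 V (-1) W) = 0" shows "same V W"
  unfolding same_def
proof
  fix U assume "U \<in> X"
  thus "B V U = B W U"
    using Cauchy_Schwarz[OF lin_closed[OF assms(1,2), of 1 "-1"] \<open>U \<in> X\<close>] assms by (simp add: lin_left)
qed

lemma same_sym: "same V W \<Longrightarrow> same W V" by (simp add: same_def)

lemma same_trans: "same U V \<Longrightarrow> same V W \<Longrightarrow> same U W" by (simp add: same_def)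

lemma same_lin:
  "V \<in> X \<Longrightarrow> W \<in> X \<Longrightarrow> V' \<in> X \<Longrightarrow> W' \<in> X \<Longrightarrow> same V V' \<Longrightarrow> same W W' \<Longrightarrow>
    same (lin \<alpha> V \<beta> W) (lin \<alpha> V' \<beta> W')"
  by (simp add: same_def lin_left)

lemma same_form_norm: "V \<in> X \<Longrightarrow> W \<in> X \<Longrightarrow> same V W \<Longrightarrow> form_norm V = form_norm W"
  unfolding same_def form_norm_def by (metis sym)


text \<open>\<open>T t\<close> commutes with the difference quotients up to null vectors, and being
  bounded it preserves their limit.\<close>

lemma generator_invariant:
  assumes T: "C0_semigroup X lin form_norm T" and VW: "(V, W) \<in> semigroup_generator X lin form_norm T" and "t \<ge> 0"
  shows "(T t V, T t W) \<in> semigroup_generator X lin form_norm T"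
proof -
  have X: "V \<in> X" "W \<in> X"
    and lim: "((\<lambda>h. form_norm (lin 1 (lin (1 / h) (T h V) (- 1 / h) V) (-1) W)) \<longlongrightarrow> 0) (at_right 0)"
    using VW by (auto simp: semigroup_generator_def)
  have TX: "T s U \<in> X" if "s \<ge> 0" "U \<in> X" for s U using T that by (auto simp: C0_semigroup_def)
  have Tlin: "same (T s (lin \<alpha> U \<beta> U')) (lin \<alpha> (T s U) \<beta> (T s U'))"
    if "s \<ge> 0" "U \<in> X" "U' \<in> X" for s \<alpha> U \<beta> U'
    using T that by (intro same_if_dist_0) (auto simp: C0_semigroup_def lin_closed)
  have Tadd: "same (T (r + s) U) (T r (T s U))" if "r \<ge> 0" "s \<ge> 0" "U \<in> X" for r s U
    using T that by (intro same_if_dist_0) (auto simp: C0_semigroup_def lin_closed)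
  have "\<exists>M. \<forall>U\<in>X. form_norm (T t U) \<le> M * form_norm U"
    using T \<open>t \<ge> 0\<close> unfolding C0_semigroup_def by simp
  then obtain M where M: "\<And>U. U \<in> X \<Longrightarrow> form_norm (T t U) \<le> M * form_norm U" by blast
  define D where "D h = lin 1 (lin (1 / h) (T h V) (- 1 / h) V) (-1) W" for h
  define D' where "D' h = lin 1 (lin (1 / h) (T h (T t V)) (- 1 / h) (T t V)) (-1) (T t W)" for h
  have DX: "D h \<in> X" "D' h \<in> X" if "h \<ge> 0" for h
    using that X \<open>t \<ge> 0\<close> by (auto simp: D_def D'_def intro!: lin_closed TX)
  have "form_norm (D' h) = form_norm (T t (D h))" if "h > 0" for h
  proof -
    have h: "h \<ge> 0" using that by simp
    note [simp] = lin_closed TX X h \<open>t \<ge> 0\<close>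
    \<comment> \<open>Commutation of \<open>T h\<close> and \<open>T t\<close>: both compositions
      represent the semigroup at time \<open>h + t\<close>.\<close>
    have "same (T (h + t) V) (T h (T t V))" "same (T (t + h) V) (T t (T h V))" by (simp_all add: Tadd)
    hence s1: "same (T h (T t V)) (T t (T h V))"
      by (simp add: same_def add.commute)
    have s2: "same (T t (lin (1 / h) (T h V) (- 1 / h) V)) (lin (1 / h) (T h (T t V)) (- 1 / h) (T t V))"
      by (rule same_trans[OF Tlin], simp, simp, simp, rule same_lin)
         (auto simp: same_sym[OF s1], auto simp: same_def)
    have "same (T t (D h)) (D' h)" unfolding D_def D'_def
      by (rule same_trans[OF Tlin], simp, simp, simp, rule same_lin[OF _ _ _ _ s2])
         (auto simp: same_def)
    thus ?thesis using DX[OF h] by (intro same_form_norm[symmetric]) auto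
  qed
  hence "form_norm (D' h) \<le> M * form_norm (D h)" "0 \<le> form_norm (D' h)" if "h > 0" for h
    using that M[OF DX(1), of h] form_norm_nonneg[OF DX(2), of h] by auto
  hence ev: "\<forall>\<^sub>F h in at_right 0. form_norm (D' h) \<le> M * form_norm (D h)" "\<forall>\<^sub>F h in at_right 0. 0 \<le> form_norm (D' h)"
    by (auto simp: eventually_at_right_field intro!: exI[of _ 1])
  have "((\<lambda>h. M * form_norm (D h)) \<longlongrightarrow> 0) (at_right 0)"
    using tendsto_mult_right_zero[OF lim, of M] by (simp add: D_def)
  hence "((\<lambda>h. form_norm (D' h)) \<longlongrightarrow> 0) (at_right 0)"
    by (rule tendsto_sandwich[OF ev(2) ev(1) tendsto_const])
  thus ?thesis using X TX \<open>t \<ge> 0\<close> by (simp add: semigroup_generator_def D'_def)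
qed

text \<open>The usual reverse triangle inequality; cancellations such as
  \<open>(V - W) + W = V\<close> are available only in the sense of \<open>same\<close>, so each
  norm is first moved to a representative of the required shape.\<close>

lemma form_norm_diff_le:
  assumes "V \<in> X" "W \<in> X" shows "\<bar>form_norm V - form_norm W\<bar> \<le> form_norm (lin 1 V (-1) W)"
proof -
  have *: "form_norm V \<le> form_norm W + form_norm (lin 1 V (-1) W)"
    and **: "form_norm W \<le> form_norm V + form_norm (lin 1 V (-1) W)"
  proof -
    have "same V (lin 1 (lin 1 V (-1) W) 1 W)" using assms by (simp add: same_def lin_left lin_closed)
    hence "form_norm V = form_norm (lin 1 (lin 1 V (-1) W) 1 W)" using assms by (intro same_form_norm lin_closed) auto
    also have "\<dots> \<le> form_norm (lin 1 V (-1) W) + form_norm W"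
      using triangle[of "lin 1 V (-1) W" W 1 1] assms by (simp add: lin_closed)
    finally show "form_norm V \<le> form_norm W + form_norm (lin 1 V (-1) W)" by simp
    have "same W (lin 1 V (-1) (lin 1 V (-1) W))" using assms by (simp add: same_def lin_left lin_closed)
    hence "form_norm W = form_norm (lin 1 V (-1) (lin 1 V (-1) W))" using assms by (intro same_form_norm lin_closed) auto
    also have "\<dots> \<le> form_norm V + form_norm (lin 1 V (-1) W)"
      using triangle[of V "lin 1 V (-1) W" 1 "-1"] assms by (simp add: lin_closed)
    finally show "form_norm W \<le> form_norm V + form_norm (lin 1 V (-1) W)" .
  qed
  thus ?thesis by linarith
qed

text \<open>Write \<open>T h Y = Y + h (Z + D h)\<close> with \<open>D h\<close> tending to 0 and
  expand the square in one argument after the other; the pairings with \<open>T h Y\<close> converge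
  by strong continuity at time 0.\<close>

lemma has_right_derivative_square_norm:
  assumes T: "C0_semigroup X lin form_norm T" and YZ: "(Y, Z) \<in> semigroup_generator X lin form_norm T"
  shows "((\<lambda>h. (B (T h Y) (T h Y) - B Y Y) / h) \<longlongrightarrow> 2 * B Z Y) (at_right 0)"
proof -
  have X [simp]: "Y \<in> X" "Z \<in> X"
    and lim: "((\<lambda>h. form_norm (lin 1 (lin (1 / h) (T h Y) (- 1 / h) Y) (-1) Z)) \<longlongrightarrow> 0) (at_right 0)"
    using YZ by (auto simp: semigroup_generator_def)
  have TX [simp]: "T s U \<in> X" if "s \<ge> 0" "U \<in> X" for s U using T that by (auto simp: C0_semigroup_def)
  define D where "D h = lin 1 (lin (1 / h) (T h Y) (- 1 / h) Y) (-1) Z" for h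
  have DX [simp]: "D h \<in> X" if "h \<ge> 0" for h using that by (simp add: D_def lin_closed)
  have T0: "form_norm (lin 1 (T 0 Y) (-1) Y) = 0" using T by (auto simp: C0_semigroup_def)
  have "((\<lambda>s. form_norm (lin 1 (T s Y) (-1) (T 0 Y))) \<longlongrightarrow> 0) (at 0 within {0..})"
    using T by (auto simp: C0_semigroup_def)
  hence lim0: "((\<lambda>s. form_norm (lin 1 (T s Y) (-1) (T 0 Y))) \<longlongrightarrow> 0) (at_right 0)"
    by (rule tendsto_within_subset) auto
  \<comment> \<open>Continuity at 0 concerns \<open>T 0 Y\<close>, which is only another
    representative of \<open>Y\<close>.\<close>
  have s0: "same (T 0 Y) Y" using T0 by (intro same_if_dist_0) auto
  have "form_norm (lin 1 (T h Y) (-1) (T 0 Y)) = form_norm (lin 1 (T h Y) (-1) Y)" if "h > 0" for h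
    using that s0 by (intro same_form_norm same_lin lin_closed) (auto simp: same_def)
  hence lim1: "((\<lambda>h. form_norm (lin 1 (T h Y) (-1) Y)) \<longlongrightarrow> 0) (at_right 0)"
    by (intro Lim_transform_eventually[OF lim0])
       (auto simp: eventually_at_right_field intro!: exI[of _ 1])
  have BT: "((\<lambda>h. B U (T h Y)) \<longlongrightarrow> B U Y) (at_right 0)" if [simp]: "U \<in> X" for U
  proof (rule tendsto_if_dist_le)
    show "((\<lambda>h. form_norm U * form_norm (lin 1 (T h Y) (-1) Y)) \<longlongrightarrow> 0) (at_right 0)"
      by (rule tendsto_mult_right_zero[OF lim1])
    have "\<bar>B U (T h Y) - B U Y\<bar> \<le> form_norm U * form_norm (lin 1 (T h Y) (-1) Y)" if "h > 0" for h
      using Cauchy_Schwarz[of U "lin 1 (T h Y) (-1) Y"] that by (simp add: lin_closed lin_right)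
    thus "\<forall>\<^sub>F h in at_right 0. \<bar>B U (T h Y) - B U Y\<bar> \<le> form_norm U * form_norm (lin 1 (T h Y) (-1) Y)"
      by (auto simp: eventually_at_right_field intro!: exI[of _ 1])
  qed
  have PT: "((\<lambda>h. form_norm (T h Y)) \<longlongrightarrow> form_norm Y) (at_right 0)"
  proof (rule tendsto_if_dist_le)
    show "((\<lambda>h. form_norm (lin 1 (T h Y) (-1) Y)) \<longlongrightarrow> 0) (at_right 0)" by (rule lim1)
    show "\<forall>\<^sub>F h in at_right 0. \<bar>form_norm (T h Y) - form_norm Y\<bar> \<le> form_norm (lin 1 (T h Y) (-1) Y)"
      using form_norm_diff_le by (auto simp: eventually_at_right_field intro!: exI[of _ 1])
  qed
  have DT: "((\<lambda>h. B (D h) (T h Y)) \<longlongrightarrow> 0) (at_right 0)"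
  proof (rule tendsto_if_dist_le)
    show "((\<lambda>h. form_norm (D h) * form_norm (T h Y)) \<longlongrightarrow> 0) (at_right 0)"
      using tendsto_mult[OF lim PT] by (simp add: D_def)
    show "\<forall>\<^sub>F h in at_right 0. \<bar>B (D h) (T h Y) - 0\<bar> \<le> form_norm (D h) * form_norm (T h Y)"
      using Cauchy_Schwarz by (auto simp: eventually_at_right_field intro!: exI[of _ 1])
  qed
  have DY: "((\<lambda>h. B (D h) Y) \<longlongrightarrow> 0) (at_right 0)"
  proof (rule tendsto_if_dist_le)
    show "((\<lambda>h. form_norm (D h) * form_norm Y) \<longlongrightarrow> 0) (at_right 0)"
      using tendsto_mult_left_zero[OF lim] by (simp add: D_def)
    show "\<forall>\<^sub>F h in at_right 0. \<bar>B (D h) Y - 0\<bar> \<le> form_norm (D h) * form_norm Y"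
      using Cauchy_Schwarz by (auto simp: eventually_at_right_field intro!: exI[of _ 1])
  qed
  have "(B (T h Y) (T h Y) - B Y Y) / h = B (D h) (T h Y) + B Z (T h Y) + B (D h) Y + B Z Y" if "h > 0" for h
  proof -
    have D: "B (T h Y) U = B Y U + h * (B Z U + B (D h) U)" if "U \<in> X" for U
      using that \<open>h > 0\<close> by (simp add: D_def lin_left lin_closed field_simps)
    have "B (T h Y) (T h Y) = B (T h Y) Y + h * (B Z (T h Y) + B (D h) (T h Y))"
      using D[of "T h Y"] that sym[of Y "T h Y"] by simp
    also have "\<dots> = B Y Y + h * (B Z Y + B (D h) Y + B Z (T h Y) + B (D h) (T h Y))"
      using D[of Y] by (simp add: algebra_simps)
    finally show ?thesis using that by simp
  qed
  moreover have "((\<lambda>h. B (D h) (T h Y) + B Z (T h Y) + B (D h) Y + B Z Y) \<longlongrightarrow> 0 + B Z Y + 0 + B Z Y) (at_right 0)"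
    by (intro tendsto_add DT BT DY tendsto_const) auto
  ultimately have "((\<lambda>h. (B (T h Y) (T h Y) - B Y Y) / h) \<longlongrightarrow> 0 + B Z Y + 0 + B Z Y) (at_right 0)"
    by (elim Lim_transform_eventually)
       (auto simp: eventually_at_right_field intro!: exI[of _ 1])
  thus ?thesis by simp
qed

text \<open>The right derivative of \<open>exp (2 * k * t) * q t\<close> is
  \<open>2 * exp (2 * k * t) * (B Z Y + k * q t)\<close> with \<open>(Y, Z)\<close> the point of the
  generator reached at time \<open>t\<close>; dissipativity makes it nonpositive.\<close>

lemma generator_decay:
  assumes T: "C0_semigroup X lin form_norm T"
    and diss: "\<And>Y Z. (Y, Z) \<in> semigroup_generator X lin form_norm T \<Longrightarrow> B Z Y \<le> - k * B Y Y"
    and VW: "(V, W) \<in> semigroup_generator X lin form_norm T" and "t \<ge> 0"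
  shows "B (T t V) (T t V) \<le> exp (- 2 * k * t) * B V V"
proof -
  have X [simp]: "V \<in> X" "W \<in> X" using VW by (auto simp: semigroup_generator_def)
  have TX [simp]: "T s U \<in> X" if "s \<ge> 0" "U \<in> X" for s U using T that by (auto simp: C0_semigroup_def)
  define q where "q t = B (T t V) (T t V)" for t
  have contP: "continuous_on {0..} (\<lambda>t. form_norm (T t V))" unfolding continuous_on_def
  proof
    fix t :: real assume t: "t \<in> {0..}"
    show "((\<lambda>s. form_norm (T s V)) \<longlongrightarrow> form_norm (T t V)) (at t within {0..})"
    proof (rule tendsto_if_dist_le)
    show "((\<lambda>s. form_norm (lin 1 (T s V) (-1) (T t V))) \<longlongrightarrow> 0) (at t within {0..})"
      using T t by (auto simp: C0_semigroup_def)
    show "\<forall>\<^sub>F s in at t within {0..}. \<bar>form_norm (T s V) - form_norm (T t V)\<bar> \<le> form_norm (lin 1 (T s V) (-1) (T t V))"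
      using form_norm_diff_le t by (simp add: eventually_at_filter)
    qed
  qed
  have "continuous_on {0..} q"
    by (rule continuous_on_eq[OF continuous_on_power[OF contP, of 2]]) (simp add: form_norm_square q_def)
  have "exp (2 * k * t) * q t \<le> exp (2 * k * 0) * q 0"
  proof (rule right_derivative_nonpos_imp_le[where f = "\<lambda>t. exp (2 * k * t) * q t"])
    show "continuous_on {0..t} (\<lambda>t. exp (2 * k * t) * q t)"
      by (intro continuous_intros continuous_on_subset[OF \<open>continuous_on {0..} q\<close>]) auto
    fix s assume s: "0 \<le> s" "s < t"
    let ?Y = "T s V" and ?Z = "T s W"
    have g: "(?Y, ?Z) \<in> semigroup_generator X lin form_norm T" by (rule generator_invariant[OF T VW s(1)])
    have "((\<lambda>h. (B (T h ?Y) (T h ?Y) - B ?Y ?Y) / h) \<longlongrightarrow> 2 * B ?Z ?Y) (at_right 0)"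
      by (rule has_right_derivative_square_norm[OF T g])
    moreover have "B (T h ?Y) (T h ?Y) = q (s + h)" if "h > 0" for h
    proof -
      have "same (T (h + s) V) (T h (T s V))"
        using T that s by (intro same_if_dist_0) (auto simp: C0_semigroup_def lin_closed)
      hence "form_norm (T (h + s) V) = form_norm (T h (T s V))" using that s by (intro same_form_norm) auto
      hence "(form_norm (T h (T s V)))\<^sup>2 = (form_norm (T (h + s) V))\<^sup>2" by simp
      thus ?thesis using that s by (simp add: form_norm_square q_def add.commute)
    qed
    ultimately have "((\<lambda>h. (q (s + h) - q s) / h) \<longlongrightarrow> 2 * B ?Z ?Y) (at_right 0)"
      by (elim Lim_transform_eventually)
         (auto simp: eventually_at_right_field q_def intro!: exI[of _ 1])
    hence q': "(q has_real_derivative 2 * B ?Z ?Y) (at_right s)"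
      unfolding has_field_derivative_iff
      \<comment> \<open>The limit at \<open>s\<close> from the right is translated to one at 0,
        where the difference quotient is expressed by the increment \<open>h\<close>.\<close>
      by (subst at_right_to_0) (simp add: filterlim_filtermap add.commute)
    have "((\<lambda>t. exp (2 * k * t) * q t) has_real_derivative
        exp (2 * k * s) * (2 * B ?Z ?Y) + (exp (2 * k * s) * (2 * k)) * q s) (at_right s)"
      by (auto intro!: derivative_eq_intros q')
    moreover have "exp (2 * k * s) * (2 * B ?Z ?Y) + (exp (2 * k * s) * (2 * k)) * q s
      = 2 * exp (2 * k * s) * (B ?Z ?Y + k * q s)" by (simp add: algebra_simps)
    moreover have "B ?Z ?Y + k * q s \<le> 0" using diss[OF g] by (simp add: q_def)
    ultimately show "\<exists>D\<le>0. ((\<lambda>t. exp (2 * k * t) * q t) has_real_derivative D) (at_right s)"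
      by (metis (no_types, lifting) exp_ge_zero mult_nonneg_nonpos zero_le_mult_iff zero_le_numeral)
  qed (use \<open>t \<ge> 0\<close> in auto)
  moreover have "q 0 = B V V"
  proof -
    have "same (T 0 V) V" using T by (intro same_if_dist_0) (auto simp: C0_semigroup_def)
    hence "form_norm (T 0 V) = form_norm V" by (intro same_form_norm) auto
    hence "(form_norm (T 0 V))\<^sup>2 = (form_norm V)\<^sup>2" by simp
    thus ?thesis by (simp add: form_norm_square q_def)
  qed
  ultimately show ?thesis by (simp add: q_def exp_minus field_simps)
qed

lemma tendsto_form_norm:
  assumes "V \<in> X" "\<And>i. Vs i \<in> X" "((\<lambda>i. form_norm (lin 1 (Vs i) (-1) V)) \<longlongrightarrow> 0) F"
  shows "((\<lambda>i. form_norm (Vs i)) \<longlongrightarrow> form_norm V) F"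
  by (rule tendsto_if_dist_le[OF assms(3)]) (simp add: form_norm_diff_le assms)

text \<open>Split the difference as \<open>B (Ws i - W) (Vs i) + B W (Vs i - V)\<close> and use that
  the norms of \<open>Vs i\<close> stay bounded since they converge. Used for graph limits here and
  later for products of \<open>L2\<close> limits.\<close>

lemma tendsto_form:
  assumes [simp]: "V \<in> X" "W \<in> X" "\<And>i. Vs i \<in> X" "\<And>i. Ws i \<in> X"
    and lims: "((\<lambda>i. form_norm (lin 1 (Vs i) (-1) V)) \<longlongrightarrow> 0) F" "((\<lambda>i. form_norm (lin 1 (Ws i) (-1) W)) \<longlongrightarrow> 0) F"
  shows "((\<lambda>i. B (Ws i) (Vs i)) \<longlongrightarrow> B W V) F"
proof (rule tendsto_if_dist_le)
  have PV: "((\<lambda>i. form_norm (Vs i)) \<longlongrightarrow> form_norm V) F" by (rule tendsto_form_norm) (simp_all add: lims)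
  show "((\<lambda>i. form_norm (lin 1 (Ws i) (-1) W) * form_norm (Vs i) + form_norm W * form_norm (lin 1 (Vs i) (-1) V)) \<longlongrightarrow> 0) F"
    using tendsto_add[OF tendsto_mult[OF lims(2) PV] tendsto_mult_right_zero[OF lims(1), of "form_norm W"]] by simp
  have "\<bar>B (Ws i) (Vs i) - B W V\<bar> \<le> form_norm (lin 1 (Ws i) (-1) W) * form_norm (Vs i) + form_norm W * form_norm (lin 1 (Vs i) (-1) V)" for i
  proof -
    have "B (Ws i) (Vs i) - B W V = B (lin 1 (Ws i) (-1) W) (Vs i) + B W (lin 1 (Vs i) (-1) V)"
      by (simp add: lin_left lin_right lin_closed)
    also have "\<bar>\<dots>\<bar> \<le> form_norm (lin 1 (Ws i) (-1) W) * form_norm (Vs i) + form_norm W * form_norm (lin 1 (Vs i) (-1) V)"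
      by (intro order_trans[OF abs_triangle_ineq] add_mono Cauchy_Schwarz) (auto simp: lin_closed)
    finally show ?thesis .
  qed
  thus "\<forall>\<^sub>F i in F. \<bar>B (Ws i) (Vs i) - B W V\<bar>
      \<le> form_norm (lin 1 (Ws i) (-1) W) * form_norm (Vs i) + form_norm W * form_norm (lin 1 (Vs i) (-1) V)" by simp
qed

text \<open>Both sides are continuous under convergence of the pair. This carries the inequality
  from the \<open>H\<^sup>2\<close> domain, where Green's formula is available, to the whole
  generator.\<close>

lemma graph_closure_dissipative:
  assumes A: "\<And>Y Z. (Y, Z) \<in> A \<Longrightarrow> Y \<in> X \<and> Z \<in> X \<and> B Z Y \<le> - k * B Y Y"
    and VW: "(V, W) \<in> graph_closure X lin form_norm A"
  shows "B W V \<le> - k * B V V"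
proof -
  obtain Vs Ws where VWs: "\<And>i. (Vs i, Ws i) \<in> A" and [simp]: "V \<in> X" "W \<in> X"
    and lims: "(\<lambda>i. form_norm (lin 1 (Vs i) (-1) V)) \<longlonglongrightarrow> 0" "(\<lambda>i. form_norm (lin 1 (Ws i) (-1) W)) \<longlonglongrightarrow> 0"
    using VW by (auto simp: graph_closure_def seq_limit_def)
  have [simp]: "Vs i \<in> X" "Ws i \<in> X" for i using A VWs by auto
  have PV: "(\<lambda>i. form_norm (Vs i)) \<longlonglongrightarrow> form_norm V" by (rule tendsto_form_norm) (simp_all add: lims)
  have 1: "(\<lambda>i. B (Ws i) (Vs i)) \<longlonglongrightarrow> B W V" by (rule tendsto_form) (simp_all add: lims)
  have "(\<lambda>i. - k * (form_norm (Vs i))\<^sup>2) \<longlonglongrightarrow> - k * (form_norm V)\<^sup>2" by (intro tendsto_intros PV)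
  hence 2: "(\<lambda>i. - k * B (Vs i) (Vs i)) \<longlonglongrightarrow> - k * B V V" by (simp add: form_norm_square)
  show ?thesis
    by (rule LIMSEQ_le[OF 1 2]) (use A VWs in auto)
qed

end

section \<open>Semigroups and generators under an equivalent norm\<close>

lemma C0_semigroup_equivalent_norm:
  assumes T: "C0_semigroup X lin N T"
    and lin: "\<And>V W \<alpha> \<beta>. V \<in> X \<Longrightarrow> W \<in> X \<Longrightarrow> lin \<alpha> V \<beta> W \<in> X"
    and NP: "\<And>V. V \<in> X \<Longrightarrow> 0 \<le> P V \<and> P V \<le> N V \<and> N V \<le> c * P V"
  shows "C0_semigroup X lin P T"
proof -
  have TX: "T s U \<in> X" if "s \<ge> 0" "U \<in> X" for s U using T that by (auto simp: C0_semigroup_def)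
  have P0: "P V = 0" if "V \<in> X" "N V = 0" for V using NP[OF that(1)] that(2) by simp
  have "\<exists>M. \<forall>V\<in>X. P (T t V) \<le> M * P V" if t: "t \<ge> 0" for t
  proof -
    have "\<exists>M. \<forall>U\<in>X. N (T t U) \<le> M * N U"
      using T t unfolding C0_semigroup_def by simp
    then obtain M where M: "\<And>U. U \<in> X \<Longrightarrow> N (T t U) \<le> M * N U" by blast
    \<comment> \<open>The operator bound \<open>M\<close> may be negative when all norms vanish;
      \<open>max M 0\<close> can be multiplied into inequalities.\<close>
    have "P (T t U) \<le> max M 0 * c * P U" if U: "U \<in> X" for U
    proof -
      have "P (T t U) \<le> M * N U" using NP[OF TX[OF t U]] M[OF U] by simp
      also have "\<dots> \<le> max M 0 * N U" using NP[OF U] by (intro mult_right_mono) auto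
      also have "\<dots> \<le> max M 0 * (c * P U)" using NP[OF U] by (intro mult_left_mono) auto
      finally show ?thesis by simp
    qed
    thus ?thesis by blast
  qed
  moreover have "((\<lambda>s. P (lin 1 (T s V) (-1) (T t V))) \<longlongrightarrow> 0) (at t within {0..})"
    if "t \<ge> 0" "V \<in> X" for t V
  proof (rule tendsto_sandwich[OF _ _ tendsto_const])
    show "((\<lambda>s. N (lin 1 (T s V) (-1) (T t V))) \<longlongrightarrow> 0) (at t within {0..})"
      using T that by (simp add: C0_semigroup_def)
    have "\<forall>\<^sub>F s in at t within {0..}. lin 1 (T s V) (-1) (T t V) \<in> X"
      using lin TX that by (simp add: eventually_at_filter)
    thus "\<forall>\<^sub>F s in at t within {0..}. 0 \<le> P (lin 1 (T s V) (-1) (T t V))"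
      "\<forall>\<^sub>F s in at t within {0..}. P (lin 1 (T s V) (-1) (T t V)) \<le> N (lin 1 (T s V) (-1) (T t V))"
      by (eventually_elim, use NP in blast)+
  qed
  moreover have "P (lin 1 (T t (lin \<alpha> V \<beta> W)) (-1) (lin \<alpha> (T t V) \<beta> (T t W))) = 0"
    if "t \<ge> 0" "V \<in> X" "W \<in> X" for t V W \<alpha> \<beta>
    by (rule P0) (use T that in \<open>auto simp: C0_semigroup_def lin\<close>)
  moreover have "P (lin 1 (T 0 V) (-1) V) = 0" if "V \<in> X" for V
    by (rule P0) (use T that in \<open>auto simp: C0_semigroup_def lin\<close>)
  moreover have "P (lin 1 (T (s + t) V) (-1) (T s (T t V))) = 0" if "s \<ge> 0" "t \<ge> 0" "V \<in> X" for s t V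
    by (rule P0) (use T that in \<open>auto simp: C0_semigroup_def lin\<close>)
  ultimately show ?thesis
    unfolding C0_semigroup_def using TX
    by (intro conjI allI ballI impI) assumption+
qed

lemma tendsto_zero_equivalent_norm:
  fixes P N :: "'v \<Rightarrow> real"
  assumes NP: "\<And>V. V \<in> X \<Longrightarrow> 0 \<le> P V \<and> P V \<le> N V \<and> N V \<le> c * P V"
    and ev: "\<forall>\<^sub>F i in F. f i \<in> X"
  shows "((\<lambda>i. P (f i)) \<longlongrightarrow> 0) F \<longleftrightarrow> ((\<lambda>i. N (f i)) \<longlongrightarrow> 0) F"
proof
  assume "((\<lambda>i. P (f i)) \<longlongrightarrow> 0) F"
  hence *: "((\<lambda>i. c * P (f i)) \<longlongrightarrow> 0) F" by (rule tendsto_mult_right_zero)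
  show "((\<lambda>i. N (f i)) \<longlongrightarrow> 0) F"
    by (rule tendsto_sandwich[OF _ _ tendsto_const *]; use ev in eventually_elim; use NP in force)
next
  assume *: "((\<lambda>i. N (f i)) \<longlongrightarrow> 0) F"
  show "((\<lambda>i. P (f i)) \<longlongrightarrow> 0) F"
    by (rule tendsto_sandwich[OF _ _ tendsto_const *]; use ev in eventually_elim; use NP in force)
qed

text \<open>Generation is assumed for the energy norm, whereas dissipativity holds for the norm of
  the modified weight. Null limits, boundedness and null vectors are the same for both, and the
  notions involved are built from nothing else.\<close>

lemma generates_equivalent_norm:
  assumes gen: "generates X lin N A T"
    and lin: "\<And>V W \<alpha> \<beta>. V \<in> X \<Longrightarrow> W \<in> X \<Longrightarrow> lin \<alpha> V \<beta> W \<in> X"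
    and NP: "\<And>V. V \<in> X \<Longrightarrow> 0 \<le> P V \<and> P V \<le> N V \<and> N V \<le> c * P V"
    and A: "A \<subseteq> X \<times> X"
  shows "generates X lin P A T"
proof -
  have T: "C0_semigroup X lin N T" and eq: "semigroup_generator X lin N T = graph_closure X lin N A"
    using gen by (auto simp: generates_def)
  have TX: "T s U \<in> X" if "s \<ge> 0" "U \<in> X" for s U using T that by (auto simp: C0_semigroup_def)
  have "((\<lambda>h. P (lin 1 (lin (1 / h) (T h V) (- 1 / h) V) (-1) W)) \<longlongrightarrow> 0) (at_right 0) \<longleftrightarrow>
      ((\<lambda>h. N (lin 1 (lin (1 / h) (T h V) (- 1 / h) V) (-1) W)) \<longlongrightarrow> 0) (at_right 0)"
    if "V \<in> X" "W \<in> X" for V W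
    by (rule tendsto_zero_equivalent_norm[OF NP])
       (auto simp: eventually_at_right_field that lin TX intro!: exI[of _ 1])
  hence "semigroup_generator X lin P T = semigroup_generator X lin N T"
    by (auto simp: semigroup_generator_def)
  moreover have "graph_closure X lin P A = graph_closure X lin N A"
  proof -
    have "seq_limit lin P Vs V \<longleftrightarrow> seq_limit lin N Vs V" if "\<And>i. Vs i \<in> X" "V \<in> X" for Vs V
      unfolding seq_limit_def
      by (rule tendsto_zero_equivalent_norm[OF NP]) (auto simp: that lin)
    hence "(\<forall>i. (Vs i, Ws i) \<in> A) \<and> seq_limit lin P Vs V \<and> seq_limit lin P Ws W \<longleftrightarrow>
        (\<forall>i. (Vs i, Ws i) \<in> A) \<and> seq_limit lin N Vs V \<and> seq_limit lin N Ws W"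
      if "V \<in> X" "W \<in> X" for V W Vs Ws
      using that A by (meson SigmaD1 SigmaD2 subsetD)
    hence "(V, W) \<in> graph_closure X lin P A \<longleftrightarrow> (V, W) \<in> graph_closure X lin N A" for V W
      unfolding graph_closure_def mem_Collect_eq prod.case
      by - (rule conj_cong[OF refl], rule conj_cong[OF refl], rule iff_exI, rule iff_exI)
    thus ?thesis by auto
  qed
  ultimately show ?thesis
    using eq C0_semigroup_equivalent_norm[OF T lin NP] unfolding generates_def by metis
qed

section \<open>C1 partitions of unity\<close>

lemma C1_has_derivative:
  "C1_with_gradient f f' \<Longrightarrow> (f has_derivative (\<lambda>h. h \<bullet> f' x)) (at x)"
  by (simp add: C1_with_gradient_def gderiv_def)

lemma C1_continuous: "C1_with_gradient f f' \<Longrightarrow> continuous_on S f"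
  by (meson C1_has_derivative continuous_at_imp_continuous_on has_derivative_continuous)

lemma C1_continuous_gradient: "C1_with_gradient f f' \<Longrightarrow> continuous_on S f'"
  by (meson C1_with_gradient_def continuous_on_subset subset_UNIV)

lemma C1_const: "C1_with_gradient (\<lambda>x. c) (\<lambda>x. 0)"
  by (simp add: C1_with_gradient_def GDERIV_const)

lemma C1_inner: "C1_with_gradient (\<lambda>x. x \<bullet> e) (\<lambda>x. e)"
  unfolding C1_with_gradient_def gderiv_def by (auto intro!: derivative_eq_intros)

lemma C1_add:
  "C1_with_gradient f f' \<Longrightarrow> C1_with_gradient g g' \<Longrightarrow>
    C1_with_gradient (\<lambda>x. f x + g x) (\<lambda>x. f' x + g' x)"
  unfolding C1_with_gradient_def by (auto intro: GDERIV_add continuous_on_add)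

lemma C1_mult:
  assumes "C1_with_gradient f f'" "C1_with_gradient g g'"
  shows "C1_with_gradient (\<lambda>x. f x * g x) (\<lambda>x. f x *\<^sub>R g' x + g x *\<^sub>R f' x)"
  using assms C1_continuous[OF assms(1)] C1_continuous[OF assms(2)]
  unfolding C1_with_gradient_def by (auto intro!: GDERIV_mult continuous_intros)

lemma C1_cmult: "C1_with_gradient f f' \<Longrightarrow> C1_with_gradient (\<lambda>x. c * f x) (\<lambda>x. c *\<^sub>R f' x)"
  using C1_mult[OF C1_const[of c]] by simp

lemma C1_sum:
  "(\<And>i. i \<in> I \<Longrightarrow> C1_with_gradient (f i) (f' i)) \<Longrightarrow>
    C1_with_gradient (\<lambda>x. \<Sum>i\<in>I. f i x) (\<lambda>x. \<Sum>i\<in>I. f' i x)"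
  by (induction I rule: infinite_finite_induct) (simp_all add: C1_const C1_add)

lemma C1_compose:
  assumes "\<And>y. (h has_real_derivative h' y) (at y)" "continuous_on UNIV h'" "C1_with_gradient f f'"
  shows "C1_with_gradient (\<lambda>x. h (f x)) (\<lambda>x. h' (f x) *\<^sub>R f' x)"
  unfolding C1_with_gradient_def
proof
  show "\<forall>x. GDERIV (\<lambda>x. h (f x)) x :> h' (f x) *\<^sub>R f' x"
    using assms(1,3) by (auto simp: C1_with_gradient_def intro: GDERIV_DERIV_compose)
  show "continuous_on UNIV (\<lambda>x. h' (f x) *\<^sub>R f' x)"
    by (intro continuous_intros C1_continuous_gradient[OF assms(3)]
        continuous_on_compose2[OF assms(2)] C1_continuous[OF assms(3)]) auto
qed

lemma C1_dist_square: "C1_with_gradient (\<lambda>x. (norm (x - p))\<^sup>2) (\<lambda>x. 2 *\<^sub>R (x - p))"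
  unfolding C1_with_gradient_def gderiv_def power2_norm_eq_inner
  by (auto intro!: derivative_eq_intros continuous_intros simp: inner_commute algebra_simps)

lemma C1_gradient_unique:
  assumes "C1_with_gradient f f'" "C1_with_gradient g g'" "open S" "x \<in> S" "\<And>y. y \<in> S \<Longrightarrow> f y = g y"
  shows "f' x = g' x"
proof -
  have "(g has_derivative (\<lambda>h. h \<bullet> f' x)) (at x)"
    by (rule has_derivative_transform_within_open[OF C1_has_derivative[OF assms(1)] assms(3,4)])
       (use assms(5) in auto)
  hence "(\<lambda>h. h \<bullet> f' x) = (\<lambda>h. h \<bullet> g' x)"
    using C1_has_derivative[OF assms(2)] has_derivative_unique by blast
  thus ?thesis by (metis inner_commute inner_eq_zero_iff inner_diff_right right_minus_eq)
qed

lemma C1_gradient_zero: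
  assumes "C1_with_gradient f f'" "closed K" "\<And>x. x \<notin> K \<Longrightarrow> f x = 0" "x \<notin> K"
  shows "f' x = 0"
  using C1_gradient_unique[OF assms(1) C1_const[of 0], of "- K" x] assms by auto

text \<open>The simplest \<open>C\<^sup>1\<close> function that vanishes exactly on a half line.
  Test functions here are only required to be \<open>C\<^sup>1\<close>, so all cutoffs and kernels
  below are built from it.\<close>

definition pos_square :: "real \<Rightarrow> real" where "pos_square x = (max 0 x)\<^sup>2"

lemma pos_square_nonneg: "0 \<le> pos_square x" by (simp add: pos_square_def)

lemma pos_square_pos_iff: "0 < pos_square x \<longleftrightarrow> 0 < x" by (auto simp: pos_square_def max_def)

lemma pos_square_eq_0_iff: "pos_square x = 0 \<longleftrightarrow> x \<le> 0" by (auto simp: pos_square_def max_def)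

lemma DERIV_pos_square: "(pos_square has_real_derivative 2 * max 0 x) (at x)"
proof -
  have "x < 0 \<or> x = 0 \<or> x > 0" by auto
  thus ?thesis
  proof (elim disjE)
    assume "x < 0"
    have "((\<lambda>x. 0) has_real_derivative 0) (at x)" by simp
    hence "(pos_square has_real_derivative 0) (at x)"
      by (rule DERIV_cong_ev[THEN iffD1, rotated 3])
         (use \<open>x < 0\<close> in \<open>auto simp: pos_square_def eventually_nhds intro!: exI[of _ "{..<0}"]\<close>)
    thus ?thesis using \<open>x < 0\<close> by simp
  next
    assume "x > 0"
    have "((\<lambda>x. x\<^sup>2) has_real_derivative 2 * x) (at x)" by (auto intro!: derivative_eq_intros)
    hence "(pos_square has_real_derivative 2 * x) (at x)"
      by (rule DERIV_cong_ev[THEN iffD1, rotated 3])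
         (use \<open>x > 0\<close> in \<open>auto simp: pos_square_def eventually_nhds intro!: exI[of _ "{0<..}"]\<close>)
    thus ?thesis using \<open>x > 0\<close> by simp
  next
    assume "x = 0"
    have "((\<lambda>h. \<bar>h\<bar>) \<longlongrightarrow> \<bar>0::real\<bar>) (at 0)" by (intro tendsto_intros)
    hence "((\<lambda>h. pos_square h / h) \<longlongrightarrow> 0) (at 0)"
      by (elim Lim_null_comparison[rotated, OF tendsto_eq_rhs])
         (auto simp: pos_square_def max_def power2_eq_square)
    thus ?thesis using \<open>x = 0\<close> by (simp add: has_field_derivative_iff pos_square_def)
  qed
qed

lemma C1_pos_square:
  "C1_with_gradient f f' \<Longrightarrow> C1_with_gradient (\<lambda>x. pos_square (f x)) (\<lambda>x. (2 * max 0 (f x)) *\<^sub>R f' x)"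
  by (rule C1_compose[OF DERIV_pos_square]) (auto intro!: continuous_intros)

text \<open>A \<open>C\<^sup>1\<close> function on the whole line that equals \<open>1 / s\<close>
  for \<open>s \<ge> d\<close>. It allows division by a sum of bumps that vanishes somewhere outside
  the compact set of interest.\<close>

definition recip_from :: "real \<Rightarrow> real \<Rightarrow> real" where
  "recip_from d s = s / (s\<^sup>2 + pos_square (d - s))"

lemma recip_from_eq: "d > 0 \<Longrightarrow> d \<le> s \<Longrightarrow> recip_from d s = 1 / s"
  by (simp add: recip_from_def pos_square_def power2_eq_square)

lemma C1_recip_from:
  assumes "d > 0" "C1_with_gradient f f'"
  shows "\<exists>g'. C1_with_gradient (\<lambda>x. recip_from d (f x)) g'"
proof -
  define q where "q s = s\<^sup>2 + pos_square (d - s)" for s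
  have q: "q s > 0" for s
    using assms(1) by (cases "s = 0") (auto simp: q_def pos_square_nonneg pos_square_pos_iff add_pos_nonneg)
  have q': "(q has_real_derivative 2 * s - 2 * max 0 (d - s)) (at s)" for s unfolding q_def
    by (rule derivative_eq_intros DERIV_chain'[OF _ DERIV_pos_square] refl | simp)+
  have contq: "continuous_on UNIV q"
    using q' by (meson DERIV_isCont continuous_at_imp_continuous_on)
  have "(recip_from d has_real_derivative (1 * q s - s * (2 * s - 2 * max 0 (d - s))) / (q s * q s)) (at s)" for s
    unfolding recip_from_def q_def[symmetric]
    by (rule DERIV_divide[OF DERIV_ident q']) (use q[of s] in auto)
  moreover have "continuous_on UNIV (\<lambda>s. (1 * q s - s * (2 * s - 2 * max 0 (d - s))) / (q s * q s))"
    using q by (intro continuous_intros contq) (auto simp: less_le)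
  ultimately show ?thesis using C1_compose[OF _ _ assms(2)] by fast
qed

definition ball_bump :: "'a::euclidean_space \<Rightarrow> real \<Rightarrow> 'a \<Rightarrow> real" where
  "ball_bump p r x = pos_square (r\<^sup>2 - (norm (x - p))\<^sup>2)"

lemma C1_ball_bump: "\<exists>g'. C1_with_gradient (ball_bump p r) g'"
  using C1_pos_square[OF C1_add[OF C1_const[of "r\<^sup>2"] C1_cmult[OF C1_dist_square[of p], of "-1"]]]
  unfolding ball_bump_def by auto

lemma ball_bump_pos: "r > 0 \<Longrightarrow> x \<in> ball p r \<Longrightarrow> 0 < ball_bump p r x"
  by (simp add: ball_bump_def pos_square_pos_iff dist_norm norm_minus_commute power_strict_mono)

lemma ball_bump_eq_0: "r > 0 \<Longrightarrow> x \<notin> ball p r \<Longrightarrow> ball_bump p r x = 0"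
  by (simp add: ball_bump_def pos_square_eq_0_iff dist_norm norm_minus_commute power_mono)

text \<open>Bumps of a finite subcover are divided by their sum by means of
  \<open>recip_from\<close>, with threshold the minimum of the sum over \<open>K\<close>. The
  functions therefore add up to 1 on \<open>K\<close> itself, and elsewhere only the supports are
  controlled.\<close>

lemma C1_partition_of_unity:
  fixes K :: "'a::euclidean_space set"
  assumes "compact K" and r: "\<And>p. p \<in> K \<Longrightarrow> r p > 0"
  obtains I \<eta> \<eta>' where "finite I" "I \<subseteq> K" "\<And>i. i \<in> I \<Longrightarrow> C1_with_gradient (\<eta> i) (\<eta>' i)"
    "\<And>i x. i \<in> I \<Longrightarrow> x \<notin> ball i (r i) \<Longrightarrow> \<eta> i x = 0" "\<And>x. x \<in> K \<Longrightarrow> (\<Sum>i\<in>I. \<eta> i x) = 1"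
proof (cases "K = {}")
  case True
  show ?thesis by (rule that[of "{}"]) (use True in auto)
next
  case False
  have "K \<subseteq> (\<Union>p\<in>K. ball p (r p))" using r by fastforce
  then obtain I where I: "I \<subseteq> K" "finite I" "K \<subseteq> (\<Union>p\<in>I. ball p (r p))"
    by (rule compactE_image[OF assms(1), rotated]) auto
  have rI: "r i > 0" if "i \<in> I" for i using r I that by auto
  obtain \<psi>' where \<psi>': "\<And>i. C1_with_gradient (ball_bump i (r i)) (\<psi>' i)"
    by (rule that[of "\<lambda>i. SOME g. C1_with_gradient (ball_bump i (r i)) g"]) (rule someI_ex[OF C1_ball_bump])
  define S where "S x = (\<Sum>i\<in>I. ball_bump i (r i) x)" for x
  have S: "C1_with_gradient S (\<lambda>x. \<Sum>i\<in>I. \<psi>' i x)"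
    unfolding S_def by (intro C1_sum \<psi>')
  have Spos: "S x > 0" if x: "x \<in> K" for x
  proof -
    obtain i where "i \<in> I" "x \<in> ball i (r i)" using I x by blast
    thus ?thesis unfolding S_def using I rI
      by (intro sum_pos2[of _ i] ball_bump_pos) (auto simp: ball_bump_def pos_square_nonneg)
  qed
  obtain m where m: "m \<in> K" "\<And>x. x \<in> K \<Longrightarrow> S m \<le> S x"
    using continuous_attains_inf[OF assms(1) False C1_continuous[OF S]] by blast
  define d where "d = S m"
  have "d > 0" using Spos m by (simp add: d_def)
  obtain k' where k': "C1_with_gradient (\<lambda>x. recip_from d (S x)) k'"
    using C1_recip_from[OF \<open>d > 0\<close> S] by blast
  define \<eta> where "\<eta> i x = ball_bump i (r i) x * recip_from d (S x)" for i x
  have "C1_with_gradient (\<eta> i)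
      (\<lambda>x. ball_bump i (r i) x *\<^sub>R k' x + recip_from d (S x) *\<^sub>R \<psi>' i x)" for i
    unfolding \<eta>_def by (rule C1_mult[OF \<psi>' k'])
  moreover have "\<eta> i x = 0" if "i \<in> I" "x \<notin> ball i (r i)" for i x
    using ball_bump_eq_0[OF rI[OF that(1)] that(2)] by (simp add: \<eta>_def)
  moreover have "(\<Sum>i\<in>I. \<eta> i x) = 1" if "x \<in> K" for x
    using m(2)[OF that] Spos[OF that] \<open>d > 0\<close>
    unfolding \<eta>_def sum_distrib_right[symmetric] S_def[symmetric] by (simp add: recip_from_eq d_def)
  ultimately show ?thesis using I(1,2) by - (rule that)
qed

text \<open>Add up a partition of unity on \<open>K\<close> whose balls all miss
  \<open>L\<close>.\<close>

lemma C1_cutoff: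
  fixes K L :: "'a::euclidean_space set"
  assumes "compact K" "closed L" "K \<inter> L = {}"
  shows "\<exists>\<eta> \<eta>'. C1_with_gradient \<eta> \<eta>' \<and> (\<forall>x\<in>K. \<eta> x = 1) \<and> (\<forall>x\<in>L. \<eta> x = 0)"
proof -
  have "\<forall>p\<in>K. \<exists>r>0. ball p r \<inter> L = {}"
    using assms(2,3) by (metis ComplI closed_def disjoint_eq_subset_Compl disjoint_iff open_contains_ball)
  then obtain r where r: "\<And>p. p \<in> K \<Longrightarrow> r p > 0" "\<And>p. p \<in> K \<Longrightarrow> ball p (r p) \<inter> L = {}" by metis
  obtain I \<eta> \<eta>' where I: "finite I" "I \<subseteq> K"
    "\<And>i. i \<in> I \<Longrightarrow> C1_with_gradient (\<eta> i) (\<eta>' i)" "\<And>i x. i \<in> I \<Longrightarrow> x \<notin> ball i (r i) \<Longrightarrow> \<eta> i x = 0"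
    "\<And>x. x \<in> K \<Longrightarrow> (\<Sum>i\<in>I. \<eta> i x) = 1"
  proof (rule C1_partition_of_unity[where r = r, OF assms(1) r(1)], goal_cases)
    case (2 I \<eta> \<eta>')
    thus ?case by - (rule that)
  qed
  have "(\<Sum>i\<in>I. \<eta> i x) = 0" if "x \<in> L" for x
  proof (rule sum.neutral, rule)
    fix i assume "i \<in> I"
    hence "x \<notin> ball i (r i)" using r(2)[of i] I(2) that by blast
    thus "\<eta> i x = 0" using I(4) \<open>i \<in> I\<close> by blast
  qed
  thus ?thesis using C1_sum[of I \<eta> \<eta>', OF I(3)] I(5)
    by (intro exI[of _ "\<lambda>x. \<Sum>i\<in>I. \<eta> i x"] exI[of _ "\<lambda>x. \<Sum>i\<in>I. \<eta>' i x"]) auto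
qed

section \<open>The divergence theorem above a graph\<close>

text \<open>Hyperplane integrals are computed on this product of coordinate measures and not on its
  image \<open>hyperplane_lborel\<close>, so that Fubini with the coordinate \<open>b\<close>
  applies directly.\<close>

definition hyperplane_product :: "'a::euclidean_space \<Rightarrow> ('a \<Rightarrow> real) measure" where
  "hyperplane_product b = (\<Pi>\<^sub>M k\<in>Basis - {b}. lborel)"

definition hyperplane_point :: "'a::euclidean_space \<Rightarrow> ('a \<Rightarrow> real) \<Rightarrow> 'a" where
  "hyperplane_point b f = (\<Sum>k\<in>Basis - {b}. f k *\<^sub>R k)"

lemma hyperplane_lborel_eq:
  "hyperplane_lborel b = distr (hyperplane_product b) borel (hyperplane_point b)"
  by (simp add: hyperplane_lborel_def hyperplane_product_def hyperplane_point_def[abs_def])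

lemma measurable_hyperplane_point [measurable]: "hyperplane_point b \<in> borel_measurable (hyperplane_product b)"
  unfolding hyperplane_point_def[abs_def] hyperplane_product_def by measurable

lemma hyperplane_point_inner: "b \<in> Basis \<Longrightarrow> hyperplane_point b f \<bullet> b = 0"
  unfolding hyperplane_point_def inner_sum_left by (intro sum.neutral) (auto simp: inner_Basis)

lemma sigma_finite_hyperplane_product: "sigma_finite_measure (hyperplane_product (b::'a::euclidean_space))"
proof -
  interpret finite_product_sigma_finite "\<lambda>_. lborel :: real measure" "Basis - {b}" by standard simp
  show ?thesis unfolding hyperplane_product_def by (rule sigma_finite_measure_axioms)
qed

text \<open>Lebesgue measure is the image of the product over all coordinates; the coordinate
  \<open>b\<close> is split off and integrated innermost.\<close>

lemma lborel_eq_hyperplane_product: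
  assumes b: "b \<in> (Basis :: 'a::euclidean_space set)"
  shows "(lborel :: 'a measure) =
    distr (hyperplane_product b \<Otimes>\<^sub>M lborel) borel (\<lambda>p. hyperplane_point b (fst p) + snd p *\<^sub>R b)"
proof (rule measure_eqI)
  fix A :: "'a set" assume "A \<in> sets lborel"
  hence A [measurable]: "A \<in> sets borel" by simp
  interpret product_sigma_finite "\<lambda>_::'a. lborel :: real measure" by standard
  have sum: "(\<Sum>k\<in>Basis. (f(b := t)) k *\<^sub>R k) = hyperplane_point b f + t *\<^sub>R b" for f t
    unfolding hyperplane_point_def using b by (subst sum.remove[OF _ b]) (auto intro!: sum.cong)
  have ins: "insert b (Basis - {b}) = Basis" using b by auto
  have "emeasure lborel A = (\<integral>\<^sup>+ x. indicator A x \<partial>lborel)" by simp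
  also have "\<dots> = (\<integral>\<^sup>+ f. indicator A (\<Sum>k\<in>Basis. f k *\<^sub>R k) \<partial>(\<Pi>\<^sub>M k\<in>Basis. lborel))"
    by (subst lborel_eq, subst nn_integral_distr) auto
  also have "\<dots> = (\<integral>\<^sup>+ f. \<integral>\<^sup>+ t. indicator A (\<Sum>k\<in>Basis. (f(b := t)) k *\<^sub>R k) \<partial>lborel \<partial>(\<Pi>\<^sub>M k\<in>Basis - {b}. lborel))"
    using product_nn_integral_insert[of "Basis - {b}" b "\<lambda>f. indicator A (\<Sum>k\<in>Basis. f k *\<^sub>R k)"]
    unfolding ins by auto
  also have "\<dots> = (\<integral>\<^sup>+ f. \<integral>\<^sup>+ t. indicator A (hyperplane_point b f + t *\<^sub>R b) \<partial>lborel \<partial>hyperplane_product b)"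
    unfolding sum hyperplane_product_def by simp
  also have "\<dots> = (\<integral>\<^sup>+ p. indicator A (hyperplane_point b (fst p) + snd p *\<^sub>R b) \<partial>(hyperplane_product b \<Otimes>\<^sub>M lborel))"
    by (subst lborel.nn_integral_fst[symmetric]) auto
  also have "\<dots> = (\<integral>\<^sup>+ x. indicator A x \<partial>distr (hyperplane_product b \<Otimes>\<^sub>M lborel) borel
      (\<lambda>p. hyperplane_point b (fst p) + snd p *\<^sub>R b))"
    by (subst nn_integral_distr) auto
  finally show "emeasure lborel A = emeasure (distr (hyperplane_product b \<Otimes>\<^sub>M lborel) borel
      (\<lambda>p. hyperplane_point b (fst p) + snd p *\<^sub>R b)) A" by simp
qed simp

lemma hyperplane_Fubini:
  fixes F :: "'a::euclidean_space \<Rightarrow> real"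
  assumes b: "b \<in> Basis" and F: "integrable lborel F"
  shows "integral\<^sup>L lborel F = (\<integral>f. (LBINT t. F (hyperplane_point b f + t *\<^sub>R b)) \<partial>hyperplane_product b)"
    and "integrable (hyperplane_product b) (\<lambda>f. \<integral>t. F (hyperplane_point b f + t *\<^sub>R b) \<partial>lborel)"
proof -
  interpret sigma_finite_measure "hyperplane_product b" by (rule sigma_finite_hyperplane_product)
  interpret P: pair_sigma_finite "hyperplane_product b" "lborel :: real measure" by standard
  let ?G = "\<lambda>p. F (hyperplane_point b (fst p) + snd p *\<^sub>R b)"
  have Fm [measurable]: "F \<in> borel_measurable borel" using F by auto
  have i: "integrable (hyperplane_product b \<Otimes>\<^sub>M lborel) ?G"
    using F by (subst (asm) lborel_eq_hyperplane_product[OF b], subst (asm) integrable_distr_eq) auto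
  have "integral\<^sup>L lborel F = integral\<^sup>L (hyperplane_product b \<Otimes>\<^sub>M lborel) ?G"
    by (subst lborel_eq_hyperplane_product[OF b], subst integral_distr) auto
  thus "integral\<^sup>L lborel F = (\<integral>f. (LBINT t. F (hyperplane_point b f + t *\<^sub>R b)) \<partial>hyperplane_product b)"
    using P.integral_fst'[OF i] by simp
  show "integrable (hyperplane_product b) (\<lambda>f. \<integral>t. F (hyperplane_point b f + t *\<^sub>R b) \<partial>lborel)"
    using P.integrable_fst'[OF i] by simp
qed

lemma integrable_compact_support:
  fixes f :: "'a::euclidean_space \<Rightarrow> 'b::{banach, second_countable_topology}"
  assumes "continuous_on UNIV f" "compact K" "\<And>x. x \<notin> K \<Longrightarrow> f x = 0"
  shows "integrable lborel f"
proof -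
  have "(\<lambda>x. indicator K x *\<^sub>R f x) = f" using assms(3) by (auto simp: indicator_def)
  thus ?thesis using borel_integrable_compact[OF assms(2) continuous_on_subset[OF assms(1)]] by simp
qed

lemma integral_deriv_half_line:
  fixes g g' :: "real \<Rightarrow> real"
  assumes g: "\<And>t. (g has_real_derivative g' t) (at t)" and g': "continuous_on UNIV g'"
    and R: "\<And>t. \<bar>t\<bar> > R \<Longrightarrow> g t = 0" "\<And>t. \<bar>t\<bar> > R \<Longrightarrow> g' t = 0" and s: "s = 1 \<or> s = -1"
  shows "(LBINT t. indicator {t. 0 < s * t} t * g' t) = - s * g 0"
    and "(LBINT t. g' t) = 0"
proof -
  \<comment> \<open>Strictly beyond \<open>R\<close>, so that the boundary values of
    \<open>g\<close> at \<open>S\<close> and \<open>-S\<close> vanish.\<close>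
  define S where "S = \<bar>R\<bar> + 1"
  have S: "S > 0" "g S = 0" "g (-S) = 0" "\<And>t. \<bar>t\<bar> > S \<Longrightarrow> g' t = 0" by (auto simp: S_def intro!: R)
  have FTC: "(LBINT t. indicator {a..b} t *\<^sub>R g' t) = g b - g a" if "a \<le> b" for a b
    using that g by (intro integral_FTC_atLeastAtMost continuous_on_subset[OF g'])
      (auto simp: has_real_derivative_iff_has_vector_derivative intro: has_vector_derivative_at_within)
  \<comment> \<open>The open half line and the closed interval used for the fundamental theorem
    differ at 0, a null set.\<close>
  have ae: "AE t in lborel. t \<noteq> (0::real)" by (rule AE_lborel_singleton)
  have [measurable]: "g' \<in> borel_measurable borel" by (rule borel_measurable_continuous_onI[OF g'])
  have [measurable]: "{t. 0 < s * t} \<in> sets borel" by measurable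
  show "(LBINT t. indicator {t. 0 < s * t} t * g' t) = - s * g 0"
  proof (cases "s = 1")
    case True
    have "(LBINT t. indicator {t. 0 < s * t} t * g' t) = (LBINT t. indicator {0..S} t *\<^sub>R g' t)"
    proof (rule integral_cong_AE)
      show "AE t in lborel. indicator {t. 0 < s * t} t * g' t = indicator {0..S} t *\<^sub>R g' t"
        using ae by eventually_elim (use True S(4) in \<open>auto simp: indicator_def\<close>)
    qed auto
    thus ?thesis using FTC[of 0 S] S True by simp
  next
    case False
    hence s: "s = -1" using s by simp
    have "(LBINT t. indicator {t. 0 < s * t} t * g' t) = (LBINT t. indicator {-S..0} t *\<^sub>R g' t)"
    proof (rule integral_cong_AE)
      show "AE t in lborel. indicator {t. 0 < s * t} t * g' t = indicator {-S..0} t *\<^sub>R g' t"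
        using ae by eventually_elim (use s S(4) in \<open>auto simp: indicator_def\<close>)
    qed auto
    thus ?thesis using FTC[of "-S" 0] S s by simp
  qed
  have "(LBINT t. g' t) = (LBINT t. indicator {-S..S} t *\<^sub>R g' t)"
    by (rule Bochner_Integration.integral_cong) (use S(4) in \<open>force simp: indicator_def\<close>)+
  thus "(LBINT t. g' t) = 0" using FTC[of "-S" S] S by simp
qed

lemma C1_line_derivative:
  assumes "C1_with_gradient f f'"
  shows "((\<lambda>t. f (y + t *\<^sub>R b)) has_real_derivative f' (y + t *\<^sub>R b) \<bullet> b) (at t)"
proof -
  have "((\<lambda>t. y + t *\<^sub>R b) has_derivative (\<lambda>t. t *\<^sub>R b)) (at t)" by (auto intro!: derivative_eq_intros)
  from has_derivative_compose[OF this C1_has_derivative[OF assms]]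
  show ?thesis unfolding has_field_derivative_def
    by (rule has_derivative_eq_rhs) (auto simp: fun_eq_iff inner_commute)
qed

lemma compact_line_bound:
  assumes "compact K" "b \<noteq> 0"
  shows "\<exists>R. \<forall>t. \<bar>t\<bar> > R \<longrightarrow> y + t *\<^sub>R b \<notin> (K :: 'a::euclidean_space set)"
proof -
  obtain B where B: "\<And>x. x \<in> K \<Longrightarrow> norm x \<le> B"
    using assms(1) by (meson compact_imp_bounded bounded_iff)
  have "\<bar>t\<bar> \<le> (B + norm y) / norm b" if "y + t *\<^sub>R b \<in> K" for t
  proof -
    have "norm (t *\<^sub>R b) \<le> norm (y + t *\<^sub>R b) + norm y" by (metis add_diff_cancel_left' norm_triangle_ineq4 add.commute)
    also have "\<dots> \<le> B + norm y" using B[OF that] by simp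
    finally show ?thesis using assms(2) by (simp add: field_simps)
  qed
  thus ?thesis by (intro exI[of _ "(B + norm y) / norm b"]) (auto simp: not_le[symmetric])
qed

lemma C1_line_integrals:
  fixes f :: "'a::euclidean_space \<Rightarrow> real"
  assumes f: "C1_with_gradient f f'" and K: "compact K" "\<And>x. x \<notin> K \<Longrightarrow> f x = 0" and "b \<noteq> 0"
    and s: "s = 1 \<or> s = -1"
  shows "(LBINT t. indicator {t. 0 < s * t} t * (f' (y + t *\<^sub>R b) \<bullet> b)) = - s * f y"
    and "(LBINT t. f' (y + t *\<^sub>R b) \<bullet> b) = 0"
proof -
  obtain R where R: "\<And>t. \<bar>t\<bar> > R \<Longrightarrow> y + t *\<^sub>R b \<notin> K" using compact_line_bound[OF K(1) \<open>b \<noteq> 0\<close>, of y] by blast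
  have R': "f (y + t *\<^sub>R b) = 0" "f' (y + t *\<^sub>R b) \<bullet> b = 0" if "\<bar>t\<bar> > R" for t
    using K(2)[OF R[OF that]] C1_gradient_zero[OF f compact_imp_closed[OF K(1)] K(2) R[OF that]] by auto
  have c: "continuous_on UNIV (\<lambda>t. f' (y + t *\<^sub>R b) \<bullet> b)"
    by (intro continuous_intros continuous_on_compose2[OF C1_continuous_gradient[OF f, of UNIV]]) auto
  note * = integral_deriv_half_line[where g = "\<lambda>t. f (y + t *\<^sub>R b)" and R = R, OF C1_line_derivative[OF f] c R' s]
  show "(LBINT t. indicator {t. 0 < s * t} t * (f' (y + t *\<^sub>R b) \<bullet> b)) = - s * f y"
    and "(LBINT t. f' (y + t *\<^sub>R b) \<bullet> b) = 0"
    using * by simp_all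
qed

text \<open>The data of a graph chart without the domain and the open set, so that the divergence
  theorem can first be proved for the full region above a graph.\<close>

locale graph_function =
  fixes b :: "'a::euclidean_space" and s :: real and \<gamma> :: "'a \<Rightarrow> real" and \<gamma>' :: "'a \<Rightarrow> 'a"
  assumes b: "b \<in> Basis" and s: "s = 1 \<or> s = -1" and C1: "C1_with_gradient \<gamma> \<gamma>'"
    and proj: "\<And>x. \<gamma> x = \<gamma> (x - (x \<bullet> b) *\<^sub>R b)"
begin

lemma shift: "\<gamma> (x + t *\<^sub>R b) = \<gamma> x"
  using proj[of "x + t *\<^sub>R b"] proj[of x] b by (simp add: inner_add_left algebra_simps)

lemma gradient_shift: "\<gamma>' (x + t *\<^sub>R b) = \<gamma>' x"
proof (rule sym, rule C1_gradient_unique[OF C1, of "\<lambda>x. \<gamma> (x + t *\<^sub>R b)" "\<lambda>x. \<gamma>' (x + t *\<^sub>R b)" UNIV])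
  have "GDERIV (\<lambda>x. \<gamma> (x + t *\<^sub>R b)) x :> \<gamma>' (x + t *\<^sub>R b)" for x
    unfolding gderiv_def
    by (rule has_derivative_compose[OF _ C1_has_derivative[OF C1]]) (auto intro!: derivative_eq_intros)
  thus "C1_with_gradient (\<lambda>x. \<gamma> (x + t *\<^sub>R b)) (\<lambda>x. \<gamma>' (x + t *\<^sub>R b))"
    unfolding C1_with_gradient_def
    by (auto intro!: continuous_on_compose2[OF C1_continuous_gradient[OF C1, of UNIV]] continuous_intros)
qed (auto simp: shift)

lemma gradient_inner: "\<gamma>' x \<bullet> b = 0"
proof -
  have "((\<lambda>t. \<gamma> (x + t *\<^sub>R b)) has_real_derivative \<gamma>' (x + 0 *\<^sub>R b) \<bullet> b) (at 0)"
    by (rule C1_line_derivative[OF C1])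
  hence "((\<lambda>t. \<gamma> x) has_real_derivative \<gamma>' x \<bullet> b) (at 0)" by (simp add: shift)
  thus ?thesis by (rule DERIV_unique) (rule DERIV_const)
qed

text \<open>Straightens the graph: it maps the half space \<open>0 < s * (x \<bullet> b)\<close>
  onto the region above the graph and is a translation on every line parallel to \<open>b\<close>,
  hence preserves volume.\<close>

definition shear :: "'a \<Rightarrow> 'a" where "shear x = x + (s * \<gamma> x) *\<^sub>R b"

lemma C1_shear:
  assumes "C1_with_gradient \<phi> \<phi>'"
  shows "C1_with_gradient (\<lambda>x. \<phi> (shear x)) (\<lambda>x. \<phi>' (shear x) + (s * (\<phi>' (shear x) \<bullet> b)) *\<^sub>R \<gamma>' x)"
  unfolding C1_with_gradient_def
proof
  have h: "(shear has_derivative (\<lambda>v. v + (s * (v \<bullet> \<gamma>' x)) *\<^sub>R b)) (at x)" for x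
    unfolding shear_def[abs_def] by (auto intro!: derivative_eq_intros C1_has_derivative[OF C1])
  show "\<forall>x. GDERIV (\<lambda>x. \<phi> (shear x)) x :> \<phi>' (shear x) + (s * (\<phi>' (shear x) \<bullet> b)) *\<^sub>R \<gamma>' x"
    unfolding gderiv_def
  proof
    fix x
    from has_derivative_compose[OF h C1_has_derivative[OF assms]]
    show "((\<lambda>x. \<phi> (shear x)) has_derivative
        (\<lambda>v. v \<bullet> (\<phi>' (shear x) + (s * (\<phi>' (shear x) \<bullet> b)) *\<^sub>R \<gamma>' x))) (at x)"
      by (rule has_derivative_eq_rhs) (auto simp: fun_eq_iff inner_add_left inner_add_right inner_commute)
  qed
  have ch: "continuous_on UNIV shear"
    unfolding shear_def[abs_def] by (intro continuous_intros C1_continuous[OF C1])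
  have "continuous_on UNIV (\<lambda>x. \<phi>' (shear x))"
    by (rule continuous_on_compose2[OF C1_continuous_gradient[OF assms, of UNIV] ch]) auto
  thus "continuous_on UNIV (\<lambda>x. \<phi>' (shear x) + (s * (\<phi>' (shear x) \<bullet> b)) *\<^sub>R \<gamma>' x)"
    by (intro continuous_intros C1_continuous_gradient[OF C1])
qed

lemma shear_support:
  assumes K: "compact K"
  shows "\<exists>K'. compact K' \<and> (\<forall>x. x \<notin> K' \<longrightarrow> shear x \<notin> K)"
proof (intro exI[of _ "(\<lambda>x. x - (s * \<gamma> x) *\<^sub>R b) ` K"] conjI allI impI)
  show "compact ((\<lambda>x. x - (s * \<gamma> x) *\<^sub>R b) ` K)"
    by (intro compact_continuous_image K continuous_intros C1_continuous[OF C1])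
  fix x assume x: "x \<notin> (\<lambda>x. x - (s * \<gamma> x) *\<^sub>R b) ` K"
  have "x = shear x - (s * \<gamma> (shear x)) *\<^sub>R b" by (simp add: shear_def shift)
  thus "shear x \<notin> K" using x by blast
qed

text \<open>Pull \<phi> back by the shear to \<psi> on a half space. The chain rule splits
  \<open>\<phi>' \<bullet> e\<close> into the derivative of \<psi> in direction \<open>e\<close> and
  its derivative in direction \<open>b\<close> times \<open>\<gamma>' \<bullet> e\<close>.
  Derivatives in direction \<open>b\<close> integrate to boundary values, tangential ones to
  0.\<close>

lemma divergence_above_graph:
  assumes \<phi>: "C1_with_gradient \<phi> \<phi>'" and K: "compact K" "\<And>x. x \<notin> K \<Longrightarrow> \<phi> x = 0" and e: "e \<in> Basis"
  shows "(LBINT x. indicator {x. \<gamma> x < s * (x \<bullet> b)} x * (\<phi>' x \<bullet> e)) =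
    (\<integral>f. \<phi> (shear (hyperplane_point b f)) * ((\<gamma>' (hyperplane_point b f) - s *\<^sub>R b) \<bullet> e) \<partial>hyperplane_product b)"
proof -
  let ?Y = "hyperplane_point b" and ?H = "hyperplane_product b"
  define \<psi> where "\<psi> x = \<phi> (shear x)" for x
  define \<psi>' where "\<psi>' x = \<phi>' (shear x) + (s * (\<phi>' (shear x) \<bullet> b)) *\<^sub>R \<gamma>' x" for x
  have \<psi>: "C1_with_gradient \<psi> \<psi>'" unfolding \<psi>_def \<psi>'_def by (rule C1_shear[OF \<phi>])
  obtain K' where K': "compact K'" "\<And>x. x \<notin> K' \<Longrightarrow> shear x \<notin> K" using shear_support[OF K(1)] by blast
  have \<psi>0: "\<psi> x = 0" if "x \<notin> K'" for x using K(2)[OF K'(2)[OF that]] by (simp add: \<psi>_def)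
  have \<psi>'0: "\<psi>' x = 0" if "x \<notin> K'" for x
    by (rule C1_gradient_zero[OF \<psi> compact_imp_closed[OF K'(1)] \<psi>0 that])
  have \<phi>'0: "\<phi>' x = 0" if "x \<notin> K" for x
    by (rule C1_gradient_zero[OF \<phi> compact_imp_closed[OF K(1)] K(2) that])
  have bb: "b \<bullet> b = 1" using b by simp
  have \<psi>'b: "\<psi>' x \<bullet> b = \<phi>' (shear x) \<bullet> b" for x by (simp add: \<psi>'_def inner_add_left gradient_inner)
  define P where "P = {x. 0 < s * (x \<bullet> b)}"
  define D where "D = {x. \<gamma> x < s * (x \<bullet> b)}"
  have "open P" unfolding P_def by (intro open_Collect_less continuous_intros)
  hence [measurable]: "P \<in> sets borel" by simp
  have "open D" unfolding D_def by (intro open_Collect_less continuous_intros C1_continuous[OF C1])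
  hence [measurable]: "D \<in> sets borel" by simp
  have int: "integrable lborel (\<lambda>x. indicator A x * g x)"
    if "A \<in> sets borel" "continuous_on UNIV g" "compact L" "\<And>x. x \<notin> L \<Longrightarrow> g x = 0"
    for A and g :: "'a \<Rightarrow> real" and L
    using integrable_mult_indicator[of A lborel g] integrable_compact_support[OF that(2-4)] that(1) by simp
  have i1: "integrable lborel (\<lambda>x. indicator D x * (\<phi>' x \<bullet> e))"
    by (rule int[where L = K]) (auto intro!: continuous_intros C1_continuous_gradient[OF \<phi>] K \<open>D \<in> sets borel\<close> simp: \<phi>'0)
  have i2: "integrable lborel (\<lambda>x. indicator P x * (\<psi>' x \<bullet> k))" for k
    by (rule int[where L = K']) (auto intro!: continuous_intros C1_continuous_gradient[OF \<psi>] K' simp: \<psi>'0)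
  have i3: "integrable lborel (\<lambda>x. indicator P x * ((\<psi>' x \<bullet> b) * (\<gamma>' x \<bullet> e)))"
    by (rule int[where L = K']) (auto intro!: continuous_intros C1_continuous_gradient[OF \<psi>] C1_continuous_gradient[OF C1] K' simp: \<psi>'0)
  have indP: "indicator P (?Y f + t *\<^sub>R b) = indicator {t. 0 < s * t} t" for f t
    using bb by (simp add: P_def indicator_def inner_add_left hyperplane_point_inner[OF b])
  have "(LBINT x. indicator D x * (\<phi>' x \<bullet> e)) =
      (\<integral>f. (LBINT t. indicator D (?Y f + t *\<^sub>R b) * (\<phi>' (?Y f + t *\<^sub>R b) \<bullet> e)) \<partial>?H)"
    by (rule hyperplane_Fubini(1)[OF b i1])
  \<comment> \<open>On the line over \<open>?Y f\<close> the shear is the translation by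
    \<open>c = s * \<gamma> (?Y f)\<close>, under which the one-dimensional integral is
    invariant.\<close>
  also have "\<dots> = (\<integral>f. (LBINT t. indicator P (?Y f + t *\<^sub>R b) * (\<phi>' (shear (?Y f + t *\<^sub>R b)) \<bullet> e)) \<partial>?H)"
  proof (rule Bochner_Integration.integral_cong[OF refl])
    fix f
    define c where "c = s * \<gamma> (?Y f)"
    have sc: "s * c = \<gamma> (?Y f)" using s by (auto simp: c_def)
    have "(LBINT t. indicator D (?Y f + t *\<^sub>R b) * (\<phi>' (?Y f + t *\<^sub>R b) \<bullet> e)) =
      (LBINT t. indicator D (?Y f + (c + 1 * t) *\<^sub>R b) * (\<phi>' (?Y f + (c + 1 * t) *\<^sub>R b) \<bullet> e))"
      by (subst lborel_integral_real_affine[where c = 1 and t = c]) simp_all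
    also have "\<dots> = (LBINT t. indicator P (?Y f + t *\<^sub>R b) * (\<phi>' (shear (?Y f + t *\<^sub>R b)) \<bullet> e))"
    proof (rule Bochner_Integration.integral_cong[OF refl])
      fix t
      have "?Y f + (c + 1 * t) *\<^sub>R b \<in> D \<longleftrightarrow> ?Y f + t *\<^sub>R b \<in> P"
        unfolding D_def P_def mem_Collect_eq shift inner_add_left hyperplane_point_inner[OF b]
        using sc bb by (simp add: algebra_simps)
      moreover have "shear (?Y f + t *\<^sub>R b) = ?Y f + (c + 1 * t) *\<^sub>R b"
        unfolding shear_def shift c_def by (simp add: algebra_simps)
      ultimately show "indicator D (?Y f + (c + 1 * t) *\<^sub>R b) * (\<phi>' (?Y f + (c + 1 * t) *\<^sub>R b) \<bullet> e) =
          indicator P (?Y f + t *\<^sub>R b) * (\<phi>' (shear (?Y f + t *\<^sub>R b)) \<bullet> e)"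
        by (simp add: indicator_def)
    qed
    finally show "(LBINT t. indicator D (?Y f + t *\<^sub>R b) * (\<phi>' (?Y f + t *\<^sub>R b) \<bullet> e)) =
      (LBINT t. indicator P (?Y f + t *\<^sub>R b) * (\<phi>' (shear (?Y f + t *\<^sub>R b)) \<bullet> e))" .
  qed
  also have "\<dots> = (LBINT x. indicator P x * (\<phi>' (shear x) \<bullet> e))"
  proof (rule hyperplane_Fubini(1)[OF b, symmetric])
    \<comment> \<open>The chain rule solved for the derivative of \<phi>: since
      \<open>\<gamma>'\<close> is orthogonal to \<open>b\<close>, \<psi> and \<phi> have the same
      derivative in direction \<open>b\<close> at corresponding points.\<close>
    have "integrable lborel (\<lambda>x. indicator P x * (\<psi>' x \<bullet> e) - s * (indicator P x * ((\<psi>' x \<bullet> b) * (\<gamma>' x \<bullet> e))))"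
      by (intro Bochner_Integration.integrable_diff integrable_mult_right i2 i3)
    thus "integrable lborel (\<lambda>x. indicator P x * (\<phi>' (shear x) \<bullet> e))"
      by (rule Bochner_Integration.integrable_cong[THEN iffD1, rotated 2])
         (auto simp: \<psi>'b, simp add: \<psi>'_def inner_add_left algebra_simps)
  qed
  also have "\<dots> = (LBINT x. indicator P x * (\<psi>' x \<bullet> e) - s * (indicator P x * ((\<psi>' x \<bullet> b) * (\<gamma>' x \<bullet> e))))"
    by (rule Bochner_Integration.integral_cong) (auto simp: \<psi>'b, simp add: \<psi>'_def inner_add_left algebra_simps)
  also have "\<dots> = (LBINT x. indicator P x * (\<psi>' x \<bullet> e))
      - s * (LBINT x. indicator P x * ((\<psi>' x \<bullet> b) * (\<gamma>' x \<bullet> e)))"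
    by (subst Bochner_Integration.integral_diff) (auto intro!: integrable_mult_right i2 i3)
  finally have main: "(LBINT x. indicator D x * (\<phi>' x \<bullet> e)) = (LBINT x. indicator P x * (\<psi>' x \<bullet> e))
      - s * (LBINT x. indicator P x * ((\<psi>' x \<bullet> b) * (\<gamma>' x \<bullet> e)))" .
  have line: "(LBINT t. indicator {t. 0 < s * t} t * (\<psi>' (y + t *\<^sub>R k) \<bullet> k)) = - s * \<psi> y"
    "(LBINT t. \<psi>' (y + t *\<^sub>R k) \<bullet> k) = 0" if "k \<in> Basis" for k y
    using C1_line_integrals[OF \<psi> K'(1) _ _ s, of k y] \<psi>0 nonzero_Basis[OF that] by auto
  have inner3: "(LBINT t. indicator P (?Y f + t *\<^sub>R b) * ((\<psi>' (?Y f + t *\<^sub>R b) \<bullet> b) * (\<gamma>' (?Y f + t *\<^sub>R b) \<bullet> e)))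
      = - s * (\<psi> (?Y f) * (\<gamma>' (?Y f) \<bullet> e))" for f
  proof -
    have "(LBINT t. indicator P (?Y f + t *\<^sub>R b) * ((\<psi>' (?Y f + t *\<^sub>R b) \<bullet> b) * (\<gamma>' (?Y f + t *\<^sub>R b) \<bullet> e)))
      = (LBINT t. (indicator {t. 0 < s * t} t * (\<psi>' (?Y f + t *\<^sub>R b) \<bullet> b)) * (\<gamma>' (?Y f) \<bullet> e))"
      by (simp only: gradient_shift indP mult.assoc)
    also have "\<dots> = (LBINT t. indicator {t. 0 < s * t} t * (\<psi>' (?Y f + t *\<^sub>R b) \<bullet> b)) * (\<gamma>' (?Y f) \<bullet> e)"
      by simp
    also have "\<dots> = - s * (\<psi> (?Y f) * (\<gamma>' (?Y f) \<bullet> e))" by (subst line(1)[OF b]) simp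
    finally show ?thesis .
  qed
  \<comment> \<open>The factor \<open>\<gamma>' \<bullet> e\<close> is constant along lines parallel
    to \<open>b\<close> and leaves the inner integral.\<close>
  have t3: "(LBINT x. indicator P x * ((\<psi>' x \<bullet> b) * (\<gamma>' x \<bullet> e))) = - s * (\<integral>f. \<psi> (?Y f) * (\<gamma>' (?Y f) \<bullet> e) \<partial>?H)"
    by (subst hyperplane_Fubini(1)[OF b i3]) (simp only: inner3 integral_mult_right_zero)
  have ss: "s * s = 1" using s by auto
  show ?thesis
  proof (cases "e = b")
    case True
    have "(LBINT x. indicator P x * (\<psi>' x \<bullet> b)) =
        (\<integral>f. (LBINT t. indicator {t. 0 < s * t} t * (\<psi>' (?Y f + t *\<^sub>R b) \<bullet> b)) \<partial>?H)"
      by (subst hyperplane_Fubini(1)[OF b i2]) (simp only: indP)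
    also have "\<dots> = (\<integral>f. - s * \<psi> (?Y f) \<partial>?H)" by (simp only: line(1)[OF b])
    finally have "(LBINT x. indicator D x * (\<phi>' x \<bullet> e)) = (\<integral>f. - s * \<psi> (?Y f) \<partial>?H)"
      using main t3 True by (simp add: gradient_inner)
    also have "\<dots> = (\<integral>f. \<phi> (shear (?Y f)) * ((\<gamma>' (?Y f) - s *\<^sub>R b) \<bullet> e) \<partial>?H)"
      using bb True by (intro Bochner_Integration.integral_cong) (auto simp: inner_diff_left gradient_inner \<psi>_def)
    finally show ?thesis unfolding D_def .
  next
    case False
    hence eb: "b \<bullet> e = 0" using b e by (simp add: inner_Basis)
    \<comment> \<open>For \<open>e \<noteq> b\<close> Fubini is used in direction \<open>e\<close>:
      the half space is invariant along it, so a full line integral of a compactly supported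
      derivative remains.\<close>
    have "(LBINT x. indicator P x * (\<psi>' x \<bullet> e)) =
        (\<integral>f. (LBINT t. indicator P (hyperplane_point e f + t *\<^sub>R e) * (\<psi>' (hyperplane_point e f + t *\<^sub>R e) \<bullet> e)) \<partial>hyperplane_product e)"
      by (rule hyperplane_Fubini(1)[OF e i2])
    also have "\<dots> = (\<integral>f. 0 \<partial>hyperplane_product e)"
    proof (rule Bochner_Integration.integral_cong[OF refl])
      fix f
      have "(LBINT t. indicator P (hyperplane_point e f + t *\<^sub>R e) * (\<psi>' (hyperplane_point e f + t *\<^sub>R e) \<bullet> e))
          = (LBINT t. indicator P (hyperplane_point e f) * (\<psi>' (hyperplane_point e f + t *\<^sub>R e) \<bullet> e))"
        using eb by (intro Bochner_Integration.integral_cong)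
          (auto simp: P_def indicator_def inner_add_left inner_commute[of e b])
      also have "\<dots> = 0" using line(2)[OF e] by simp
      finally show "(LBINT t. indicator P (hyperplane_point e f + t *\<^sub>R e) * (\<psi>' (hyperplane_point e f + t *\<^sub>R e) \<bullet> e)) = 0" .
    qed
    finally have "(LBINT x. indicator D x * (\<phi>' x \<bullet> e)) = (\<integral>f. \<psi> (?Y f) * (\<gamma>' (?Y f) \<bullet> e) \<partial>?H)"
      using main t3 ss by (simp add: mult.assoc[symmetric])
    also have "\<dots> = (\<integral>f. \<phi> (shear (?Y f)) * ((\<gamma>' (?Y f) - s *\<^sub>R b) \<bullet> e) \<partial>?H)"
      using eb by (intro Bochner_Integration.integral_cong) (auto simp: inner_diff_left \<psi>_def)
    finally show ?thesis unfolding D_def .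
  qed
qed

end

section \<open>The divergence theorem on C1 domains\<close>

lemma graph_chart_graph_function:
  "graph_chart \<Omega> U b s \<gamma> \<gamma>' \<Longrightarrow> graph_function b s \<gamma> \<gamma>'"
  unfolding graph_chart_def graph_function_def by blast

text \<open>Points strictly on the other side of the graph have a neighbourhood missing \<Omega>;
  points on the graph are limits of \<open>x + (s * t) b\<close> with \<open>t > 0\<close>, which
  lie in \<Omega> because moving by \<open>s * t\<close> along \<open>b\<close> raises
  \<open>s * (x \<bullet> b)\<close> by \<open>t\<close> and leaves \<gamma> unchanged.\<close>

lemma frontier_in_chart:
  assumes "graph_chart \<Omega> U b s \<gamma> \<gamma>'" "open \<Omega>" "x \<in> U"
  shows "x \<in> frontier \<Omega> \<longleftrightarrow> \<gamma> x = s * (x \<bullet> b)"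
proof -
  interpret graph_function b s \<gamma> \<gamma>' by (rule graph_chart_graph_function[OF assms(1)])
  have U: "open U" "\<Omega> \<inter> U = {x \<in> U. \<gamma> x < s * (x \<bullet> b)}" using assms(1) by (auto simp: graph_chart_def)
  have bb: "b \<bullet> b = 1" and ss: "s * s = 1" using b s by auto
  have fr: "frontier \<Omega> = closure \<Omega> - \<Omega>" using assms(2) by (simp add: frontier_def interior_open)
  show ?thesis
  proof
    assume x: "x \<in> frontier \<Omega>"
    hence "\<not> \<gamma> x < s * (x \<bullet> b)" using U assms(3) fr by blast
    moreover have "\<not> \<gamma> x > s * (x \<bullet> b)"
    proof
      assume gt: "\<gamma> x > s * (x \<bullet> b)"
      define V where "V = U \<inter> {x. s * (x \<bullet> b) < \<gamma> x}"
      have "open V" unfolding V_def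
        by (intro open_Int U open_Collect_less continuous_intros C1_continuous[OF C1])
      moreover have "V \<inter> \<Omega> = {}"
      proof -
        have "\<gamma> x < s * (x \<bullet> b)" if "x \<in> U" "x \<in> \<Omega>" for x using U(2) that by blast
        thus ?thesis by (force simp: V_def)
      qed
      ultimately have "V \<inter> closure \<Omega> = {}" by (simp add: open_Int_closure_eq_empty)
      thus False using gt x assms(3) fr by (auto simp: V_def)
    qed
    ultimately show "\<gamma> x = s * (x \<bullet> b)" by simp
  next
    assume eq: "\<gamma> x = s * (x \<bullet> b)"
    moreover have "\<gamma> x < s * (x \<bullet> b)" if "x \<in> \<Omega>" using U assms(3) that by blast
    ultimately have "x \<notin> \<Omega>" by auto
    moreover have "x \<in> closure \<Omega>"
    proof (rule Lim_in_closed_set[where F = "at_right (0::real)" and f = "\<lambda>t. x + (s * t) *\<^sub>R b"])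
      have lim: "((\<lambda>t. x + (s * t) *\<^sub>R b) \<longlongrightarrow> x + (s * 0) *\<^sub>R b) (at_right 0)" by (intro tendsto_intros)
      thus "((\<lambda>t. x + (s * t) *\<^sub>R b) \<longlongrightarrow> x) (at_right 0)" by simp
      have "\<forall>\<^sub>F t in at_right 0. x + (s * t) *\<^sub>R b \<in> U"
        using lim U(1) assms(3) by (intro topological_tendstoD[of _ x]) auto
      moreover have "\<forall>\<^sub>F t in at_right 0. (t::real) > 0" by (rule eventually_at_right_less)
      ultimately show "\<forall>\<^sub>F t in at_right 0. x + (s * t) *\<^sub>R b \<in> closure \<Omega>"
      proof eventually_elim
        fix t :: real assume t: "x + (s * t) *\<^sub>R b \<in> U" "t > 0"
        have "s * ((x + (s * t) *\<^sub>R b) \<bullet> b) = s * (x \<bullet> b) + s * s * t"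
          using bb by (simp add: inner_add_left algebra_simps)
        hence "\<gamma> (x + (s * t) *\<^sub>R b) < s * ((x + (s * t) *\<^sub>R b) \<bullet> b)"
          using t eq ss by (simp add: shift)
        hence "x + (s * t) *\<^sub>R b \<in> \<Omega>" using t U by blast
        thus "x + (s * t) *\<^sub>R b \<in> closure \<Omega>" using closure_subset by blast
      qed
    qed auto
    ultimately show "x \<in> frontier \<Omega>" using fr by blast
  qed
qed

text \<open>The given field \<open>\<nu>\<close> is arbitrary away from the boundary; this version is Borel.\<close>

definition boundary_normal :: "'a::euclidean_space set \<Rightarrow> ('a \<Rightarrow> 'a) \<Rightarrow> 'a \<Rightarrow> 'a" where
  "boundary_normal \<Omega> \<nu> x = indicator (frontier \<Omega>) x *\<^sub>R \<nu> x"

locale C1_domain =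
  fixes \<Omega> :: "'a::euclidean_space set" and \<nu> :: "'a \<Rightarrow> 'a" and \<sigma> :: "'a measure"
  assumes open_dom: "open \<Omega>" and bounded_dom: "bounded \<Omega>" and C1_bd: "C1_boundary \<Omega>"
    and normal: "outward_unit_normal \<Omega> \<nu>" and surface: "surface_measure \<Omega> \<sigma>"
begin

lemma sets_surface [measurable_cong, simp]: "sets \<sigma> = sets borel"
  using surface by (simp add: surface_measure_def)

lemma space_surface [simp]: "space \<sigma> = UNIV"
  using sets_eq_imp_space_eq[OF sets_surface] by simp

lemma compact_frontier_dom: "compact (frontier \<Omega>)"
  using bounded_dom by (rule compact_frontier_bounded)

lemma AE_frontier: "AE x in \<sigma>. x \<in> frontier \<Omega>"
  using surface by (intro AE_I[of _ _ "- frontier \<Omega>"]) (auto simp: surface_measure_def frontier_closed open_Compl)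

text \<open>Near each boundary point the normal coincides on the boundary with the chart formula,
  which is continuous on the whole space.\<close>

lemma continuous_normal: "continuous_on (frontier \<Omega>) \<nu>"
  unfolding continuous_on_eq_continuous_within
proof
  fix p assume p: "p \<in> frontier \<Omega>"
  then obtain U b s \<gamma> \<gamma>' where U: "p \<in> U" and ch: "graph_chart \<Omega> U b s \<gamma> \<gamma>'"
    using C1_bd unfolding C1_boundary_def by blast
  interpret graph_function b s \<gamma> \<gamma>' by (rule graph_chart_graph_function[OF ch])
  have "open U" using ch by (simp add: graph_chart_def)
  define n where "n x = (\<gamma>' x - s *\<^sub>R b) /\<^sub>R sqrt (1 + (norm (\<gamma>' x))\<^sup>2)" for x
  have "continuous_on UNIV n" unfolding n_def
    by (intro continuous_intros C1_continuous_gradient[OF C1]) (auto simp: add_nonneg_eq_0_iff)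
  hence "continuous (at p within frontier \<Omega>) n"
    by (simp add: continuous_on_eq_continuous_at continuous_at_imp_continuous_at_within)
  moreover have "\<forall>\<^sub>F x in at p within frontier \<Omega>. n x = \<nu> x"
  proof -
    have "n x = \<nu> x" if "x \<in> U" "x \<in> frontier \<Omega>" for x
      using normal ch that unfolding outward_unit_normal_def n_def by (metis IntI)
    thus ?thesis unfolding eventually_at_topological using \<open>open U\<close> U by blast
  qed
  moreover have "n p = \<nu> p"
    using normal ch U p unfolding outward_unit_normal_def n_def by (metis IntI)
  ultimately show "continuous (at p within frontier \<Omega>) \<nu>"
    unfolding continuous_within using Lim_transform_eventually[of n "n p" "at p within frontier \<Omega>" \<nu>] by simp
qed

lemma measurable_boundary_normal [measurable]: "boundary_normal \<Omega> \<nu> \<in> borel_measurable borel"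
  unfolding boundary_normal_def[abs_def]
  by (intro borel_measurable_continuous_on_indicator continuous_normal) (simp add: frontier_closed)

lemma bounded_boundary_normal: "\<exists>C. \<forall>x. norm (boundary_normal \<Omega> \<nu> x) \<le> C"
proof -
  have "bounded (\<nu> ` frontier \<Omega>)"
    by (intro compact_imp_bounded compact_continuous_image continuous_normal compact_frontier_dom)
  then obtain C where "\<And>x. x \<in> frontier \<Omega> \<Longrightarrow> norm (\<nu> x) \<le> C" by (auto simp: bounded_iff)
  hence "norm (boundary_normal \<Omega> \<nu> x) \<le> \<bar>C\<bar>" for x
    by (force simp: boundary_normal_def indicator_def)
  thus ?thesis by blast
qed

lemma surface_measure_chart:
  assumes ch: "graph_chart \<Omega> U b s \<gamma> \<gamma>'" and A: "A \<in> sets borel"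
  shows "emeasure \<sigma> (A \<inter> U) = (\<integral>\<^sup>+ f. indicator (A \<inter> U) (graph_function.shear b s \<gamma> (hyperplane_point b f)) *
     ennreal (sqrt (1 + (norm (\<gamma>' (hyperplane_point b f)))\<^sup>2)) \<partial>hyperplane_product b)"
proof -
  interpret graph_function b s \<gamma> \<gamma>' by (rule graph_chart_graph_function[OF ch])
  have [measurable]: "U \<in> sets borel" using ch by (simp add: graph_chart_def)
  have [measurable]: "\<gamma>' \<in> borel_measurable borel" "\<gamma> \<in> borel_measurable borel"
    by (auto intro!: borel_measurable_continuous_onI C1_continuous[OF C1] C1_continuous_gradient[OF C1])
  note A [measurable]
  have "emeasure \<sigma> (A \<inter> U) = emeasure \<sigma> (A \<inter> U \<inter> frontier \<Omega>)"
    using AE_frontier by (intro emeasure_eq_AE) (auto simp: frontier_closed)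
  also have "\<dots> = (\<integral>\<^sup>+ y. indicator (A \<inter> U) (y + (s * \<gamma> y) *\<^sub>R b) * ennreal (sqrt (1 + (norm (\<gamma>' y))\<^sup>2))
      \<partial>hyperplane_lborel b)"
    using surface ch unfolding surface_measure_def by (auto simp: A)
  also have "\<dots> = (\<integral>\<^sup>+ f. indicator (A \<inter> U) (shear (hyperplane_point b f)) *
     ennreal (sqrt (1 + (norm (\<gamma>' (hyperplane_point b f)))\<^sup>2)) \<partial>hyperplane_product b)"
    unfolding hyperplane_lborel_eq shear_def by (subst nn_integral_distr) auto
  finally show ?thesis .
qed

text \<open>The defining property on Borel sets says that \<sigma> restricted to \<open>U\<close> is
  the image of a weighted hyperplane measure. Proving this as an equality of measures yields the
  formula for signed functions at once.\<close>

lemma surface_integral_chart: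
  fixes F :: "'a \<Rightarrow> real"
  assumes ch: "graph_chart \<Omega> U b s \<gamma> \<gamma>'" and F [measurable]: "F \<in> borel_measurable borel"
    and F0: "\<And>x. x \<notin> U \<Longrightarrow> F x = 0"
  shows "integral\<^sup>L \<sigma> F = (\<integral>f. sqrt (1 + (norm (\<gamma>' (hyperplane_point b f)))\<^sup>2) *
    F (graph_function.shear b s \<gamma> (hyperplane_point b f)) \<partial>hyperplane_product b)"
proof -
  interpret graph_function b s \<gamma> \<gamma>' by (rule graph_chart_graph_function[OF ch])
  have U [measurable]: "U \<in> sets borel" using ch by (simp add: graph_chart_def)
  have [measurable]: "\<gamma>' \<in> borel_measurable borel" "\<gamma> \<in> borel_measurable borel"
    by (auto intro!: borel_measurable_continuous_onI C1_continuous[OF C1] C1_continuous_gradient[OF C1])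
  define \<Phi> where "\<Phi> f = shear (hyperplane_point b f)" for f
  have [measurable]: "\<Phi> \<in> borel_measurable (hyperplane_product b)"
    unfolding \<Phi>_def shear_def by measurable
  define J where "J f = sqrt (1 + (norm (\<gamma>' (hyperplane_point b f)))\<^sup>2)" for f
  have [measurable]: "J \<in> borel_measurable (hyperplane_product b)" unfolding J_def by measurable
  have J0: "J f \<ge> 0" for f by (simp add: J_def)
  define g where "g f = indicator U (\<Phi> f) * J f" for f
  have [measurable]: "g \<in> borel_measurable (hyperplane_product b)" unfolding g_def by measurable
  have "density \<sigma> (indicator U :: _ \<Rightarrow> real) = distr (density (hyperplane_product b) g) borel \<Phi>"
  proof (rule measure_eqI)
    fix A assume "A \<in> sets (density \<sigma> (indicator U :: _ \<Rightarrow> real))"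
    hence A [measurable]: "A \<in> sets borel" by simp
    have "emeasure (density \<sigma> (indicator U :: _ \<Rightarrow> real)) A = emeasure \<sigma> (A \<inter> U)"
      by (subst emeasure_density) (auto simp: ennreal_indicator indicator_inter_arith[symmetric] Int_commute)
    also have "\<dots> = (\<integral>\<^sup>+ f. indicator (A \<inter> U) (\<Phi> f) * ennreal (J f) \<partial>hyperplane_product b)"
      unfolding \<Phi>_def J_def by (rule surface_measure_chart[OF ch A])
    also have "\<dots> = (\<integral>\<^sup>+ f. ennreal (g f) * indicator A (\<Phi> f) \<partial>hyperplane_product b)"
      by (rule nn_integral_cong) (auto simp: g_def indicator_def)
    also have "\<dots> = (\<integral>\<^sup>+ f. indicator A (\<Phi> f) \<partial>density (hyperplane_product b) g)"
      by (subst nn_integral_density) auto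
    also have "\<dots> = (\<integral>\<^sup>+ x. indicator A x \<partial>distr (density (hyperplane_product b) g) borel \<Phi>)"
      by (subst nn_integral_distr) auto
    finally show "emeasure (density \<sigma> (indicator U :: _ \<Rightarrow> real)) A =
        emeasure (distr (density (hyperplane_product b) g) borel \<Phi>) A" by simp
  qed simp
  hence "integral\<^sup>L (density \<sigma> (indicator U :: _ \<Rightarrow> real)) F =
      integral\<^sup>L (distr (density (hyperplane_product b) g) borel \<Phi>) F" by simp
  moreover have "integral\<^sup>L (density \<sigma> (indicator U :: _ \<Rightarrow> real)) F = integral\<^sup>L \<sigma> F"
    by (subst integral_density) (auto intro!: Bochner_Integration.integral_cong simp: F0 indicator_def)
  moreover have "integral\<^sup>L (distr (density (hyperplane_product b) g) borel \<Phi>) F =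
      (\<integral>f. J f * F (\<Phi> f) \<partial>hyperplane_product b)"
    by (subst integral_distr, simp, simp, subst integral_density)
       (auto intro!: Bochner_Integration.integral_cong simp: F0 J0 g_def indicator_def)
  ultimately show ?thesis by (simp add: J_def \<Phi>_def)
qed

text \<open>By compactness of the boundary it suffices to bound the measure of a small ball in a
  chart. There the area element is bounded and the parameters range over a bounded part of the
  hyperplane.\<close>

lemma finite_surface: "finite_measure \<sigma>"
proof
  have "\<exists>r>0. emeasure \<sigma> (ball p r) < \<infinity>" if p: "p \<in> frontier \<Omega>" for p
  proof -
    obtain U b s \<gamma> \<gamma>' where U: "p \<in> U" and ch: "graph_chart \<Omega> U b s \<gamma> \<gamma>'"
      using C1_bd p unfolding C1_boundary_def by blast
    interpret graph_function b s \<gamma> \<gamma>' by (rule graph_chart_graph_function[OF ch])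
    have "open U" using ch by (simp add: graph_chart_def)
    then obtain r where r: "r > 0" "ball p r \<subseteq> U" using U open_contains_ball by blast
    have bb: "b \<bullet> b = 1" "norm b = 1" using b by auto
    define \<pi> where "\<pi> x = x - (x \<bullet> b) *\<^sub>R b" for x
    \<comment> \<open>The projection along \<open>b\<close> moves the difference to \<open>p\<close>
      by at most its own norm, hence at most doubles it; \<open>L\<close> contains all parameters of
      points in the ball.\<close>
    define L where "L = cball (\<pi> p) (2 * r)"
    have "compact L" by (simp add: L_def)
    hence "bounded (\<gamma>' ` L)"
      by (intro compact_imp_bounded compact_continuous_image C1_continuous_gradient[OF C1])
    then obtain C where C: "\<And>y. y \<in> L \<Longrightarrow> norm (\<gamma>' y) \<le> C" by (auto simp: bounded_iff)
    have ball_L: "y \<in> L" if "y \<bullet> b = 0" "shear y \<in> ball p r" for y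
    proof -
      have "\<pi> (shear y) = y" using that bb by (simp add: \<pi>_def shear_def inner_add_left)
      hence "y - \<pi> p = (shear y - p) - ((shear y - p) \<bullet> b) *\<^sub>R b"
        by (simp add: \<pi>_def inner_diff_left algebra_simps)
      hence "norm (y - \<pi> p) \<le> norm (shear y - p) + norm (((shear y - p) \<bullet> b) *\<^sub>R b)"
        by (metis norm_triangle_ineq4)
      also have "\<dots> \<le> 2 * norm (shear y - p)"
        using Cauchy_Schwarz_ineq2[of "shear y - p" b] bb by simp
      also have "\<dots> \<le> 2 * r" using that(2) by (simp add: dist_norm norm_minus_commute)
      finally show ?thesis by (simp add: L_def dist_norm norm_minus_commute)
    qed
    have [measurable]: "L \<in> sets borel" by (simp add: L_def)
    have "emeasure \<sigma> (ball p r) = emeasure \<sigma> (ball p r \<inter> U)" using r by (simp add: Int_absorb2)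
    also have "\<dots> = (\<integral>\<^sup>+ f. indicator (ball p r \<inter> U) (shear (hyperplane_point b f)) *
      ennreal (sqrt (1 + (norm (\<gamma>' (hyperplane_point b f)))\<^sup>2)) \<partial>hyperplane_product b)"
      by (rule surface_measure_chart[OF ch]) simp
    also have "\<dots> \<le> (\<integral>\<^sup>+ f. ennreal (sqrt (1 + C\<^sup>2)) * indicator L (hyperplane_point b f) \<partial>hyperplane_product b)"
    proof (rule nn_integral_mono)
      fix f
      show "indicator (ball p r \<inter> U) (shear (hyperplane_point b f)) * ennreal (sqrt (1 + (norm (\<gamma>' (hyperplane_point b f)))\<^sup>2))
         \<le> ennreal (sqrt (1 + C\<^sup>2)) * indicator L (hyperplane_point b f)"
        using ball_L[of "hyperplane_point b f"] hyperplane_point_inner[OF b, of f] C[of "hyperplane_point b f"]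
        by (auto simp: indicator_def intro!: ennreal_leI power_mono)
    qed
    also have "\<dots> = ennreal (sqrt (1 + C\<^sup>2)) * (\<integral>\<^sup>+ f. indicator L (hyperplane_point b f) \<partial>hyperplane_product b)"
      by (rule nn_integral_cmult) measurable
    also have "\<dots> < \<infinity>"
    proof -
      \<comment> \<open>To bound the hyperplane measure of \<open>L\<close>, thicken it by a unit
        interval in direction \<open>b\<close>: the measure is unchanged by the factor 1, and the
        thickened set lies in this ball of finite Lebesgue measure.\<close>
      define Q where "Q = cball (\<pi> p) (2 * r + 1)"
      have [measurable]: "Q \<in> sets borel" by (simp add: Q_def)
      have inQ: "y + t *\<^sub>R b \<in> Q" if "y \<in> L" "t \<in> {0..1}" for y t
      proof -
        have "norm (y + t *\<^sub>R b - \<pi> p) \<le> norm (y - \<pi> p) + norm (t *\<^sub>R b)"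
          by (metis add_diff_eq add.commute add_diff_eq norm_triangle_ineq diff_add_eq)
        thus ?thesis using that bb by (simp add: L_def Q_def dist_norm norm_minus_commute)
      qed
      have "(\<integral>\<^sup>+ f. indicator L (hyperplane_point b f) \<partial>hyperplane_product b)
        = (\<integral>\<^sup>+ f. \<integral>\<^sup>+ t. indicator L (hyperplane_point b f) * indicator {0..1::real} t \<partial>lborel \<partial>hyperplane_product b)"
        by (subst nn_integral_cmult) auto
      also have "\<dots> \<le> (\<integral>\<^sup>+ f. \<integral>\<^sup>+ t. indicator Q (hyperplane_point b f + t *\<^sub>R b) \<partial>lborel \<partial>hyperplane_product b)"
        by (intro nn_integral_mono) (use inQ in \<open>auto simp: indicator_def\<close>)
      also have "\<dots> = (\<integral>\<^sup>+ p. indicator Q (hyperplane_point b (fst p) + snd p *\<^sub>R b) \<partial>(hyperplane_product b \<Otimes>\<^sub>M lborel))"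
        by (subst lborel.nn_integral_fst[symmetric]) auto
      also have "\<dots> = (\<integral>\<^sup>+ x. indicator Q x \<partial>lborel)"
        by (subst lborel_eq_hyperplane_product[OF b], subst nn_integral_distr) auto
      also have "\<dots> = emeasure lborel Q" by simp
      also have "\<dots> < \<infinity>" by (rule emeasure_bounded_finite) (simp add: Q_def)
      finally show ?thesis by (simp add: ennreal_mult_less_top)
    qed
    finally show ?thesis using r by blast
  qed
  then obtain r where r: "\<And>p. p \<in> frontier \<Omega> \<Longrightarrow> r p > 0 \<and> emeasure \<sigma> (ball p (r p)) < \<infinity>" by metis
  hence "frontier \<Omega> \<subseteq> (\<Union>p\<in>frontier \<Omega>. ball p (r p))" by fastforce
  then obtain I where I: "I \<subseteq> frontier \<Omega>" "finite I" "frontier \<Omega> \<subseteq> (\<Union>p\<in>I. ball p (r p))"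
    by (rule compactE_image[OF compact_frontier_dom, rotated]) auto
  have "emeasure \<sigma> (space \<sigma>) = emeasure \<sigma> (frontier \<Omega>)"
    using AE_frontier by (intro emeasure_eq_AE) (auto simp: frontier_closed)
  also have "\<dots> \<le> emeasure \<sigma> (\<Union>p\<in>I. ball p (r p))" using I by (intro emeasure_mono) auto
  also have "\<dots> \<le> (\<Sum>p\<in>I. emeasure \<sigma> (ball p (r p)))" using I by (intro emeasure_subadditive_finite) auto
  also have "\<dots> < \<infinity>" using r I by (auto simp: ennreal_sum_less_top subset_eq)
  finally show "emeasure \<sigma> (space \<sigma>) \<noteq> \<infinity>" by simp
qed

text \<open>The normalising factor of the unit normal is the reciprocal of the area element, so the
  integrand of \<open>divergence_above_graph\<close> is the surface integrand in the chart. Outside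
  \<open>K\<close> both vanish, hence the full region above the graph may replace \<Omega>.\<close>

lemma divergence_chart:
  assumes ch: "graph_chart \<Omega> U b s \<gamma> \<gamma>'" and \<phi>: "C1_with_gradient \<phi> \<phi>'"
    and K: "compact K" "K \<subseteq> U" "\<And>x. x \<notin> K \<Longrightarrow> \<phi> x = 0" and e: "e \<in> Basis"
  shows "(LINT x|leb \<Omega>. \<phi>' x \<bullet> e) = (LINT x|\<sigma>. \<phi> x * (boundary_normal \<Omega> \<nu> x \<bullet> e))"
proof -
  interpret graph_function b s \<gamma> \<gamma>' by (rule graph_chart_graph_function[OF ch])
  have U: "\<Omega> \<inter> U = {x \<in> U. \<gamma> x < s * (x \<bullet> b)}" using ch by (auto simp: graph_chart_def)
  have [measurable]: "\<phi> \<in> borel_measurable borel"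
    by (auto intro!: borel_measurable_continuous_onI C1_continuous[OF \<phi>])
  have \<phi>'0: "\<phi>' x = 0" if "x \<notin> K" for x
    using C1_gradient_zero[OF \<phi> compact_imp_closed[OF K(1)] _ that] K(3) by blast
  have "(LINT x|leb \<Omega>. \<phi>' x \<bullet> e) = (LBINT x. indicator \<Omega> x *\<^sub>R (\<phi>' x \<bullet> e))"
    using open_dom by (intro integral_restrict_space) auto
  also have "\<dots> = (LBINT x. indicator {x. \<gamma> x < s * (x \<bullet> b)} x * (\<phi>' x \<bullet> e))"
  proof (rule Bochner_Integration.integral_cong[OF refl])
    fix x show "indicator \<Omega> x *\<^sub>R (\<phi>' x \<bullet> e) = indicator {x. \<gamma> x < s * (x \<bullet> b)} x * (\<phi>' x \<bullet> e)"
      using U \<phi>'0[of x] K(2) by (cases "x \<in> K") (auto simp: indicator_def)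
  qed
  also have "\<dots> = (\<integral>f. \<phi> (shear (hyperplane_point b f)) * ((\<gamma>' (hyperplane_point b f) - s *\<^sub>R b) \<bullet> e) \<partial>hyperplane_product b)"
    using divergence_above_graph[OF \<phi> K(1) _ e] K(3) by blast
  also have "\<dots> = (\<integral>f. sqrt (1 + (norm (\<gamma>' (hyperplane_point b f)))\<^sup>2) *
     (\<phi> (shear (hyperplane_point b f)) * (boundary_normal \<Omega> \<nu> (shear (hyperplane_point b f)) \<bullet> e)) \<partial>hyperplane_product b)"
  proof (rule Bochner_Integration.integral_cong[OF refl])
    fix f
    let ?y = "hyperplane_point b f"
    show "\<phi> (shear ?y) * ((\<gamma>' ?y - s *\<^sub>R b) \<bullet> e) = sqrt (1 + (norm (\<gamma>' ?y))\<^sup>2) *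
       (\<phi> (shear ?y) * (boundary_normal \<Omega> \<nu> (shear ?y) \<bullet> e))"
    proof (cases "shear ?y \<in> K")
      case False thus ?thesis using K(3) by simp
    next
      case True
      hence inU: "shear ?y \<in> U" using K by blast
      have J: "sqrt (1 + (norm (\<gamma>' ?y))\<^sup>2) \<noteq> 0" by (auto simp: add_nonneg_eq_0_iff)
      have "s * s = 1" using s by auto
      hence "\<gamma> (shear ?y) = s * (shear ?y \<bullet> b)"
        using b by (simp add: shear_def shift inner_add_left hyperplane_point_inner mult.assoc[symmetric])
      hence fr: "shear ?y \<in> frontier \<Omega>" using frontier_in_chart[OF ch open_dom inU] by blast
      have "\<nu> (shear ?y) = (\<gamma>' (shear ?y) - s *\<^sub>R b) /\<^sub>R sqrt (1 + (norm (\<gamma>' (shear ?y)))\<^sup>2)"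
        using normal ch inU fr unfolding outward_unit_normal_def by blast
      hence "boundary_normal \<Omega> \<nu> (shear ?y) = (\<gamma>' ?y - s *\<^sub>R b) /\<^sub>R sqrt (1 + (norm (\<gamma>' ?y))\<^sup>2)"
        using fr by (simp add: boundary_normal_def shear_def gradient_shift)
      thus ?thesis using J by simp
    qed
  qed
  also have "\<dots> = (LINT x|\<sigma>. \<phi> x * (boundary_normal \<Omega> \<nu> x \<bullet> e))"
    by (rule surface_integral_chart[OF ch, symmetric]) (use K in auto)
  finally show ?thesis .
qed

text \<open>Both sides are 0: the left by integrating along lines, the right because the support
  does not meet the boundary.\<close>

lemma divergence_interior:
  assumes \<phi>: "C1_with_gradient \<phi> \<phi>'" and K: "compact K" "K \<subseteq> \<Omega>" "\<And>x. x \<notin> K \<Longrightarrow> \<phi> x = 0" and e: "e \<in> Basis"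
  shows "(LINT x|leb \<Omega>. \<phi>' x \<bullet> e) = (LINT x|\<sigma>. \<phi> x * (boundary_normal \<Omega> \<nu> x \<bullet> e))"
proof -
  have \<phi>'0: "\<phi>' x = 0" if "x \<notin> K" for x
    using C1_gradient_zero[OF \<phi> compact_imp_closed[OF K(1)] _ that] K(3) by blast
  have "(LINT x|leb \<Omega>. \<phi>' x \<bullet> e) = (LBINT x. indicator \<Omega> x *\<^sub>R (\<phi>' x \<bullet> e))"
    using open_dom by (intro integral_restrict_space) auto
  also have "\<dots> = (LBINT x. \<phi>' x \<bullet> e)"
    by (rule Bochner_Integration.integral_cong) (use \<phi>'0 subsetD[OF K(2)] in \<open>force simp: indicator_def\<close>)+
  also have "\<dots> = (\<integral>f. \<integral>t. \<phi>' (hyperplane_point e f + t *\<^sub>R e) \<bullet> e \<partial>lborel \<partial>hyperplane_product e)"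
    by (intro hyperplane_Fubini(1)[OF e] integrable_compact_support[OF _ K(1)])
       (auto simp: \<phi>'0 intro!: continuous_intros C1_continuous_gradient[OF \<phi>])
  also have "\<dots> = (\<integral>f. 0 \<partial>hyperplane_product e)"
    \<comment> \<open>The sign 1 is a placeholder; the integral over the full line does not depend
      on it.\<close>
    using C1_line_integrals(2)[OF \<phi> K(1) _ nonzero_Basis[OF e], of 1] K(3)
    by (intro Bochner_Integration.integral_cong) auto
  also have "\<dots> = (LINT x|\<sigma>. \<phi> x * (boundary_normal \<Omega> \<nu> x \<bullet> e))"
  proof -
    have zero: "\<phi> x * (boundary_normal \<Omega> \<nu> x \<bullet> e) = 0" for x
      using open_dom K(2) K(3)[of x] by (auto simp: boundary_normal_def indicator_def frontier_def interior_open)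
    show ?thesis by (simp only: zero integral_zero)
  qed
  finally show ?thesis .
qed

lemma C1_surface_integrable:
  assumes "C1_with_gradient \<phi> \<phi>'" and [measurable]: "g \<in> borel_measurable \<sigma>" and "\<And>x. \<bar>g x\<bar> \<le> (C::real)"
  shows "integrable \<sigma> (\<lambda>x. \<phi> x * g x)"
proof -
  interpret finite_measure \<sigma> by (rule finite_surface)
  have "bounded (\<phi> ` frontier \<Omega>)"
    by (intro compact_imp_bounded compact_continuous_image C1_continuous[OF assms(1)] compact_frontier_dom)
  then obtain B where B: "\<And>x. x \<in> frontier \<Omega> \<Longrightarrow> \<bar>\<phi> x\<bar> \<le> B" by (auto simp: bounded_iff)
  have [measurable]: "\<phi> \<in> borel_measurable \<sigma>"
    by (auto intro!: borel_measurable_continuous_onI C1_continuous[OF assms(1)] simp: measurable_cong_sets[OF sets_surface refl])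
  show ?thesis
  proof (rule integrable_const_bound[of _ "B * C"])
    show "AE x in \<sigma>. norm (\<phi> x * g x) \<le> B * C"
      using AE_frontier by eventually_elim (auto simp: abs_mult intro!: mult_mono' B assms(3))
  qed measurable
qed

lemma C1_domain_integrable:
  fixes g :: "'a \<Rightarrow> 'b::{banach, second_countable_topology}"
  assumes "continuous_on UNIV g"
  shows "integrable (leb \<Omega>) g"
proof -
  have "integrable lborel (\<lambda>x. indicator (closure \<Omega>) x *\<^sub>R g x)"
    using bounded_dom by (intro borel_integrable_compact continuous_on_subset[OF assms]) auto
  hence "integrable lborel (\<lambda>x. indicator \<Omega> x *\<^sub>R (indicator (closure \<Omega>) x *\<^sub>R g x))"
    using open_dom by - (rule integrable_mult_indicator, auto)
  moreover have "(\<lambda>x. indicator \<Omega> x *\<^sub>R (indicator (closure \<Omega>) x *\<^sub>R g x)) = (\<lambda>x. indicator \<Omega> x *\<^sub>R g x)"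
    using closure_subset by (fastforce simp: indicator_def fun_eq_iff)
  ultimately have "integrable lborel (\<lambda>x. indicator \<Omega> x *\<^sub>R g x)" by simp
  thus ?thesis using open_dom by (subst integrable_restrict_space) auto
qed

text \<open>Localised by a partition of unity on the closure of \<Omega>, each piece being covered
  by the interior or the chart version; the formula is linear in \<phi>.\<close>

theorem divergence:
  assumes \<phi>: "C1_with_gradient \<phi> \<phi>'" and e: "e \<in> Basis"
  shows "(LINT x|leb \<Omega>. \<phi>' x \<bullet> e) = (LINT x|\<sigma>. \<phi> x * (boundary_normal \<Omega> \<nu> x \<bullet> e))"
proof -
  have local: "\<exists>r>0. \<forall>\<phi> \<phi>'. C1_with_gradient \<phi> \<phi>' \<and> (\<forall>x. x \<notin> ball p r \<longrightarrow> \<phi> x = 0) \<longrightarrow>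
      (LINT x|leb \<Omega>. \<phi>' x \<bullet> e) = (LINT x|\<sigma>. \<phi> x * (boundary_normal \<Omega> \<nu> x \<bullet> e))"
    if p: "p \<in> closure \<Omega>" for p
  proof (cases "p \<in> \<Omega>")
    case True
    \<comment> \<open>The open ball carries the bump, the closed ball is the compact support
      required by the local versions.\<close>
    then obtain r where r: "r > 0" "cball p r \<subseteq> \<Omega>" using open_dom open_contains_cball by blast
    show ?thesis
      by (intro exI[of _ r] conjI allI impI divergence_interior[where K = "cball p r"]) (use r e in auto)
  next
    case False
    hence "p \<in> frontier \<Omega>" using p open_dom by (simp add: frontier_def interior_open)
    then obtain U b s \<gamma> \<gamma>' where U: "p \<in> U" and ch: "graph_chart \<Omega> U b s \<gamma> \<gamma>'"
      using C1_bd unfolding C1_boundary_def by blast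
    have "open U" using ch by (simp add: graph_chart_def)
    then obtain r where r: "r > 0" "cball p r \<subseteq> U" using U open_contains_cball by blast
    show ?thesis
      by (intro exI[of _ r] conjI allI impI divergence_chart[OF ch, where K = "cball p r"]) (use r e in auto)
  qed
  have "\<exists>r. \<forall>p\<in>closure \<Omega>. r p > 0 \<and> (\<forall>\<phi> \<phi>'. C1_with_gradient \<phi> \<phi>' \<and> (\<forall>x. x \<notin> ball p (r p) \<longrightarrow> \<phi> x = 0) \<longrightarrow>
      (LINT x|leb \<Omega>. \<phi>' x \<bullet> e) = (LINT x|\<sigma>. \<phi> x * (boundary_normal \<Omega> \<nu> x \<bullet> e)))"
    by (rule bchoice, rule ballI, rule local)
  then obtain r where r: "\<And>p. p \<in> closure \<Omega> \<Longrightarrow> r p > 0"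
    "\<And>p \<phi> \<phi>'. p \<in> closure \<Omega> \<Longrightarrow> C1_with_gradient \<phi> \<phi>' \<Longrightarrow> (\<And>x. x \<notin> ball p (r p) \<Longrightarrow> \<phi> x = 0) \<Longrightarrow>
      (LINT x|leb \<Omega>. \<phi>' x \<bullet> e) = (LINT x|\<sigma>. \<phi> x * (boundary_normal \<Omega> \<nu> x \<bullet> e))"
    by blast
  have "compact (closure \<Omega>)" using bounded_dom by simp
  then obtain I \<eta> \<eta>' where I: "finite I" "I \<subseteq> closure \<Omega>"
    "\<And>i. i \<in> I \<Longrightarrow> C1_with_gradient (\<eta> i) (\<eta>' i)" "\<And>i x. i \<in> I \<Longrightarrow> x \<notin> ball i (r i) \<Longrightarrow> \<eta> i x = 0"
    "\<And>x. x \<in> closure \<Omega> \<Longrightarrow> (\<Sum>i\<in>I. \<eta> i x) = 1"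
  proof (rule C1_partition_of_unity[where r = r], goal_cases)
    case (2 I \<eta> \<eta>')
    thus ?case by - (rule that)
  qed (rule r(1))
  define g where "g i x = \<phi> x * \<eta> i x" for i x
  define g' where "g' i x = \<phi> x *\<^sub>R \<eta>' i x + \<eta> i x *\<^sub>R \<phi>' x" for i x
  have g: "C1_with_gradient (g i) (g' i)" if "i \<in> I" for i
    unfolding g_def g'_def by (rule C1_mult[OF \<phi> I(3)[OF that]])
  have sum_g: "(\<Sum>i\<in>I. g i x) = \<phi> x" if "x \<in> closure \<Omega>" for x
    using I(5)[OF that] by (simp add: g_def flip: sum_distrib_left)
  \<comment> \<open>The partition sums to 1 throughout the open set \<Omega>, so no derivative of
    the cutoffs survives there.\<close>
  have sum_g': "(\<Sum>i\<in>I. g' i x) = \<phi>' x" if "x \<in> \<Omega>" for x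
    by (rule C1_gradient_unique[OF C1_sum[of I g g', OF g] \<phi> open_dom that])
       (use sum_g closure_subset in auto)
  obtain C where C: "\<And>x. norm (boundary_normal \<Omega> \<nu> x) \<le> C" using bounded_boundary_normal by blast
  have nb: "\<bar>boundary_normal \<Omega> \<nu> x \<bullet> e\<bar> \<le> C" for x
    using Basis_le_norm[OF e, of "boundary_normal \<Omega> \<nu> x"] C[of x] by linarith
  have "(LINT x|leb \<Omega>. \<phi>' x \<bullet> e) = (LINT x|leb \<Omega>. (\<Sum>i\<in>I. g' i x \<bullet> e))"
    by (rule Bochner_Integration.integral_cong)
       (auto simp: space_restrict_space inner_sum_left[symmetric] sum_g')
  also have "\<dots> = (\<Sum>i\<in>I. LINT x|leb \<Omega>. g' i x \<bullet> e)"
    by (rule Bochner_Integration.integral_sum)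
       (auto intro!: C1_domain_integrable continuous_intros C1_continuous_gradient[OF g])
  also have "\<dots> = (\<Sum>i\<in>I. LINT x|\<sigma>. g i x * (boundary_normal \<Omega> \<nu> x \<bullet> e))"
  proof (rule sum.cong[OF refl])
    fix i assume i: "i \<in> I"
    show "(LINT x|leb \<Omega>. g' i x \<bullet> e) = (LINT x|\<sigma>. g i x * (boundary_normal \<Omega> \<nu> x \<bullet> e))"
      by (rule r(2)[OF _ g[OF i]]) (use i I in \<open>auto simp: g_def\<close>)
  qed
  also have "\<dots> = (LINT x|\<sigma>. (\<Sum>i\<in>I. g i x * (boundary_normal \<Omega> \<nu> x \<bullet> e)))"
    by (rule Bochner_Integration.integral_sum[symmetric], rule C1_surface_integrable[OF g _ nb])
       (auto simp: measurable_cong_sets[OF sets_surface refl])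
  also have "\<dots> = (LINT x|\<sigma>. \<phi> x * (boundary_normal \<Omega> \<nu> x \<bullet> e))"
    by (rule Bochner_Integration.integral_cong)
       (auto simp: sum_distrib_right[symmetric] boundary_normal_def indicator_def sum_g frontier_def)
  finally show ?thesis .
qed

end

section \<open>Square integrable functions and the fundamental lemma of the calculus of variations\<close>

lemma L2_measurable: "f \<in> L2 M \<Longrightarrow> f \<in> borel_measurable M" by (simp add: L2_def)

lemma L2_square_integrable: "f \<in> L2 M \<Longrightarrow> integrable M (\<lambda>x. (norm (f x))\<^sup>2)" by (simp add: L2_def)

lemma norm_add_square_le: "(norm (x + y :: 'c::real_normed_vector))\<^sup>2 \<le> 2 * (norm x)\<^sup>2 + 2 * (norm y)\<^sup>2"
proof -
  have "(norm (x + y))\<^sup>2 \<le> (norm x + norm y)\<^sup>2" by (intro power_mono norm_triangle_ineq) auto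
  also have "\<dots> \<le> 2 * (norm x)\<^sup>2 + 2 * (norm y)\<^sup>2"
    using zero_le_power2[of "norm x - norm y"] by (simp add: power2_eq_square algebra_simps)
  finally show ?thesis .
qed

lemma L2_lin:
  fixes f g :: "'b \<Rightarrow> 'c::euclidean_space"
  assumes "f \<in> L2 M" "g \<in> L2 M"
  shows "(\<lambda>x. \<alpha> *\<^sub>R f x + \<beta> *\<^sub>R g x) \<in> L2 M"
proof -
  note [measurable] = assms[THEN L2_measurable]
  have "integrable M (\<lambda>x. (norm (\<alpha> *\<^sub>R f x + \<beta> *\<^sub>R g x))\<^sup>2)"
  proof (rule Bochner_Integration.integrable_bound)
    show "integrable M (\<lambda>x. 2 * (\<alpha>\<^sup>2 * (norm (f x))\<^sup>2) + 2 * (\<beta>\<^sup>2 * (norm (g x))\<^sup>2))"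
      using assms[THEN L2_square_integrable] by (intro Bochner_Integration.integrable_add integrable_mult_right)
    show "AE x in M. norm ((norm (\<alpha> *\<^sub>R f x + \<beta> *\<^sub>R g x))\<^sup>2) \<le>
        norm (2 * (\<alpha>\<^sup>2 * (norm (f x))\<^sup>2) + 2 * (\<beta>\<^sup>2 * (norm (g x))\<^sup>2))"
      using norm_add_square_le[of "\<alpha> *\<^sub>R f _" "\<beta> *\<^sub>R g _"] by (simp add: power_mult_distrib)
  qed measurable
  thus ?thesis by (simp add: L2_def)
qed

lemma L2_lin_real:
  "f \<in> L2 M \<Longrightarrow> g \<in> L2 M \<Longrightarrow> (\<lambda>x. \<alpha> * f x + \<beta> * g x :: real) \<in> L2 M"
  using L2_lin[of f M g \<alpha> \<beta>] by simp

lemma L2_diff: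
  fixes f g :: "'b \<Rightarrow> 'c::euclidean_space"
  shows "f \<in> L2 M \<Longrightarrow> g \<in> L2 M \<Longrightarrow> (\<lambda>x. f x - g x) \<in> L2 M"
  using L2_lin[of f M g 1 "-1"] by simp

lemma L2_inner_integrable:
  fixes f g :: "'b \<Rightarrow> 'c::euclidean_space"
  assumes "f \<in> L2 M" "g \<in> L2 M"
  shows "integrable M (\<lambda>x. f x \<bullet> g x)"
proof (rule Bochner_Integration.integrable_bound)
  note [measurable] = assms[THEN L2_measurable]
  show "(\<lambda>x. f x \<bullet> g x) \<in> borel_measurable M" by measurable
  show "integrable M (\<lambda>x. (norm (f x))\<^sup>2 + (norm (g x))\<^sup>2)"
    using assms[THEN L2_square_integrable] by (rule Bochner_Integration.integrable_add)
  have "\<bar>f x \<bullet> g x\<bar> \<le> (norm (f x))\<^sup>2 + (norm (g x))\<^sup>2" for x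
  proof -
    have "\<bar>f x \<bullet> g x\<bar> \<le> norm (f x) * norm (g x)" by (rule Cauchy_Schwarz_ineq2)
    also have "\<dots> \<le> (norm (f x))\<^sup>2 + (norm (g x))\<^sup>2"
      using zero_le_power2[of "norm (f x) - norm (g x)"] mult_nonneg_nonneg[OF norm_ge_zero norm_ge_zero, of "f x" "g x"]
      unfolding power2_diff by linarith
    finally show ?thesis .
  qed
  thus "AE x in M. norm (f x \<bullet> g x) \<le> norm ((norm (f x))\<^sup>2 + (norm (g x))\<^sup>2)" by simp
qed

lemma L2_mult_integrable: "f \<in> L2 M \<Longrightarrow> g \<in> L2 M \<Longrightarrow> integrable M (\<lambda>x. f x * g x :: real)"
  using L2_inner_integrable[of f M g] by simp

lemma L2_inner_const:
  fixes f :: "'b \<Rightarrow> 'c::euclidean_space"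
  assumes "f \<in> L2 M" shows "(\<lambda>x. f x \<bullet> e) \<in> L2 M"
proof -
  note [measurable] = L2_measurable[OF assms]
  have "integrable M (\<lambda>x. (norm (f x \<bullet> e))\<^sup>2)"
  proof (rule Bochner_Integration.integrable_bound)
    show "integrable M (\<lambda>x. (norm e)\<^sup>2 * (norm (f x))\<^sup>2)"
      using L2_square_integrable[OF assms] by (rule integrable_mult_right)
    have "(f x \<bullet> e)\<^sup>2 \<le> (norm e)\<^sup>2 * (norm (f x))\<^sup>2" for x
      using power_mono[OF Cauchy_Schwarz_ineq2[of "f x" e] abs_ge_zero, of 2] by (simp add: power_mult_distrib mult.commute)
    thus "AE x in M. norm ((norm (f x \<bullet> e))\<^sup>2) \<le> norm ((norm e)\<^sup>2 * (norm (f x))\<^sup>2)" by simp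
  qed measurable
  thus ?thesis by (simp add: L2_def)
qed

lemma L2_mult_bounded:
  fixes f h :: "'b \<Rightarrow> real"
  assumes f: "f \<in> L2 M" and [measurable]: "h \<in> borel_measurable M" and h: "AE x in M. \<bar>h x\<bar> \<le> C"
  shows "(\<lambda>x. f x * h x) \<in> L2 M" and "(\<integral>x. (f x * h x)\<^sup>2 \<partial>M) \<le> C\<^sup>2 * (\<integral>x. (f x)\<^sup>2 \<partial>M)"
proof -
  note [measurable] = L2_measurable[OF f]
  have b: "AE x in M. (f x * h x)\<^sup>2 \<le> C\<^sup>2 * (f x)\<^sup>2"
    using h
  proof eventually_elim
    fix x assume "\<bar>h x\<bar> \<le> C"
    hence "(h x)\<^sup>2 \<le> C\<^sup>2" using power_mono[of "\<bar>h x\<bar>" C 2] by simp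
    thus "(f x * h x)\<^sup>2 \<le> C\<^sup>2 * (f x)\<^sup>2" using mult_right_mono[of "(h x)\<^sup>2" "C\<^sup>2" "(f x)\<^sup>2"] by (simp add: power_mult_distrib mult.commute)
  qed
  have i: "integrable M (\<lambda>x. C\<^sup>2 * (f x)\<^sup>2)"
    using L2_square_integrable[OF f] by (auto intro: integrable_mult_right)
  have i2: "integrable M (\<lambda>x. (f x * h x)\<^sup>2)"
    by (rule Bochner_Integration.integrable_bound[OF i]) (use b in auto)
  thus "(\<lambda>x. f x * h x) \<in> L2 M" by (simp add: L2_def)
  show "(\<integral>x. (f x * h x)\<^sup>2 \<partial>M) \<le> C\<^sup>2 * (\<integral>x. (f x)\<^sup>2 \<partial>M)"
    using integral_mono_AE[OF i2 i b] by simp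
qed

text \<open>Makes the abstract continuity of pairings available for \<open>L2\<close>, whose
  elements are functions and whose form is therefore only semidefinite.\<close>

lemma L2_semi_inner_product:
  "semi_inner_product (L2 M) (\<lambda>\<alpha> f \<beta> g x. \<alpha> * f x + \<beta> * g x) (\<lambda>f g. \<integral>x. f x * g x \<partial>M :: real)"
proof
  fix f g h :: "'a \<Rightarrow> real" and \<alpha> \<beta> :: real
  assume f: "f \<in> L2 M" and g: "g \<in> L2 M"
  show "(\<lambda>x. \<alpha> * f x + \<beta> * g x) \<in> L2 M" by (rule L2_lin_real[OF f g])
  show "(\<integral>x. f x * g x \<partial>M) = (\<integral>x. g x * f x \<partial>M)" by (simp add: mult.commute)
  show "0 \<le> (\<integral>x. f x * f x \<partial>M)" by simp
  assume h: "h \<in> L2 M"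
  have "(\<integral>x. (\<alpha> * f x + \<beta> * g x) * h x \<partial>M) = (\<integral>x. \<alpha> * (f x * h x) + \<beta> * (g x * h x) \<partial>M)"
    by (simp add: algebra_simps)
  also have "\<dots> = \<alpha> * (\<integral>x. f x * h x \<partial>M) + \<beta> * (\<integral>x. g x * h x \<partial>M)"
    by (subst Bochner_Integration.integral_add) (auto intro!: integrable_mult_right L2_mult_integrable f g h)
  finally show "(\<integral>x. (\<alpha> * f x + \<beta> * g x) * h x \<partial>M) = \<alpha> * (\<integral>x. f x * h x \<partial>M) + \<beta> * (\<integral>x. g x * h x \<partial>M)" .
qed

text \<open>The bounded weight is absorbed into the second factor, which keeps \<open>L2\<close>
  convergence; then the pairing is continuous.\<close>

lemma L2_tendsto_product:
  fixes f g :: "'b \<Rightarrow> real"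
  assumes L2: "\<And>k::nat. fs k \<in> L2 M" "\<And>k. gs k \<in> L2 M" "f \<in> L2 M" "g \<in> L2 M"
    and lims: "(\<lambda>k. \<integral>x. (fs k x - f x)\<^sup>2 \<partial>M) \<longlonglongrightarrow> 0" "(\<lambda>k. \<integral>x. (gs k x - g x)\<^sup>2 \<partial>M) \<longlonglongrightarrow> 0"
    and h: "h \<in> borel_measurable M" "AE x in M. \<bar>h x\<bar> \<le> C"
  shows "(\<lambda>k. \<integral>x. fs k x * gs k x * h x \<partial>M) \<longlonglongrightarrow> (\<integral>x. f x * g x * h x \<partial>M)"
proof -
  interpret semi_inner_product "L2 M" "\<lambda>\<alpha> f \<beta> g x. \<alpha> * f x + \<beta> * g x" "\<lambda>f g. \<integral>x. f x * g x \<partial>M :: real"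
    by (rule L2_semi_inner_product)
  have "(\<lambda>k. \<integral>x. fs k x * (gs k x * h x) \<partial>M) \<longlonglongrightarrow> (\<integral>x. f x * (g x * h x) \<partial>M)"
  proof (rule tendsto_form)
    show "(\<lambda>k. form_norm (\<lambda>x. 1 * fs k x + - 1 * f x)) \<longlonglongrightarrow> 0"
      using tendsto_real_sqrt[OF lims(1)] by (simp add: form_norm_def power2_eq_square)
    have "(\<lambda>k. \<integral>x. (gs k x * h x - g x * h x)\<^sup>2 \<partial>M) \<longlonglongrightarrow> 0"
    proof (rule tendsto_sandwich[OF _ _ tendsto_const])
      show "(\<lambda>k. C\<^sup>2 * (\<integral>x. (gs k x - g x)\<^sup>2 \<partial>M)) \<longlonglongrightarrow> 0" by (rule tendsto_mult_right_zero[OF lims(2)])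
      show "\<forall>\<^sub>F k in sequentially. (\<integral>x. (gs k x * h x - g x * h x)\<^sup>2 \<partial>M) \<le> C\<^sup>2 * (\<integral>x. (gs k x - g x)\<^sup>2 \<partial>M)"
        using L2_mult_bounded(2)[OF L2_diff[OF L2(2,4)] h] by (simp add: left_diff_distrib)
    qed simp
    from tendsto_real_sqrt[OF this]
    show "(\<lambda>k. form_norm (\<lambda>x. 1 * (gs k x * h x) + - 1 * (g x * h x))) \<longlonglongrightarrow> 0"
      by (simp add: form_norm_def power2_eq_square)
  qed (auto intro: L2_mult_bounded[OF _ h] L2)
  thus ?thesis by (simp add: mult.assoc)
qed

lemma L2_tendsto_lin:
  fixes f g :: "'b \<Rightarrow> 'c::euclidean_space"
  assumes L2: "\<And>k::nat. fs k \<in> L2 M" "\<And>k. gs k \<in> L2 M" "f \<in> L2 M" "g \<in> L2 M"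
    and lims: "(\<lambda>k. \<integral>x. (norm (fs k x - f x))\<^sup>2 \<partial>M) \<longlonglongrightarrow> 0" "(\<lambda>k. \<integral>x. (norm (gs k x - g x))\<^sup>2 \<partial>M) \<longlonglongrightarrow> 0"
  shows "(\<lambda>k. \<integral>x. (norm ((\<alpha> *\<^sub>R fs k x + \<beta> *\<^sub>R gs k x) - (\<alpha> *\<^sub>R f x + \<beta> *\<^sub>R g x)))\<^sup>2 \<partial>M) \<longlonglongrightarrow> 0"
proof (rule tendsto_sandwich[OF _ _ tendsto_const])
  show "(\<lambda>k. 2 * (\<alpha>\<^sup>2 * (\<integral>x. (norm (fs k x - f x))\<^sup>2 \<partial>M)) + 2 * (\<beta>\<^sup>2 * (\<integral>x. (norm (gs k x - g x))\<^sup>2 \<partial>M))) \<longlonglongrightarrow> 0"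
    by (intro tendsto_add_zero tendsto_mult_right_zero lims)
  have "(\<integral>x. (norm ((\<alpha> *\<^sub>R fs k x + \<beta> *\<^sub>R gs k x) - (\<alpha> *\<^sub>R f x + \<beta> *\<^sub>R g x)))\<^sup>2 \<partial>M) \<le>
      2 * (\<alpha>\<^sup>2 * (\<integral>x. (norm (fs k x - f x))\<^sup>2 \<partial>M)) + 2 * (\<beta>\<^sup>2 * (\<integral>x. (norm (gs k x - g x))\<^sup>2 \<partial>M))" for k
  proof -
    note d = L2_diff[OF L2(1) L2(3), of k] L2_diff[OF L2(2) L2(4), of k]
    have eq: "(\<alpha> *\<^sub>R fs k x + \<beta> *\<^sub>R gs k x) - (\<alpha> *\<^sub>R f x + \<beta> *\<^sub>R g x) = \<alpha> *\<^sub>R (fs k x - f x) + \<beta> *\<^sub>R (gs k x - g x)" for x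
      by (simp add: algebra_simps)
    have "(\<integral>x. (norm (\<alpha> *\<^sub>R (fs k x - f x) + \<beta> *\<^sub>R (gs k x - g x)))\<^sup>2 \<partial>M) \<le>
      (\<integral>x. 2 * (\<alpha>\<^sup>2 * (norm (fs k x - f x))\<^sup>2) + 2 * (\<beta>\<^sup>2 * (norm (gs k x - g x))\<^sup>2) \<partial>M)"
    proof (rule integral_mono)
      show "integrable M (\<lambda>x. (norm (\<alpha> *\<^sub>R (fs k x - f x) + \<beta> *\<^sub>R (gs k x - g x)))\<^sup>2)"
        by (rule L2_square_integrable[OF L2_lin[OF d]])
      show "integrable M (\<lambda>x. 2 * (\<alpha>\<^sup>2 * (norm (fs k x - f x))\<^sup>2) + 2 * (\<beta>\<^sup>2 * (norm (gs k x - g x))\<^sup>2))"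
        by (intro Bochner_Integration.integrable_add integrable_mult_right L2_square_integrable d)
      fix x show "(norm (\<alpha> *\<^sub>R (fs k x - f x) + \<beta> *\<^sub>R (gs k x - g x)))\<^sup>2 \<le>
          2 * (\<alpha>\<^sup>2 * (norm (fs k x - f x))\<^sup>2) + 2 * (\<beta>\<^sup>2 * (norm (gs k x - g x))\<^sup>2)"
        using norm_add_square_le[of "\<alpha> *\<^sub>R (fs k x - f x)" "\<beta> *\<^sub>R (gs k x - g x)"] by (simp add: power_mult_distrib)
    qed
    also have "\<dots> = 2 * (\<alpha>\<^sup>2 * (\<integral>x. (norm (fs k x - f x))\<^sup>2 \<partial>M)) + 2 * (\<beta>\<^sup>2 * (\<integral>x. (norm (gs k x - g x))\<^sup>2 \<partial>M))"
      by (subst Bochner_Integration.integral_add) (auto intro!: integrable_mult_right L2_square_integrable d)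
    finally show ?thesis unfolding eq .
  qed
  thus "\<forall>\<^sub>F k in sequentially. (\<integral>x. (norm ((\<alpha> *\<^sub>R fs k x + \<beta> *\<^sub>R gs k x) - (\<alpha> *\<^sub>R f x + \<beta> *\<^sub>R g x)))\<^sup>2 \<partial>M) \<le>
      2 * (\<alpha>\<^sup>2 * (\<integral>x. (norm (fs k x - f x))\<^sup>2 \<partial>M)) + 2 * (\<beta>\<^sup>2 * (\<integral>x. (norm (gs k x - g x))\<^sup>2 \<partial>M))" by simp
qed simp

section \<open>Test functions approximating indicators of boxes\<close>

lemma C1_prod_ex:
  "finite I \<Longrightarrow> (\<And>i. i \<in> I \<Longrightarrow> \<exists>f'. C1_with_gradient (f i) f') \<Longrightarrow>
    \<exists>g'. C1_with_gradient (\<lambda>x. \<Prod>i\<in>I. f i x) g'"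
proof (induction I rule: finite_induct)
  case empty
  show ?case using C1_const[of 1] by auto
next
  case (insert i I)
  have "\<exists>f'. C1_with_gradient (f i) f'" "\<exists>g'. C1_with_gradient (\<lambda>x. \<Prod>i\<in>I. f i x) g'"
    by (auto intro: insert)
  then obtain f' g' where "C1_with_gradient (f i) f'" "C1_with_gradient (\<lambda>x. \<Prod>i\<in>I. f i x) g'" by blast
  from C1_mult[OF this] show ?case using insert by auto
qed

definition box_bump :: "'a::euclidean_space \<Rightarrow> 'a \<Rightarrow> 'a \<Rightarrow> real" where
  "box_bump l u x = (\<Prod>i\<in>Basis. pos_square ((x - l) \<bullet> i) * pos_square ((u - x) \<bullet> i))"

lemma C1_box_bump: "\<exists>g'. C1_with_gradient (box_bump l u) g'"
  unfolding box_bump_def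
proof (rule C1_prod_ex)
  fix i
  have 1: "C1_with_gradient (\<lambda>x. pos_square ((x - l) \<bullet> i)) (\<lambda>x. (2 * max 0 ((x - l) \<bullet> i)) *\<^sub>R i)"
    using C1_pos_square[OF C1_add[OF C1_inner[of i] C1_const[of "- (l \<bullet> i)"]]]
    by (simp add: inner_diff_left)
  have 2: "C1_with_gradient (\<lambda>x. pos_square ((u - x) \<bullet> i)) (\<lambda>x. (2 * max 0 ((u - x) \<bullet> i)) *\<^sub>R - i)"
    using C1_pos_square[OF C1_add[OF C1_const[of "u \<bullet> i"] C1_cmult[OF C1_inner[of i], of "-1"]]]
    by (simp add: inner_diff_left)
  show "\<exists>f'. C1_with_gradient (\<lambda>x. pos_square ((x - l) \<bullet> i) * pos_square ((u - x) \<bullet> i)) f'"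
    using C1_mult[OF 1 2] by blast
qed simp

lemma box_bump_nonzero_iff: "box_bump l u x \<noteq> 0 \<longleftrightarrow> x \<in> box l u"
  by (auto simp: box_bump_def pos_square_eq_0_iff mem_box inner_diff_left not_le)

text \<open>As \<open>k\<close> grows these functions increase to the indicator of the set where
  \<open>h\<close> is nonzero, while staying \<open>C\<^sup>1\<close>, between 0 and 1, and zero
  wherever \<open>h\<close> is.\<close>

lemma C1_saturate:
  assumes "C1_with_gradient h h'"
  shows "\<exists>g'. C1_with_gradient (\<lambda>x. real k * (h x)\<^sup>2 / (1 + real k * (h x)\<^sup>2)) g'"
proof -
  have pos: "1 + real k * y\<^sup>2 > 0" for y by (simp add: add_pos_nonneg)
  have "((\<lambda>y. real k * y\<^sup>2 / (1 + real k * y\<^sup>2)) has_real_derivative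
      (real k * (2 * y) * (1 + real k * y\<^sup>2) - real k * y\<^sup>2 * (real k * (2 * y))) / ((1 + real k * y\<^sup>2) * (1 + real k * y\<^sup>2))) (at y)" for y
    by (rule DERIV_divide) (use pos[of y] in \<open>auto intro!: derivative_eq_intros\<close>)
  moreover have "continuous_on UNIV (\<lambda>y. (real k * (2 * y) * (1 + real k * y\<^sup>2) - real k * y\<^sup>2 * (real k * (2 * y))) / ((1 + real k * y\<^sup>2) * (1 + real k * y\<^sup>2)))"
    using pos by (intro continuous_intros) (auto simp: less_le)
  ultimately show ?thesis using C1_compose[OF _ _ assms] by fast
qed

lemma saturate_bounds: "0 \<le> real k * y\<^sup>2 / (1 + real k * y\<^sup>2)" "real k * y\<^sup>2 / (1 + real k * y\<^sup>2) \<le> 1"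
  by (simp_all add: divide_le_eq_1 add_pos_nonneg)

lemma saturate_tendsto:
  assumes "y \<noteq> 0" shows "(\<lambda>k. real k * y\<^sup>2 / (1 + real k * y\<^sup>2)) \<longlonglongrightarrow> 1"
proof -
  have "y\<^sup>2 > 0" using assms by simp
  have "filterlim (\<lambda>k. 1 + real k * y\<^sup>2) at_top sequentially"
    using \<open>y\<^sup>2 > 0\<close> by (intro filterlim_tendsto_add_at_top[OF tendsto_const]
       filterlim_at_top_mult_tendsto_pos[OF tendsto_const _ filterlim_real_sequentially, of "y\<^sup>2"])
  hence "(\<lambda>k. 1 - 1 / (1 + real k * y\<^sup>2)) \<longlonglongrightarrow> 1 - 0"
    by (intro tendsto_diff tendsto_const tendsto_divide_0[OF tendsto_const] filterlim_at_top_imp_at_infinity)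
  moreover have "1 - 1 / (1 + real k * y\<^sup>2) = real k * y\<^sup>2 / (1 + real k * y\<^sup>2)" for k
  proof -
    have "1 + real k * y\<^sup>2 > 0" by (simp add: add_pos_nonneg)
    thus ?thesis by (simp add: field_simps)
  qed
  ultimately show ?thesis by simp
qed

text \<open>The positive and negative parts are densities of two measures that agree on open boxes,
  a generating family stable under intersection; so the measures and then the densities
  agree.\<close>

lemma AE_zero_if_box_integrals_zero:
  fixes G :: "'a::euclidean_space \<Rightarrow> real"
  assumes G: "integrable lborel G" and box0: "\<And>c d. (LBINT x. indicator (box c d) x * G x) = 0"
  shows "AE x in lborel. G x = 0"
proof -
  define Gp where "Gp x = max 0 (G x)" for x
  define Gn where "Gn x = max 0 (- G x)" for x
  have i: "integrable lborel Gp" "integrable lborel Gn"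
    unfolding Gp_def Gn_def by (auto intro!: integrable_max G)
  have [measurable]: "Gp \<in> borel_measurable borel" "Gn \<in> borel_measurable borel" using i by auto
  have nn: "0 \<le> Gp x" "0 \<le> Gn x" "G x = Gp x - Gn x" for x by (auto simp: Gp_def Gn_def)
  have em: "emeasure (density lborel (\<lambda>x. ennreal (g x))) A = ennreal (LBINT x. indicator A x * g x)"
    if "integrable lborel g" "\<And>x. 0 \<le> g x" "A \<in> sets borel" for g :: "'a \<Rightarrow> real" and A
  proof -
    have "emeasure (density lborel (\<lambda>x. ennreal (g x))) A = (\<integral>\<^sup>+ x. ennreal (indicator A x * g x) \<partial>lborel)"
      using that by (subst emeasure_density) (auto simp: indicator_def intro!: nn_integral_cong)
    also have "\<dots> = ennreal (LBINT x. indicator A x * g x)"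
      using integrable_mult_indicator[of A lborel g] that by (intro nn_integral_eq_integral) auto
    finally show ?thesis .
  qed
  have "density lborel Gp = density lborel Gn"
  proof (rule measure_eqI_generator_eq)
    let ?E = "range (\<lambda>(a, b). box a b :: 'a set)"
    show "Int_stable ?E" by (auto simp: Int_stable_def box_Int_box)
    show "?E \<subseteq> Pow UNIV" "sets (density lborel Gp) = sigma_sets UNIV ?E" "sets (density lborel Gn) = sigma_sets UNIV ?E"
      by (simp_all add: borel_eq_box)
    let ?A = "\<lambda>n::nat. box (- (real n *\<^sub>R One)) (real n *\<^sub>R One) :: 'a set"
    show "range ?A \<subseteq> ?E" "(\<Union>i. ?A i) = UNIV" unfolding UN_box_eq_UNIV by auto
    show "emeasure (density lborel Gp) (?A i) \<noteq> \<infinity>" for i using em[OF i(1) nn(1)] by simp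
    fix A assume "A \<in> ?E"
    then obtain c d where A: "A = box c d" by auto
    have "(LBINT x. indicator A x * Gp x) - (LBINT x. indicator A x * Gn x) = (LBINT x. indicator A x * G x)"
      using integrable_mult_indicator[OF _ i(1), of A] integrable_mult_indicator[OF _ i(2), of A]
      by (subst Bochner_Integration.integral_diff[symmetric]) (auto simp: A nn(3) right_diff_distrib)
    thus "emeasure (density lborel Gp) A = emeasure (density lborel Gn) A"
      using box0[of c d] by (simp add: em i nn A)
  qed
  hence "AE x in lborel. ennreal (Gp x) = ennreal (Gn x)" by (intro sigma_finite_measure.density_unique[OF sigma_finite_lborel]) auto
  thus ?thesis by eventually_elim (simp add: nn)
qed

definition test_function :: "'a::euclidean_space set \<Rightarrow> ('a \<Rightarrow> real) \<Rightarrow> ('a \<Rightarrow> 'a) \<Rightarrow> bool" where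
  "test_function \<Omega> \<phi> \<phi>' \<longleftrightarrow>
     C1_with_gradient \<phi> \<phi>' \<and> (\<exists>K. compact K \<and> K \<subseteq> \<Omega> \<and> (\<forall>x. x \<notin> K \<longrightarrow> \<phi> x = 0))"

text \<open>Testing with saturated bumps gives, in the limit, vanishing integrals over all boxes
  inside a fixed box whose closure lies in \<Omega>. Countably many such boxes cover
  \<Omega>.\<close>

lemma fundamental_lemma:
  fixes g :: "'a::euclidean_space \<Rightarrow> real"
  assumes "open \<Omega>" and g: "g \<in> L2 (leb \<Omega>)"
    and test: "\<And>\<phi> \<phi>'. test_function \<Omega> \<phi> \<phi>' \<Longrightarrow> (LINT x|leb \<Omega>. \<phi> x * g x) = 0"
  shows "AE x in leb \<Omega>. g x = 0"
proof -
  define G where "G x = indicator \<Omega> x * g x" for x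
  have Om: "\<Omega> \<inter> space lborel \<in> sets lborel" using \<open>open \<Omega>\<close> by simp
  have [measurable]: "\<Omega> \<in> sets borel" using \<open>open \<Omega>\<close> by simp
  have Gm [measurable]: "G \<in> borel_measurable borel"
    using L2_measurable[OF g] unfolding borel_measurable_restrict_space_iff[OF Om] G_def[abs_def] by simp
  have G2: "integrable lborel (\<lambda>x. (G x)\<^sup>2)"
    using L2_square_integrable[OF g] unfolding integrable_restrict_space[OF Om]
    by (rule Bochner_Integration.integrable_cong[THEN iffD1, rotated 2]) (auto simp: G_def indicator_def)
  have loc: "AE x in lborel. x \<in> box a b \<longrightarrow> G x = 0" if ab: "cbox a b \<subseteq> \<Omega>" for a b
  proof -
    define g1 where "g1 x = indicator (box a b) x * G x" for x
    \<comment> \<open>Local integrability from square integrability, by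
      \<open>\<bar>t\<bar> \<le> 1 + t\<^sup>2\<close> on the box of finite measure.\<close>
    have ib: "integrable lborel (\<lambda>x. indicator (box a b) x + (G x)\<^sup>2)"
      by (intro Bochner_Integration.integrable_add G2 integrable_real_indicator)
         (use emeasure_bounded_finite[OF bounded_box, of a b] in auto)
    have g1: "integrable lborel g1"
    proof (rule Bochner_Integration.integrable_bound[OF ib])
      have "\<bar>G x\<bar> \<le> 1 + (G x)\<^sup>2" for x
        using zero_le_power2[of "\<bar>G x\<bar> - 1"] zero_le_power2[of "G x"] by (simp add: power2_diff)
      thus "AE x in lborel. norm (g1 x) \<le> norm (indicator (box a b) x + (G x)\<^sup>2)"
        by (auto simp: g1_def indicator_def)
    qed (simp add: g1_def[abs_def])
    have "AE x in lborel. g1 x = 0"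
    proof (rule AE_zero_if_box_integrals_zero[OF g1])
      fix c d
      \<comment> \<open>Nonzero exactly on the intersection of the two boxes: the box
        \<open>c d\<close> is the one being tested, the box \<open>a b\<close> keeps the support
        compact in \<Omega>.\<close>
      define h where "h x = box_bump c d x * box_bump a b x" for x
      obtain p p' where "C1_with_gradient (box_bump c d) p" "C1_with_gradient (box_bump a b) p'"
        using C1_box_bump by metis
      from C1_mult[OF this] obtain h' where h': "C1_with_gradient h h'" unfolding h_def by blast
      have h0: "h x \<noteq> 0 \<longleftrightarrow> x \<in> box c d \<and> x \<in> box a b" for x
        using box_bump_nonzero_iff unfolding h_def by fastforce
      define \<phi> where "\<phi> k x = real k * (h x)\<^sup>2 / (1 + real k * (h x)\<^sup>2)" for k x
      have "\<forall>k. \<exists>g'. C1_with_gradient (\<phi> k) g'" unfolding \<phi>_def using C1_saturate[OF h'] by blast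
      from choice[OF this] obtain \<phi>' where \<phi>': "\<And>k. C1_with_gradient (\<phi> k) (\<phi>' k)" by blast
      have \<phi>0: "\<phi> k x = 0" if "x \<notin> cbox a b" for k x
        using h0[of x] that box_subset_cbox[of a b] by (auto simp: \<phi>_def)
      have [measurable]: "\<phi> k \<in> borel_measurable borel" for k
        by (intro borel_measurable_continuous_onI C1_continuous[OF \<phi>'])
      have "(LBINT x. \<phi> k x * g1 x) = 0" for k
      proof -
        have "test_function \<Omega> (\<phi> k) (\<phi>' k)"
          unfolding test_function_def using \<phi>' \<phi>0 ab by (blast intro: compact_cbox)
        hence "(LINT x|leb \<Omega>. \<phi> k x * g x) = 0" by (rule test)
        hence "(LBINT x. indicator \<Omega> x *\<^sub>R (\<phi> k x * g x)) = 0"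
          unfolding integral_restrict_space[OF Om] .
        moreover have "(\<lambda>x. indicator \<Omega> x *\<^sub>R (\<phi> k x * g x)) = (\<lambda>x. \<phi> k x * g1 x)"
        proof
          fix x show "indicator \<Omega> x *\<^sub>R (\<phi> k x * g x) = \<phi> k x * g1 x"
            using h0[of x] by (cases "h x = 0") (auto simp: \<phi>_def g1_def G_def indicator_def)
        qed
        ultimately show ?thesis by simp
      qed
      moreover have "(\<lambda>k. \<integral>x. \<phi> k x * g1 x \<partial>lborel) \<longlonglongrightarrow> (LBINT x. indicator (box c d) x * g1 x)"
      proof (rule integral_dominated_convergence[where w = "\<lambda>x. \<bar>g1 x\<bar>"])
        show "AE x in lborel. (\<lambda>k. \<phi> k x * g1 x) \<longlonglongrightarrow> indicator (box c d) x * g1 x"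
        proof (rule AE_I2)
          fix x
          show "(\<lambda>k. \<phi> k x * g1 x) \<longlonglongrightarrow> indicator (box c d) x * g1 x"
          proof (cases "h x = 0")
            case True
            hence z: "indicator (box c d) x * g1 x = 0" using h0[of x] by (auto simp: g1_def indicator_def)
            show ?thesis unfolding z using True by (simp add: \<phi>_def)
          next
            case False
            hence "indicator (box c d) x = (1::real)" using h0[of x] by simp
            thus ?thesis unfolding \<phi>_def using tendsto_mult[OF saturate_tendsto[OF False] tendsto_const] by simp
          qed
        qed
        show "AE x in lborel. norm (\<phi> k x * g1 x) \<le> \<bar>g1 x\<bar>" for k
        proof -
          have "0 \<le> \<phi> k x" "\<phi> k x \<le> 1" for x unfolding \<phi>_def by (rule saturate_bounds)+
          thus ?thesis by (auto simp: abs_mult intro!: mult_left_le_one_le)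
        qed
      qed (use g1 in auto)
      ultimately show "(LBINT x. indicator (box c d) x * g1 x) = 0"
        using LIMSEQ_unique[OF _ tendsto_const] by auto
    qed
    thus ?thesis by eventually_elim (auto simp: g1_def)
  qed
  define F where "F = {box a b |a b. cbox a b \<subseteq> \<Omega>}"
  have "open S" if "S \<in> F" for S using that by (auto simp: F_def open_box)
  \<comment> \<open>A countable subcover is needed to unite the exceptional null sets.\<close>
  then obtain F' where F': "F' \<subseteq> F" "countable F'" "\<Union>F' = \<Union>F" by (rule Lindelof)
  have "\<Omega> \<subseteq> \<Union>F"
  proof
    fix x assume x: "x \<in> \<Omega>"
    obtain a b where "cbox a b \<subseteq> \<Omega>" "x \<in> box a b" "\<forall>i\<in>Basis. a \<bullet> i < b \<bullet> i"
      by (rule open_contains_cbox[OF \<open>open \<Omega>\<close> x])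
    thus "x \<in> \<Union>F" unfolding F_def by auto
  qed
  have "AE x in lborel. \<forall>X\<in>F'. x \<in> X \<longrightarrow> G x = 0"
    using F' loc by (subst AE_ball_countable) (auto simp: F_def)
  hence "AE x in lborel. x \<in> \<Omega> \<longrightarrow> G x = 0"
    by eventually_elim (use \<open>\<Omega> \<subseteq> \<Union>F\<close> F'(3) in blast)
  hence "AE x in lborel. x \<in> \<Omega> \<longrightarrow> g x = 0" by eventually_elim (auto simp: G_def)
  thus ?thesis using Om by (subst AE_restrict_space_iff) auto
qed

section \<open>Absolutely continuous functions on the unit interval\<close>

text \<open>Up to boundary terms, the two integrals are those of \<open>f s * g t\<close> over the two halves \<open>s \<le> t\<close>
  and \<open>t \<le> s\<close> of the unit square.\<close>

lemma indefinite_integral_by_parts: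
  fixes f g F G :: "real \<Rightarrow> real"
  assumes f: "integrable lborel f" and g: "integrable lborel g"
    and F: "\<And>t. t \<in> {0..1} \<Longrightarrow> F t = F 0 + (LBINT s. indicator {0..t} s * f s)"
    and G: "\<And>t. t \<in> {0..1} \<Longrightarrow> G t = G 0 + (LBINT s. indicator {0..t} s * g s)"
  shows "(LBINT t. indicator {0..1} t * (F t * g t)) + (LBINT t. indicator {0..1} t * (f t * G t))
      = F 1 * G 1 - F 0 * G 0"
    and "integrable lborel (\<lambda>t. indicator {0..1} t * (F t * g t))"
proof -
  have [measurable]: "f \<in> borel_measurable borel" "g \<in> borel_measurable borel" using f g by auto
  define f1 where "f1 s = indicator {0..1} s * f s" for s
  define g1 where "g1 s = indicator {0..1} s * g s" for s
  have f1: "integrable lborel f1" and g1: "integrable lborel g1"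
    unfolding f1_def g1_def using integrable_mult_indicator[of "{0..1}" lborel f] integrable_mult_indicator[of "{0..1}" lborel g] f g by auto
  have [measurable]: "f1 \<in> borel_measurable borel" "g1 \<in> borel_measurable borel" using f1 g1 by auto
  have fg: "integrable (lborel \<Otimes>\<^sub>M lborel) (\<lambda>(s, t). f1 s * g1 t)"
  proof (rule lborel_pair.Fubini_integrable)
    show "(\<lambda>(s, t). f1 s * g1 t) \<in> borel_measurable (lborel \<Otimes>\<^sub>M lborel)" by measurable
    show "integrable lborel (\<lambda>s. LINT t|lborel. norm (case (s, t) of (s, t) \<Rightarrow> f1 s * g1 t))"
      using f1 by (simp add: abs_mult)
    show "AE s in lborel. integrable lborel (\<lambda>t. case (s, t) of (s, t) \<Rightarrow> f1 s * g1 t)"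
      using g1 by simp
  qed
  define lo where "lo s t = of_bool (s \<le> t) * (f1 s * g1 t)" for s t
  define up where "up s t = of_bool (t \<le> s) * (f1 s * g1 t)" for s t
  have lo: "integrable (lborel \<Otimes>\<^sub>M lborel) (\<lambda>(s, t). lo s t)"
    by (rule Bochner_Integration.integrable_bound[OF fg]) (auto simp: lo_def)
  have up: "integrable (lborel \<Otimes>\<^sub>M lborel) (\<lambda>(s, t). up s t)"
    by (rule Bochner_Integration.integrable_bound[OF fg]) (auto simp: up_def)
  have inner_lo: "(LBINT s. lo s t) = indicator {0..1} t * ((F t - F 0) * g t)" for t
  proof (cases "t \<in> {0..1}")
    case True
    have "(LBINT s. lo s t) = (LBINT s. (indicator {0..t} s * f s) * g t)"
      using True by (intro Bochner_Integration.integral_cong) (auto simp: lo_def f1_def g1_def indicator_def)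
    thus ?thesis using F[OF True] True by simp
  qed (simp add: lo_def g1_def)
  have inner_up: "(LBINT t. up s t) = indicator {0..1} s * (f s * (G s - G 0))" for s
  proof (cases "s \<in> {0..1}")
    case True
    have "(LBINT t. up s t) = (LBINT t. f s * (indicator {0..s} t * g t))"
      using True by (intro Bochner_Integration.integral_cong) (auto simp: up_def f1_def g1_def indicator_def)
    thus ?thesis using G[OF True] True by simp
  qed (simp add: up_def f1_def)
  have e1: "(LBINT t. indicator {0..1} t * ((F t - F 0) * g t)) = integral\<^sup>L (lborel \<Otimes>\<^sub>M lborel) (\<lambda>(s, t). lo s t)"
    using lborel_pair.integral_snd[OF lo] by (simp add: inner_lo)
  have e2: "(LBINT s. indicator {0..1} s * (f s * (G s - G 0))) = integral\<^sup>L (lborel \<Otimes>\<^sub>M lborel) (\<lambda>(s, t). up s t)"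
    using lborel_pair.integral_fst[OF up] by (simp add: inner_up)
  have i1: "integrable lborel (\<lambda>t. indicator {0..1} t * ((F t - F 0) * g t))"
    using lborel_pair.integrable_snd[OF lo] by (simp add: inner_lo)
  have i2: "integrable lborel (\<lambda>s. indicator {0..1} s * (f s * (G s - G 0)))"
    using lborel_pair.integrable_fst[OF up] by (simp add: inner_up)
  have "integral\<^sup>L (lborel \<Otimes>\<^sub>M lborel) (\<lambda>(s, t). lo s t) + integral\<^sup>L (lborel \<Otimes>\<^sub>M lborel) (\<lambda>(s, t). up s t)
      = integral\<^sup>L (lborel \<Otimes>\<^sub>M lborel) (\<lambda>(s, t). f1 s * g1 t)"
  proof -
    have "integral\<^sup>L (lborel \<Otimes>\<^sub>M lborel) (\<lambda>(s, t). lo s t) + integral\<^sup>L (lborel \<Otimes>\<^sub>M lborel) (\<lambda>(s, t). up s t)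
      = integral\<^sup>L (lborel \<Otimes>\<^sub>M lborel) (\<lambda>p. (case p of (s, t) \<Rightarrow> lo s t) + (case p of (s, t) \<Rightarrow> up s t))"
      by (rule Bochner_Integration.integral_add[symmetric, OF lo up])
    \<comment> \<open>Both halves contain the diagonal, where the product is counted twice; it is a
      null set.\<close>
    also have "\<dots> = integral\<^sup>L (lborel \<Otimes>\<^sub>M lborel) (\<lambda>(s, t). f1 s * g1 t)"
    proof (rule integral_cong_AE)
      have [measurable]: "(\<lambda>p. lo (fst p) (snd p)) \<in> borel_measurable (lborel \<Otimes>\<^sub>M lborel)"
        "(\<lambda>p. up (fst p) (snd p)) \<in> borel_measurable (lborel \<Otimes>\<^sub>M lborel)"
        using lo up by (auto dest!: borel_measurable_integrable simp: case_prod_beta')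
      have "AE p in lborel \<Otimes>\<^sub>M lborel. lo (fst p) (snd p) + up (fst p) (snd p) = f1 (fst p) * g1 (snd p)"
      proof (rule lborel_pair.AE_pair_measure)
        show "{p \<in> space (lborel \<Otimes>\<^sub>M lborel). lo (fst p) (snd p) + up (fst p) (snd p) = f1 (fst p) * g1 (snd p)}
            \<in> sets (lborel \<Otimes>\<^sub>M lborel)" by measurable
        show "AE s in lborel. AE t in lborel. lo (fst (s, t)) (snd (s, t)) + up (fst (s, t)) (snd (s, t)) = f1 (fst (s, t)) * g1 (snd (s, t))"
        proof (rule AE_I2)
          fix s :: real
          have "AE t in lborel. t \<noteq> s" by (rule AE_lborel_singleton)
          thus "AE t in lborel. lo (fst (s, t)) (snd (s, t)) + up (fst (s, t)) (snd (s, t)) = f1 (fst (s, t)) * g1 (snd (s, t))"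
            by eventually_elim (auto simp: lo_def up_def)
        qed
      qed
      thus "AE p in lborel \<Otimes>\<^sub>M lborel. (case p of (s, t) \<Rightarrow> lo s t) + (case p of (s, t) \<Rightarrow> up s t) = (case p of (s, t) \<Rightarrow> f1 s * g1 t)"
        by (simp add: case_prod_beta)
    qed (use lo up fg in \<open>auto intro!: borel_measurable_integrable\<close>)
    finally show ?thesis .
  qed
  also have "\<dots> = (LBINT s. (LBINT t. f1 s * g1 t))" using lborel_pair.integral_fst[OF fg] by simp
  also have "\<dots> = (F 1 - F 0) * (G 1 - G 0)" using F[of 1] G[of 1] by (simp add: f1_def g1_def)
  finally have *: "(LBINT t. indicator {0..1} t * ((F t - F 0) * g t)) + (LBINT s. indicator {0..1} s * (f s * (G s - G 0)))
      = (F 1 - F 0) * (G 1 - G 0)" by (simp only: e1 e2)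
  \<comment> \<open>Restores the constants \<open>F 0\<close> and \<open>G 0\<close> that the two
    double integrals leave out.\<close>
  have s1: "(\<lambda>t. indicator {0..1} t * (F t * g t)) = (\<lambda>t. indicator {0..1} t * ((F t - F 0) * g t) + F 0 * g1 t)"
    by (auto simp: g1_def algebra_simps)
  have s2: "(\<lambda>t. indicator {0..1} t * (f t * G t)) = (\<lambda>t. indicator {0..1} t * (f t * (G t - G 0)) + G 0 * f1 t)"
    by (auto simp: f1_def algebra_simps)
  show "integrable lborel (\<lambda>t. indicator {0..1} t * (F t * g t))"
    unfolding s1 by (intro Bochner_Integration.integrable_add i1 integrable_mult_right g1)
  have "(LBINT t. indicator {0..1} t * (F t * g t)) = (LBINT t. indicator {0..1} t * ((F t - F 0) * g t)) + F 0 * (G 1 - G 0)"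
    unfolding s1 Bochner_Integration.integral_add[OF i1 integrable_mult_right[OF g1]] using G[of 1] by (simp add: g1_def)
  moreover have "(LBINT t. indicator {0..1} t * (f t * G t)) = (LBINT t. indicator {0..1} t * (f t * (G t - G 0))) + G 0 * (F 1 - F 0)"
    unfolding s2 Bochner_Integration.integral_add[OF i2 integrable_mult_right[OF f1]] using F[of 1] by (simp add: f1_def)
  ultimately show "(LBINT t. indicator {0..1} t * (F t * g t)) + (LBINT t. indicator {0..1} t * (f t * G t))
      = F 1 * G 1 - F 0 * G 0" using * by (simp add: algebra_simps)
qed

text \<open>A \<open>C\<^sup>1\<close> passage from 0 to 1 on the unit interval. Rescaled, it
  approximates a jump, and its derivative is a kernel of total mass 1 concentrating just to the
  right of the jump.\<close>

definition unit_step :: "real \<Rightarrow> real" where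
  "unit_step x = pos_square x / (pos_square x + pos_square (1 - x))"

definition unit_step' :: "real \<Rightarrow> real" where
  "unit_step' x = (2 * max 0 x * (pos_square x + pos_square (1 - x)) -
     pos_square x * (2 * max 0 x - 2 * max 0 (1 - x))) /
       ((pos_square x + pos_square (1 - x)) * (pos_square x + pos_square (1 - x)))"

lemma unit_step_denominator: "pos_square x + pos_square (1 - x) > 0"
  by (cases "x > 0") (auto simp: pos_square_nonneg pos_square_pos_iff add_pos_nonneg add_nonneg_pos)

lemma DERIV_unit_step: "(unit_step has_real_derivative unit_step' x) (at x)"
  unfolding unit_step_def[abs_def] unit_step'_def
proof (rule DERIV_divide[OF DERIV_pos_square])
  show "((\<lambda>x. pos_square x + pos_square (1 - x)) has_real_derivative 2 * max 0 x - 2 * max 0 (1 - x)) (at x)"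
    by (rule derivative_eq_intros DERIV_pos_square DERIV_chain'[OF _ DERIV_pos_square] refl | simp)+
qed (use unit_step_denominator[of x] in simp)

lemma continuous_unit_step': "continuous_on UNIV unit_step'"
  unfolding unit_step'_def[abs_def]
proof -
  have c: "continuous_on UNIV pos_square" by (auto simp: pos_square_def[abs_def] intro!: continuous_intros)
  have c2: "continuous_on UNIV (\<lambda>x. pos_square (1 - x))"
    by (rule continuous_on_compose2[OF c]) (auto intro!: continuous_intros)
  have "pos_square x + pos_square (1 - x) \<noteq> 0" for x using unit_step_denominator[of x] by simp
  thus "continuous_on UNIV (\<lambda>x. (2 * max 0 x * (pos_square x + pos_square (1 - x)) -
     pos_square x * (2 * max 0 x - 2 * max 0 (1 - x))) /
       ((pos_square x + pos_square (1 - x)) * (pos_square x + pos_square (1 - x))))"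
    by (intro continuous_intros c c2) simp
qed

lemma unit_step_low: "x \<le> 0 \<Longrightarrow> unit_step x = 0" by (simp add: unit_step_def pos_square_eq_0_iff)

lemma unit_step_high: "1 \<le> x \<Longrightarrow> unit_step x = 1"
  using unit_step_denominator[of x] by (simp add: unit_step_def pos_square_eq_0_iff)

lemma unit_step_bounds: "0 \<le> unit_step x" "unit_step x \<le> 1"
  using unit_step_denominator[of x] by (auto simp: unit_step_def pos_square_nonneg divide_le_eq_1)

lemma unit_step'_outside: "x < 0 \<or> 1 < x \<Longrightarrow> unit_step' x = 0"
  using pos_square_eq_0_iff[of x] pos_square_eq_0_iff[of "1 - x"] by (auto simp: unit_step'_def)

lemma integral_unit_step': "(LBINT x. unit_step' x) = 1"
proof -
  have "(LBINT x. indicator {0..1} x *\<^sub>R unit_step' x) = unit_step 1 - unit_step 0"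
    by (intro integral_FTC_atLeastAtMost continuous_on_subset[OF continuous_unit_step'])
       (auto simp: has_real_derivative_iff_has_vector_derivative[symmetric]
          intro: has_field_derivative_at_within[OF DERIV_unit_step])
  moreover have "(\<lambda>x. indicator {0..1} x *\<^sub>R unit_step' x) = unit_step'"
    by (auto simp: indicator_def fun_eq_iff) (meson not_le unit_step'_outside)+
  ultimately show ?thesis by (simp add: unit_step_low unit_step_high)
qed

lemma C1_real:
  fixes f :: "real \<Rightarrow> real"
  assumes "\<And>x. (f has_real_derivative f' x) (at x)" "continuous_on UNIV f'"
  shows "C1_with_gradient f f'"
proof -
  have "(\<lambda>h. h \<bullet> f' x) = (*) (f' x)" for x by (simp add: fun_eq_iff mult.commute)
  thus ?thesis using assms by (simp add: C1_with_gradient_def gderiv_def has_field_derivative_def)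
qed

text \<open>Substituting \<open>y = n (x - s)\<close> turns the average into that of
  \<open>c (s + y / n)\<close> against a fixed kernel; dominated convergence applies since
  \<open>c\<close> is bounded.\<close>

lemma average_unit_step_tendsto:
  fixes c :: "real \<Rightarrow> real"
  assumes c: "continuous_on UNIV c" and B: "\<And>x. \<bar>c x\<bar> \<le> B"
  shows "(\<lambda>k. \<integral>x. c x * (real (Suc k) * unit_step' (real (Suc k) * (x - s))) \<partial>lborel) \<longlonglongrightarrow> c s"
proof -
  have [measurable]: "c \<in> borel_measurable borel" "unit_step' \<in> borel_measurable borel"
    using c continuous_unit_step' by (auto intro: borel_measurable_continuous_onI)
  have "(LBINT x. c x * (real (Suc k) * unit_step' (real (Suc k) * (x - s)))) =
      (LBINT y. c (s + y / real (Suc k)) * unit_step' y)" for k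
  proof -
    define n where "n = real (Suc k)"
    have n: "n > 0" by (simp add: n_def)
    have "(LBINT x. c x * (n * unit_step' (n * (x - s)))) =
      \<bar>1 / n\<bar> *\<^sub>R (LBINT y. c (s + 1 / n * y) * (n * unit_step' (n * ((s + 1 / n * y) - s))))"
      by (rule lborel_integral_real_affine) (use n in simp)
    also have "\<dots> = (LBINT y. 1 / n * (c (s + 1 / n * y) * (n * unit_step' (n * ((s + 1 / n * y) - s)))))"
      using n by (subst integral_mult_right_zero) simp
    also have "\<dots> = (LBINT y. c (s + y / n) * unit_step' y)"
      by (rule Bochner_Integration.integral_cong) (use n in auto)
    finally show ?thesis unfolding n_def .
  qed
  moreover have "(\<lambda>k. \<integral>y. c (s + y / real (Suc k)) * unit_step' y \<partial>lborel) \<longlonglongrightarrow> (LBINT y. c s * unit_step' y)"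
  proof (rule integral_dominated_convergence[where w = "\<lambda>y. B * \<bar>unit_step' y\<bar>"])
    have "integrable lborel unit_step'"
      by (rule integrable_compact_support[OF continuous_unit_step', of "{0..1}"])
         (auto intro!: unit_step'_outside)
    thus "integrable lborel (\<lambda>y. B * \<bar>unit_step' y\<bar>)" by (intro integrable_mult_right integrable_abs)
    show "AE y in lborel. (\<lambda>k. c (s + y / real (Suc k)) * unit_step' y) \<longlonglongrightarrow> c s * unit_step' y"
    proof (rule AE_I2)
      fix y
      have "(\<lambda>k. s + y * inverse (real (Suc k))) \<longlonglongrightarrow> s + y * 0" by (intro tendsto_intros LIMSEQ_inverse_real_of_nat)
      moreover have "isCont c (s + y * 0)" using c by (simp add: continuous_on_eq_continuous_at)
      ultimately have "(\<lambda>k. c (s + y * inverse (real (Suc k)))) \<longlonglongrightarrow> c (s + y * 0)"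
        using isCont_tendsto_compose by blast
      thus "(\<lambda>k. c (s + y / real (Suc k)) * unit_step' y) \<longlonglongrightarrow> c s * unit_step' y"
        by (intro tendsto_mult tendsto_const) (simp add: divide_inverse)
    qed
    show "AE y in lborel. norm (c (s + y / real (Suc k)) * unit_step' y) \<le> B * \<bar>unit_step' y\<bar>" for k
      using B by (auto simp: abs_mult intro!: mult_right_mono)
  qed measurable
  ultimately show ?thesis by (simp add: integral_unit_step')
qed


text \<open>The continuous representative is absolutely continuous. Test with a step at
  \<open>s\<close> minus a step at \<open>t\<close>: the test functions tend to the indicator of the
  interval between them, their derivatives average \<open>c\<close> near \<open>s\<close> and near
  \<open>t\<close>. This yields the increments in the open interval, and continuity the end
  points.\<close>

lemma H1_gradient_indefinite_integral:
  fixes f \<zeta> c :: "real \<Rightarrow> real"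
  assumes H1: "H1_gradient {0<..<1} f \<zeta>" and c: "continuous_on {0..1} c"
    and ae: "AE \<rho> in leb {0<..<1}. f \<rho> = c \<rho>"
  defines "z \<equiv> \<lambda>s. indicator {0<..<1} s * \<zeta> s"
  shows "integrable lborel z" and "t \<in> {0..1} \<Longrightarrow> c t = c 0 + (LBINT s. indicator {0..t} s * z s)"
proof -
  have I: "{0<..<1::real} \<inter> space lborel \<in> sets lborel" by simp
  have \<zeta>: "\<zeta> \<in> borel_measurable (leb {0<..<1})" "integrable (leb {0<..<1}) (\<lambda>x. (norm (\<zeta> x))\<^sup>2)"
    using H1 by (auto simp: H1_gradient_def L2_def)
  have zm [measurable]: "z \<in> borel_measurable borel"
    using \<zeta>(1) unfolding borel_measurable_restrict_space_iff[OF I] z_def by simp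
  have z2: "integrable lborel (\<lambda>x. (z x)\<^sup>2)"
    using \<zeta>(2) unfolding integrable_restrict_space[OF I]
    by (rule Bochner_Integration.integrable_cong[THEN iffD1, rotated 2]) (auto simp: z_def indicator_def)
  show zi: "integrable lborel z"
  proof (rule Bochner_Integration.integrable_bound)
    show "integrable lborel (\<lambda>x. indicator {0<..<1} x + (z x)\<^sup>2)"
      by (intro Bochner_Integration.integrable_add z2 integrable_real_indicator) auto
    show "AE x in lborel. norm (z x) \<le> norm (indicator {0<..<1} x + (z x)\<^sup>2)"
    proof (rule AE_I2)
      fix x
      have "\<bar>z x\<bar> \<le> 1 + (z x)\<^sup>2"
        using zero_le_power2[of "\<bar>z x\<bar> - 1"] zero_le_power2[of "z x"] by (simp add: power2_diff)
      thus "norm (z x) \<le> norm (indicator {0<..<1} x + (z x)\<^sup>2)"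
        by (cases "x \<in> {0<..<1}") (auto simp: z_def)
    qed
  qed simp
  \<comment> \<open>The extension of \<open>c\<close> by its end values to a bounded continuous
    function on the line, as required by the averaging lemma.\<close>
  define C where "C x = c (max 0 (min 1 x))" for x
  have C: "continuous_on UNIV C" unfolding C_def
    by (rule continuous_on_compose2[OF c]) (auto intro!: continuous_intros)
  have Cm [measurable]: "C \<in> borel_measurable borel" by (rule borel_measurable_continuous_onI[OF C])
  have "bounded (c ` {0..1})" by (intro compact_imp_bounded compact_continuous_image c) simp
  then obtain B where "\<forall>y\<in>c ` {0..1}. norm y \<le> B" unfolding bounded_iff by blast
  hence B: "\<bar>C x\<bar> \<le> B" for x by (auto simp: C_def)
  have ae': "AE x in lborel. x \<in> {0<..<1} \<longrightarrow> f x = C x"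
    using ae by (subst (asm) AE_restrict_space_iff[OF I]) (auto simp: C_def)
  have fm: "(\<lambda>x. indicator {0<..<1} x *\<^sub>R f x) \<in> borel_measurable borel"
  proof -
    have "f \<in> borel_measurable (leb {0<..<1})" using H1 by (simp add: H1_gradient_def L2_def)
    thus ?thesis unfolding borel_measurable_restrict_space_iff[OF I] by simp
  qed
  have [measurable]: "unit_step \<in> borel_measurable borel" "unit_step' \<in> borel_measurable borel"
    using continuous_unit_step' DERIV_unit_step
    by (auto intro!: borel_measurable_continuous_onI continuous_at_imp_continuous_on DERIV_isCont)
  have inner: "C t - C s = (LBINT x. indicator {s<..t} x * z x)" if st: "0 < s" "s < t" "t < 1" for s t
  proof -
    define \<phi> where "\<phi> k x = unit_step (real (Suc k) * (x - s)) - unit_step (real (Suc k) * (x - t))" for k x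
    define \<phi>' where "\<phi>' k x = real (Suc k) * unit_step' (real (Suc k) * (x - s))
        - real (Suc k) * unit_step' (real (Suc k) * (x - t))" for k x
    \<comment> \<open>The limit is 0 at \<open>x = r\<close> itself, since
      \<open>unit_step 0 = 0\<close>; so the difference of two steps tends to a half-open
      indicator.\<close>
    have step_lim: "(\<lambda>k. unit_step (real (Suc k) * (x - r))) \<longlonglongrightarrow> indicator {r<..} x" for x r
    proof (cases "x \<le> r")
      case True
      hence "unit_step (real (Suc k) * (x - r)) = 0" for k
        by (intro unit_step_low mult_nonneg_nonpos) auto
      thus ?thesis using True by simp
    next
      case False
      have "\<forall>\<^sub>F k in sequentially. inverse (x - r) \<le> real (Suc k)"
        using filterlim_compose[OF filterlim_real_sequentially filterlim_Suc] by (auto simp: filterlim_at_top)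
      hence "\<forall>\<^sub>F k in sequentially. unit_step (real (Suc k) * (x - r)) = 1"
        by eventually_elim (use False in \<open>auto intro!: unit_step_high simp: field_simps\<close>)
      thus ?thesis using False by (simp add: tendsto_eventually)
    qed
    have C1: "C1_with_gradient (\<phi> k) (\<phi>' k)" for k
    proof (rule C1_real)
      fix x
      have d: "((\<lambda>x. unit_step (n * (x - r))) has_real_derivative n * unit_step' (n * (x - r))) (at x)" for n r
        by (rule DERIV_chain'[OF _ DERIV_unit_step, THEN DERIV_cong]) (auto intro!: derivative_eq_intros)
      show "(\<phi> k has_real_derivative \<phi>' k x) (at x)" unfolding \<phi>_def[abs_def] \<phi>'_def by (intro DERIV_diff d)
      have e: "continuous_on UNIV (\<lambda>x. unit_step' (n * (x - r)))" for n r
        by (rule continuous_on_compose2[OF continuous_unit_step']) (auto intro!: continuous_intros)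
      show "continuous_on UNIV (\<phi>' k)" unfolding \<phi>'_def[abs_def] by (intro continuous_intros e)
    qed
    have \<phi>b: "\<bar>\<phi> k x\<bar> \<le> 1" for k x
      using unit_step_bounds[of "real (Suc k) * (x - s)"] unit_step_bounds[of "real (Suc k) * (x - t)"]
      unfolding \<phi>_def by linarith
    \<comment> \<open>The test function is supported in the interval from \<open>s\<close> to
      \<open>t + 1 / n\<close>, which lies inside the open unit interval only for large
      \<open>n\<close>.\<close>
    have "\<forall>\<^sub>F k in sequentially. inverse (1 - t) < real (Suc k)"
      using filterlim_compose[OF filterlim_real_sequentially filterlim_Suc] by (auto simp: filterlim_at_top_dense)
    hence ev: "\<forall>\<^sub>F k in sequentially. (LBINT x. C x * (real (Suc k) * unit_step' (real (Suc k) * (x - s))))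
      - (LBINT x. C x * (real (Suc k) * unit_step' (real (Suc k) * (x - t)))) = - (LBINT x. \<phi> k x * z x)"
    proof eventually_elim
      fix k assume k: "inverse (1 - t) < real (Suc k)"
      define n where "n = real (Suc k)"
      have n: "n > 0" by (simp add: n_def)
      have tn: "t + 1 / n < 1" using k st n unfolding n_def[symmetric] by (simp add: field_simps)
      have high: "1 \<le> n * (x - r)" if "x > t + 1 / n" "r \<le> t" for x r
      proof -
        have "1 / n \<le> x - r" using that by simp
        thus ?thesis using n by (simp add: field_simps)
      qed
      have out: "\<phi> k x = 0" if "x \<notin> {s..t + 1 / n}" for x
      proof (cases "x < s")
        case True
        hence "n * (x - s) \<le> 0" "n * (x - t) \<le> 0" using n st by (auto intro!: mult_nonneg_nonpos)
        thus ?thesis by (simp add: \<phi>_def unit_step_low n_def del: of_nat_Suc)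
      next
        case False
        hence "1 \<le> n * (x - s)" "1 \<le> n * (x - t)" using that st by (auto intro!: high)
        thus ?thesis by (simp add: \<phi>_def unit_step_high n_def del: of_nat_Suc)
      qed
      have out': "\<phi>' k x = 0" if "x \<notin> {s..t + 1 / n}" for x
        by (rule C1_gradient_zero[OF C1, of "{s..t + 1 / n}"]) (use out that in auto)
      have KI: "{s..t + 1 / n} \<subseteq> {0<..<1}" using st tn by auto
      have u: "integrable lborel (\<lambda>x. C x * (n * unit_step' (n * (x - r))))" for r
      proof (rule integrable_compact_support[of _ "{r..r + 1 / n}"])
        show "continuous_on UNIV (\<lambda>x. C x * (n * unit_step' (n * (x - r))))"
          by (intro continuous_intros C continuous_on_compose2[OF continuous_unit_step']) auto
        fix x assume "x \<notin> {r..r + 1 / n}"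
        hence "n * (x - r) < 0 \<or> 1 < n * (x - r)" using n by (auto simp: field_simps mult_less_0_iff)
        thus "C x * (n * unit_step' (n * (x - r))) = 0" by (simp add: unit_step'_outside)
      qed simp
      have "(LBINT x. C x * (n * unit_step' (n * (x - s)))) - (LBINT x. C x * (n * unit_step' (n * (x - t))))
        = (LBINT x. C x * \<phi>' k x)"
        by (subst Bochner_Integration.integral_diff[symmetric, OF u u]) (simp add: \<phi>'_def n_def right_diff_distrib)
      also have "\<dots> = (LBINT x. indicator {0<..<1} x *\<^sub>R (f x *\<^sub>R \<phi>' k x))"
      proof (rule integral_cong_AE)
        show "AE x in lborel. C x * \<phi>' k x = indicator {0<..<1} x *\<^sub>R (f x *\<^sub>R \<phi>' k x)"
          using ae' by eventually_elim (use out' KI in \<open>fastforce simp: indicator_def\<close>)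
        have [measurable]: "\<phi>' k \<in> borel_measurable borel"
          by (rule borel_measurable_continuous_onI[OF C1_continuous_gradient[OF C1]])
        show "(\<lambda>x. C x * \<phi>' k x) \<in> borel_measurable lborel" by measurable
        have "(\<lambda>x. (indicator {0<..<1} x *\<^sub>R f x) * \<phi>' k x) \<in> borel_measurable lborel"
          using fm by measurable
        thus "(\<lambda>x. indicator {0<..<1} x *\<^sub>R (f x *\<^sub>R \<phi>' k x)) \<in> borel_measurable lborel" by (simp add: mult.assoc)
      qed
      also have "\<dots> = (LINT x|leb {0<..<1}. f x *\<^sub>R \<phi>' k x)" by (rule integral_restrict_space[OF I, symmetric])
      also have "\<dots> = - (LINT x|leb {0<..<1}. \<phi> k x *\<^sub>R \<zeta> x)"
        using H1 C1[of k] KI out unfolding H1_gradient_def by (metis compact_Icc)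
      also have "(LINT x|leb {0<..<1}. \<phi> k x *\<^sub>R \<zeta> x) = (LBINT x. indicator {0<..<1} x *\<^sub>R (\<phi> k x *\<^sub>R \<zeta> x))"
        by (rule integral_restrict_space[OF I])
      also have "\<dots> = (LBINT x. \<phi> k x * z x)"
        by (rule Bochner_Integration.integral_cong) (auto simp: z_def)
      finally show "(LBINT x. C x * (real (Suc k) * unit_step' (real (Suc k) * (x - s))))
          - (LBINT x. C x * (real (Suc k) * unit_step' (real (Suc k) * (x - t)))) = - (LBINT x. \<phi> k x * z x)"
        unfolding n_def .
    qed
    have lim1: "(\<lambda>k. - (LBINT x. \<phi> k x * z x)) \<longlonglongrightarrow> C s - C t"
      by (rule Lim_transform_eventually[OF tendsto_diff[OF average_unit_step_tendsto[OF C B] average_unit_step_tendsto[OF C B]] ev])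
    have "(\<lambda>k. \<integral>x. \<phi> k x * z x \<partial>lborel) \<longlonglongrightarrow> (LBINT x. indicator {s<..t} x * z x)"
    proof (rule integral_dominated_convergence[where w = "\<lambda>x. \<bar>z x\<bar>"])
      show "AE x in lborel. (\<lambda>k. \<phi> k x * z x) \<longlonglongrightarrow> indicator {s<..t} x * z x"
      proof (rule AE_I2)
        fix x
        have "(\<lambda>k. \<phi> k x) \<longlonglongrightarrow> indicator {s<..} x - indicator {t<..} x"
          unfolding \<phi>_def by (intro tendsto_diff step_lim)
        moreover have "indicator {s<..} x - indicator {t<..} x = (indicator {s<..t} x :: real)"
          using st by (auto simp: indicator_def)
        ultimately show "(\<lambda>k. \<phi> k x * z x) \<longlonglongrightarrow> indicator {s<..t} x * z x" by (auto intro!: tendsto_mult)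
      qed
      show "AE x in lborel. norm (\<phi> k x * z x) \<le> \<bar>z x\<bar>" for k
        using \<phi>b[of k] by (auto simp: abs_mult intro!: mult_left_le_one_le)
      show "(\<lambda>x. \<phi> k x * z x) \<in> borel_measurable lborel" for k unfolding \<phi>_def by measurable
    qed (use zi in auto)
    from LIMSEQ_unique[OF tendsto_minus[OF this] lim1] show ?thesis by simp
  qed
  define J where "J t = (LBINT s. indicator {0..t} s * z s)" for t
  have si: "set_integrable lborel {0..t} z" for t
    unfolding set_integrable_def using integrable_mult_indicator[OF _ zi, of "{0..t}"] by simp
  have J_eq: "J t = integral {0..t} z" for t
    using set_borel_integral_eq_integral(2)[OF si] by (simp add: J_def set_lebesgue_integral_def)
  have "continuous_on {0..1} (\<lambda>t. integral {0..t} z)"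
    by (rule indefinite_integral_continuous_1) (rule set_borel_integral_eq_integral(1)[OF si])
  hence contE: "continuous_on {0..1} (\<lambda>t. C t - J t)"
    unfolding J_eq by (intro continuous_intros continuous_on_subset[OF C]) auto
  have Jdiff: "J t - J s = (LBINT x. indicator {s<..t} x * z x)" if "0 < s" "s < t" for s t
  proof -
    have i: "integrable lborel (\<lambda>x. indicator {0..r} x * z x)" for r
      using integrable_mult_indicator[OF _ zi, of "{0..r}"] by simp
    show ?thesis unfolding J_def
      by (subst Bochner_Integration.integral_diff[symmetric, OF i i])
         (rule Bochner_Integration.integral_cong, use that in \<open>auto simp: indicator_def\<close>)
  qed
  have const: "C t - J t = C (1/2) - J (1/2)" if "t \<in> {0<..<1}" for t
  proof -
    consider "t = 1/2" | "t < 1/2" | "1/2 < t" by linarith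
    thus ?thesis
    proof cases
      case 1 show ?thesis unfolding 1 ..
    next
      case 2 thus ?thesis using inner[of t "1/2"] Jdiff[of t "1/2"] that by auto
    next
      case 3 thus ?thesis using inner[of "1/2" t] Jdiff[of "1/2" t] that by auto
    qed
  qed
  \<comment> \<open>An identity on the open interval between functions continuous on its closure
    extends to 0 and 1, where the traces of the delay variable are taken.\<close>
  have const': "C t - J t = C (1/2) - J (1/2)" if "t \<in> {0..1}" for t
  proof (rule continuous_constant_on_closure[of "{0<..<1}" "\<lambda>t. C t - J t"])
    have cl: "closure {0<..<1} = {0..1::real}" by simp
    show "continuous_on (closure {0<..<1}) (\<lambda>t. C t - J t)" unfolding cl by (rule contE)
    show "t \<in> closure {0<..<1}" unfolding cl by (rule that)
  qed (rule const)
  have J0: "J 0 = 0"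
  proof -
    have "indicator {0..0} s * z s = 0" for s by (auto simp: z_def indicator_def)
    thus ?thesis unfolding J_def by (simp only: integral_zero)
  qed
  show "c t = c 0 + (LBINT s. indicator {0..t} s * z s)" if t: "t \<in> {0..1}"
  proof -
    have "min 1 t = t" "max 0 t = t" using t by auto
    hence "C t = c t" "C 0 = c 0" by (simp_all add: C_def)
    thus ?thesis using const'[OF t] const'[of 0] J0 unfolding J_def[of t] by simp
  qed
qed

text \<open>Integrate half the derivative of the square of the continuous representative against the
  affine weight \<open>A + B * \<rho>\<close> by parts. The derivative \<open>B\<close> of the
  weight produces the integral of the square, which is the price of a nonconstant weight.\<close>

lemma weighted_square_identity:
  fixes f \<zeta> :: "real \<Rightarrow> real"
  assumes H1: "H1_gradient {0<..<1} f \<zeta>" and ends: "endpoint_values f c0 c1"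
  shows "(LINT \<rho>|leb {0<..<1}. (A + B * \<rho>) * (f \<rho> * \<zeta> \<rho>)) =
    ((A + B) * c1\<^sup>2 - A * c0\<^sup>2 - B * (LINT \<rho>|leb {0<..<1}. (f \<rho>)\<^sup>2)) / 2"
proof -
  obtain c where c: "continuous_on {0..1} c" "AE \<rho> in leb {0<..<1}. f \<rho> = c \<rho>" "c 0 = c0" "c 1 = c1"
    using ends by (auto simp: endpoint_values_def)
  define z where "z s = indicator {0<..<1} s * \<zeta> s" for s :: real
  have I: "{0<..<1::real} \<inter> space lborel \<in> sets lborel" by simp
  have z: "integrable lborel z" and cz: "\<And>t. t \<in> {0..1} \<Longrightarrow> c t = c 0 + (LBINT s. indicator {0..t} s * z s)"
    using H1_gradient_indefinite_integral(1)[OF H1 c(1,2)] H1_gradient_indefinite_integral(2)[OF H1 c(1,2)]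
    unfolding z_def by this
  have [measurable]: "z \<in> borel_measurable borel" using z by auto
  have cb: "(\<lambda>x. indicator {0..1} x * c x) \<in> borel_measurable borel"
    using borel_measurable_continuous_on_indicator[OF _ c(1)] by simp
  define f2 where "f2 t = indicator {0..1} t * (2 * (c t * z t))" for t
  \<comment> \<open>The square is itself an indefinite integral, with density \<open>f2\<close>;
    this makes it admissible as a factor in the second integration by parts.\<close>
  have sq: "(c t)\<^sup>2 = (c 0)\<^sup>2 + (LBINT s. indicator {0..t} s * f2 s)" and f2i: "integrable lborel f2" if t: "t \<in> {0..1}" for t
  proof -
    \<comment> \<open>Stopping the function at \<open>t\<close> reduces the formula at an
      intermediate point to integration by parts over the whole unit interval.\<close>
    define zt where "zt s = indicator {0..t} s * z s" for s
    have zt: "integrable lborel zt" unfolding zt_def using integrable_mult_indicator[OF _ z, of "{0..t}"] by simp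
    have F: "c (min x t) = c (min 0 t) + (LBINT s. indicator {0..x} s * zt s)" if "x \<in> {0..1}" for x
    proof -
      have e: "(LBINT s. indicator {0..x} s * zt s) = (LBINT s. indicator {0..min x t} s * z s)"
        by (rule Bochner_Integration.integral_cong) (auto simp: zt_def indicator_def)
      have m: "min x t \<in> {0..1}" "min 0 t = 0" using t that by (auto simp: min_def)
      show ?thesis unfolding e m(2) by (rule cz[OF m(1)])
    qed
    note parts = indefinite_integral_by_parts[where F = "\<lambda>x. c (min x t)" and G = "\<lambda>x. c (min x t)", OF zt zt F F]
    have eq: "indicator {0..1} s * (c (min s t) * zt s) = indicator {0..t} s * (f2 s / 2)"
      "indicator {0..1} s * (zt s * c (min s t)) = indicator {0..t} s * (f2 s / 2)" for s
      using t by (auto simp: zt_def f2_def indicator_def)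
    show "(c t)\<^sup>2 = (c 0)\<^sup>2 + (LBINT s. indicator {0..t} s * f2 s)"
    proof -
      have m: "min 1 t = t" "min 0 t = 0" using t by (auto simp: min_def)
      show ?thesis using parts(1) unfolding eq m by (simp add: power2_eq_square)
    qed
  next
    have "integrable lborel (\<lambda>t. indicator {0..1} t * (c t * z t))"
      by (rule indefinite_integral_by_parts(2)[OF z z cz cz])
    hence "integrable lborel (\<lambda>t. 2 * (indicator {0..1} t * (c t * z t)))" by (rule integrable_mult_right)
    thus "integrable lborel f2" unfolding f2_def by (simp add: algebra_simps)
  qed
  have f2: "integrable lborel f2" by (rule f2i[of 0]) simp
  define g where "g t = indicator {0..1} t * B" for t :: real
  have g: "integrable lborel g" unfolding g_def by (intro integrable_mult_left integrable_real_indicator) auto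
  have G: "A + B * t = A + B * 0 + (LBINT s. indicator {0..t} s * g s)" if "t \<in> {0..1}" for t
  proof -
    have "(LBINT s. indicator {0..t} s * g s) = (LBINT s. indicator {0..t} s * B)"
      by (rule Bochner_Integration.integral_cong) (use that in \<open>auto simp: g_def indicator_def\<close>)
    thus ?thesis using that by simp
  qed
  have "(LBINT t. indicator {0..1} t * ((c t)\<^sup>2 * g t)) + (LBINT t. indicator {0..1} t * (f2 t * (A + B * t)))
      = (c 1)\<^sup>2 * (A + B * 1) - (c 0)\<^sup>2 * (A + B * 0)"
    by (rule indefinite_integral_by_parts(1)[OF f2 g sq G])
  moreover have ae: "AE x in lborel. x \<in> {0<..<1} \<longrightarrow> f x = c x"
    using c(2) by (subst (asm) AE_restrict_space_iff[OF I]) auto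
  have ends: "AE x in lborel. x \<noteq> (0::real)" "AE x in lborel. x \<noteq> (1::real)" by (rule AE_lborel_singleton)+
  have fm: "(\<lambda>x. indicator {0<..<1} x *\<^sub>R f x) \<in> borel_measurable borel"
  proof -
    have "f \<in> borel_measurable (leb {0<..<1})" using H1 by (simp add: H1_gradient_def L2_def)
    thus ?thesis unfolding borel_measurable_restrict_space_iff[OF I] by simp
  qed
  have [measurable]: "f2 \<in> borel_measurable borel" "g \<in> borel_measurable borel" using f2 g by auto
  have "(LBINT t. indicator {0..1} t * ((c t)\<^sup>2 * g t)) = B * (LINT \<rho>|leb {0<..<1}. (f \<rho>)\<^sup>2)"
  proof -
    have "(LBINT t. indicator {0..1} t * ((c t)\<^sup>2 * g t)) = (LBINT x. B * (indicator {0<..<1} x *\<^sub>R (f x)\<^sup>2))"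
    proof (rule integral_cong_AE)
      show "AE x in lborel. indicator {0..1} x * ((c x)\<^sup>2 * g x) = B * (indicator {0<..<1} x *\<^sub>R (f x)\<^sup>2)"
        using ae ends by eventually_elim (auto simp: g_def indicator_def)
      have "(\<lambda>x. (indicator {0..1} x * c x)\<^sup>2 * g x) \<in> borel_measurable lborel" using cb by measurable
      thus "(\<lambda>x. indicator {0..1} x * ((c x)\<^sup>2 * g x)) \<in> borel_measurable lborel"
        by (rule measurable_cong[THEN iffD1, rotated]) (auto simp: indicator_def)
      have "(\<lambda>x. B * (indicator {0<..<1} x *\<^sub>R f x)\<^sup>2) \<in> borel_measurable lborel"
        by (rule borel_measurable_times[OF borel_measurable_const borel_measurable_power]) (use fm in simp)
      thus "(\<lambda>x. B * (indicator {0<..<1} x *\<^sub>R (f x)\<^sup>2)) \<in> borel_measurable lborel"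
        by (rule measurable_cong[THEN iffD1, rotated]) (auto simp: indicator_def)
    qed
    thus ?thesis by (simp add: integral_restrict_space[OF I])
  qed
  moreover have "(LBINT t. indicator {0..1} t * (f2 t * (A + B * t))) = 2 * (LINT \<rho>|leb {0<..<1}. (A + B * \<rho>) * (f \<rho> * \<zeta> \<rho>))"
  proof -
    have "(LBINT t. indicator {0..1} t * (f2 t * (A + B * t))) =
        (LBINT x. 2 * (indicator {0<..<1} x *\<^sub>R ((A + B * x) * (f x * \<zeta> x))))"
    proof (rule integral_cong_AE)
      show "AE x in lborel. indicator {0..1} x * (f2 x * (A + B * x)) = 2 * (indicator {0<..<1} x *\<^sub>R ((A + B * x) * (f x * \<zeta> x)))"
        using ae by eventually_elim (auto simp: f2_def z_def indicator_def)
      show "(\<lambda>t. indicator {0..1} t * (f2 t * (A + B * t))) \<in> borel_measurable lborel" by measurable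
      have "(\<lambda>x. 2 * ((A + B * x) * ((indicator {0<..<1} x *\<^sub>R f x) * z x))) \<in> borel_measurable lborel"
        using fm by measurable
      thus "(\<lambda>x. 2 * (indicator {0<..<1} x *\<^sub>R ((A + B * x) * (f x * \<zeta> x)))) \<in> borel_measurable lborel"
        by (rule measurable_cong[THEN iffD1, rotated]) (auto simp: indicator_def z_def)
    qed
    thus ?thesis by (simp add: integral_restrict_space[OF I])
  qed
  ultimately show ?thesis using c(3,4) by (simp add: algebra_simps)
qed

section \<open>Green's formula for traces\<close>

lemma L2_norm: "f \<in> L2 M \<Longrightarrow> (\<lambda>x. norm (f x)) \<in> L2 M"
  by (auto simp: L2_def)

lemma L2_scaleR_integrable:
  fixes f :: "'b \<Rightarrow> real" and g :: "'b \<Rightarrow> 'c::euclidean_space"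
  assumes f: "f \<in> L2 M" and g: "g \<in> L2 M"
  shows "integrable M (\<lambda>x. f x *\<^sub>R g x)"
proof (rule Bochner_Integration.integrable_bound[OF L2_mult_integrable[OF L2_norm[OF f] L2_norm[OF g]]])
  note [measurable] = L2_measurable[OF f] L2_measurable[OF g]
  show "(\<lambda>x. f x *\<^sub>R g x) \<in> borel_measurable M" by measurable
qed simp

lemma L2_sum:
  fixes f :: "'i \<Rightarrow> 'b \<Rightarrow> real"
  assumes "finite I" "\<And>i. i \<in> I \<Longrightarrow> f i \<in> L2 M"
  shows "(\<lambda>x. \<Sum>i\<in>I. f i x) \<in> L2 M"
  using assms
proof (induction I rule: finite_induct)
  case empty
  show ?case by (simp add: L2_def)
next
  case (insert i I)
  thus ?case using L2_lin_real[of "f i" M "\<lambda>x. \<Sum>i\<in>I. f i x" 1 1] by simp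
qed

lemma continuous_compact_support_L2:
  fixes f :: "'a::euclidean_space \<Rightarrow> 'b::euclidean_space"
  assumes "open \<Omega>" "continuous_on UNIV f" "compact K" "\<And>x. x \<notin> K \<Longrightarrow> f x = 0"
  shows "f \<in> L2 (leb \<Omega>)"
proof -
  have Om: "\<Omega> \<inter> space lborel \<in> sets lborel" using \<open>open \<Omega>\<close> by simp
  have "integrable lborel (\<lambda>x. (norm (f x))\<^sup>2)"
    by (rule integrable_compact_support[OF _ assms(3)]) (use assms in \<open>auto intro!: continuous_intros\<close>)
  hence "integrable lborel (\<lambda>x. indicator \<Omega> x *\<^sub>R (norm (f x))\<^sup>2)"
    using Om by - (rule integrable_mult_indicator, auto)
  moreover have "f \<in> borel_measurable (leb \<Omega>)"
    by (rule measurable_restrict_space1) (simp add: borel_measurable_continuous_onI assms(2))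
  ultimately show ?thesis unfolding L2_def integrable_restrict_space[OF Om] by simp
qed

lemma test_function_L2:
  assumes "open \<Omega>" "test_function \<Omega> \<phi> \<phi>'"
  shows "\<phi> \<in> L2 (leb \<Omega>)" "\<phi>' \<in> L2 (leb \<Omega>)"
proof -
  obtain K where C1: "C1_with_gradient \<phi> \<phi>'" and K: "compact K" "\<And>x. x \<notin> K \<Longrightarrow> \<phi> x = 0"
    using assms(2) unfolding test_function_def by blast
  have "\<phi>' x = 0" if "x \<notin> K" for x
    using C1_gradient_zero[OF C1 compact_imp_closed[OF K(1)] _ that] K(2) by blast
  thus "\<phi> \<in> L2 (leb \<Omega>)" "\<phi>' \<in> L2 (leb \<Omega>)"
    using continuous_compact_support_L2[OF assms(1) C1_continuous[OF C1] K]
      continuous_compact_support_L2[OF assms(1) C1_continuous_gradient[OF C1] K(1)] by auto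
qed

lemma H1_gradient_test:
  assumes "H1_gradient \<Omega> u g" "test_function \<Omega> \<phi> \<phi>'"
  shows "(LINT x|leb \<Omega>. u x *\<^sub>R \<phi>' x) = - (LINT x|leb \<Omega>. \<phi> x *\<^sub>R g x)"
  using assms unfolding H1_gradient_def test_function_def by blast

lemma H1_gradientI:
  assumes "u \<in> L2 (leb \<Omega>)" "g \<in> L2 (leb \<Omega>)"
    "\<And>\<phi> \<phi>'. test_function \<Omega> \<phi> \<phi>' \<Longrightarrow> (LINT x|leb \<Omega>. u x *\<^sub>R \<phi>' x) = - (LINT x|leb \<Omega>. \<phi> x *\<^sub>R g x)"
  shows "H1_gradient \<Omega> u g"
  using assms unfolding H1_gradient_def test_function_def by blast

lemma H1_gradient_L2: "H1_gradient \<Omega> u g \<Longrightarrow> u \<in> L2 (leb \<Omega>)" "H1_gradient \<Omega> u g \<Longrightarrow> g \<in> L2 (leb \<Omega>)"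
  by (auto simp: H1_gradient_def)

section \<open>Uniqueness and linearity of the weak gradient\<close>

lemma H1_gradient_unique:
  assumes "open \<Omega>" and g: "H1_gradient \<Omega> u g" and h: "H1_gradient \<Omega> u h"
  shows "AE x in leb \<Omega>. g x = h x"
proof -
  have "AE x in leb \<Omega>. (g x - h x) \<bullet> b = 0" for b
  proof (rule fundamental_lemma[OF assms(1)])
    show "(\<lambda>x. (g x - h x) \<bullet> b) \<in> L2 (leb \<Omega>)"
      by (intro L2_inner_const L2_diff H1_gradient_L2[OF g] H1_gradient_L2[OF h])
    fix \<phi> \<phi>' assume t: "test_function \<Omega> \<phi> \<phi>'"
    have ig: "integrable (leb \<Omega>) (\<lambda>x. \<phi> x *\<^sub>R g x)" and ih: "integrable (leb \<Omega>) (\<lambda>x. \<phi> x *\<^sub>R h x)"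
      by (intro L2_scaleR_integrable test_function_L2[OF assms(1) t] H1_gradient_L2[OF g] H1_gradient_L2[OF h])+
    have "(LINT x|leb \<Omega>. \<phi> x * ((g x - h x) \<bullet> b)) = (LINT x|leb \<Omega>. (\<phi> x *\<^sub>R g x - \<phi> x *\<^sub>R h x) \<bullet> b)"
      by (simp add: inner_diff_left right_diff_distrib)
    also have "\<dots> = (LINT x|leb \<Omega>. \<phi> x *\<^sub>R g x - \<phi> x *\<^sub>R h x) \<bullet> b"
      by (rule integral_inner_left) (intro Bochner_Integration.integrable_diff ig ih)
    also have "\<dots> = 0"
      using H1_gradient_test[OF g t] H1_gradient_test[OF h t] by (simp add: Bochner_Integration.integral_diff[OF ig ih])
    finally show "(LINT x|leb \<Omega>. \<phi> x * ((g x - h x) \<bullet> b)) = 0" .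
  qed
  hence "AE x in leb \<Omega>. \<forall>b\<in>Basis. (g x - h x) \<bullet> b = 0" by (intro AE_finite_allI) auto
  thus ?thesis by eventually_elim (simp add: euclidean_eq_iff[of "g _"] inner_diff_left)
qed

lemma H1_gradient_lin:
  assumes "open \<Omega>" and u: "H1_gradient \<Omega> u g" and v: "H1_gradient \<Omega> v h"
  shows "H1_gradient \<Omega> (\<lambda>x. \<alpha> * u x + \<beta> * v x) (\<lambda>x. \<alpha> *\<^sub>R g x + \<beta> *\<^sub>R h x)"
proof (rule H1_gradientI)
  note L2 = H1_gradient_L2[OF u] H1_gradient_L2[OF v]
  show "(\<lambda>x. \<alpha> * u x + \<beta> * v x) \<in> L2 (leb \<Omega>)" by (intro L2_lin_real L2)
  show "(\<lambda>x. \<alpha> *\<^sub>R g x + \<beta> *\<^sub>R h x) \<in> L2 (leb \<Omega>)" by (intro L2_lin L2)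
  fix \<phi> \<phi>' assume t: "test_function \<Omega> \<phi> \<phi>'"
  note tL2 = test_function_L2[OF assms(1) t]
  have i: "integrable (leb \<Omega>) (\<lambda>x. \<alpha> *\<^sub>R (u x *\<^sub>R \<phi>' x))" "integrable (leb \<Omega>) (\<lambda>x. \<beta> *\<^sub>R (v x *\<^sub>R \<phi>' x))"
    "integrable (leb \<Omega>) (\<lambda>x. \<alpha> *\<^sub>R (\<phi> x *\<^sub>R g x))" "integrable (leb \<Omega>) (\<lambda>x. \<beta> *\<^sub>R (\<phi> x *\<^sub>R h x))"
    by (intro integrable_scaleR_right L2_scaleR_integrable L2 tL2)+
  have "(LINT x|leb \<Omega>. (\<alpha> * u x + \<beta> * v x) *\<^sub>R \<phi>' x) = (LINT x|leb \<Omega>. \<alpha> *\<^sub>R (u x *\<^sub>R \<phi>' x) + \<beta> *\<^sub>R (v x *\<^sub>R \<phi>' x))"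
    by (simp add: scaleR_add_left)
  also have "\<dots> = \<alpha> *\<^sub>R (LINT x|leb \<Omega>. u x *\<^sub>R \<phi>' x) + \<beta> *\<^sub>R (LINT x|leb \<Omega>. v x *\<^sub>R \<phi>' x)"
    by (simp only: Bochner_Integration.integral_add[OF i(1,2)] integral_scaleR_right)
  also have "\<dots> = - (\<alpha> *\<^sub>R (LINT x|leb \<Omega>. \<phi> x *\<^sub>R g x) + \<beta> *\<^sub>R (LINT x|leb \<Omega>. \<phi> x *\<^sub>R h x))"
    by (simp add: H1_gradient_test[OF u t] H1_gradient_test[OF v t])
  also have "\<alpha> *\<^sub>R (LINT x|leb \<Omega>. \<phi> x *\<^sub>R g x) + \<beta> *\<^sub>R (LINT x|leb \<Omega>. \<phi> x *\<^sub>R h x)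
      = (LINT x|leb \<Omega>. \<alpha> *\<^sub>R (\<phi> x *\<^sub>R g x) + \<beta> *\<^sub>R (\<phi> x *\<^sub>R h x))"
    by (simp only: Bochner_Integration.integral_add[OF i(3,4)] integral_scaleR_right)
  also have "\<dots> = (LINT x|leb \<Omega>. \<phi> x *\<^sub>R (\<alpha> *\<^sub>R g x + \<beta> *\<^sub>R h x))"
    by (rule Bochner_Integration.integral_cong) (auto simp: scaleR_add_right mult.commute)
  finally show "(LINT x|leb \<Omega>. (\<alpha> * u x + \<beta> * v x) *\<^sub>R \<phi>' x) = - (LINT x|leb \<Omega>. \<phi> x *\<^sub>R (\<alpha> *\<^sub>R g x + \<beta> *\<^sub>R h x))" .
qed

lemma weak_grad_H1: "u \<in> H1 \<Omega> \<Longrightarrow> H1_gradient \<Omega> u (weak_grad \<Omega> u)"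
  using someI_ex[of "H1_gradient \<Omega> u"] unfolding H1_def weak_grad_def by blast

lemma H1_L2: "u \<in> H1 \<Omega> \<Longrightarrow> u \<in> L2 (leb \<Omega>)" "u \<in> H1 \<Omega> \<Longrightarrow> weak_grad \<Omega> u \<in> L2 (leb \<Omega>)"
  using weak_grad_H1 H1_gradient_L2 by blast+

lemma H1_lin: "open \<Omega> \<Longrightarrow> u \<in> H1 \<Omega> \<Longrightarrow> v \<in> H1 \<Omega> \<Longrightarrow> (\<lambda>x. \<alpha> * u x + \<beta> * v x) \<in> H1 \<Omega>"
  using H1_gradient_lin[OF _ weak_grad_H1 weak_grad_H1] unfolding H1_def by blast

text \<open>\<open>weak_grad\<close> is a choice among representatives, so linearity holds almost
  everywhere, by uniqueness.\<close>

lemma weak_grad_lin: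
  assumes "open \<Omega>" "u \<in> H1 \<Omega>" "v \<in> H1 \<Omega>"
  shows "AE x in leb \<Omega>. weak_grad \<Omega> (\<lambda>x. \<alpha> * u x + \<beta> * v x) x = \<alpha> *\<^sub>R weak_grad \<Omega> u x + \<beta> *\<^sub>R weak_grad \<Omega> v x"
  by (rule H1_gradient_unique[OF assms(1) weak_grad_H1[OF H1_lin[OF assms]]
        H1_gradient_lin[OF assms(1) weak_grad_H1 weak_grad_H1]]) (use assms in auto)

context C1_domain
begin

lemma C1_L2_domain: assumes "C1_with_gradient f f'" shows "f \<in> L2 (leb \<Omega>)" "f' \<in> L2 (leb \<Omega>)"
proof -
  have L: "g \<in> L2 (leb \<Omega>)" if g: "continuous_on UNIV g" for g :: "'a \<Rightarrow> 'b::euclidean_space"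
  proof -
    have "integrable (leb \<Omega>) (\<lambda>x. (norm (g x))\<^sup>2)"
      by (intro C1_domain_integrable continuous_intros g)
    moreover have "g \<in> borel_measurable (leb \<Omega>)"
      by (rule measurable_restrict_space1) (simp add: borel_measurable_continuous_onI g)
    ultimately show ?thesis by (simp add: L2_def)
  qed
  show "f \<in> L2 (leb \<Omega>)" by (rule L[OF C1_continuous[OF assms]])
  show "f' \<in> L2 (leb \<Omega>)" by (rule L[OF C1_continuous_gradient[OF assms]])
qed

lemma C1_measurable_surface: "C1_with_gradient f f' \<Longrightarrow> f \<in> borel_measurable \<sigma>"
  by (simp add: measurable_cong_sets[OF sets_surface refl] borel_measurable_continuous_onI C1_continuous)

lemma C1_L2_surface: assumes "C1_with_gradient f f'" shows "f \<in> L2 \<sigma>"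
proof -
  have "integrable \<sigma> (\<lambda>x. (f x * f x) * 1)"
    by (rule C1_surface_integrable[OF C1_mult[OF assms assms], of _ 1]) auto
  thus ?thesis using C1_measurable_surface[OF assms] by (simp add: L2_def power2_eq_square)
qed

lemma C1_bounded_domain:
  fixes g :: "'a \<Rightarrow> real"
  assumes "continuous_on UNIV g"
  shows "\<exists>C. (AE x in leb \<Omega>. \<bar>g x\<bar> \<le> C)" "g \<in> borel_measurable (leb \<Omega>)"
proof -
  have "bounded (g ` closure \<Omega>)"
    using bounded_dom by (intro compact_imp_bounded compact_continuous_image continuous_on_subset[OF assms]) auto
  then obtain C where C: "\<forall>y\<in>g ` closure \<Omega>. norm y \<le> C" unfolding bounded_iff by blast
  have "AE x in leb \<Omega>. \<bar>g x\<bar> \<le> C"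
  proof (rule AE_I2)
    fix x assume "x \<in> space (leb \<Omega>)"
    hence "x \<in> closure \<Omega>" using closure_subset by (auto simp: space_restrict_space)
    thus "\<bar>g x\<bar> \<le> C" using C by auto
  qed
  thus "\<exists>C. (AE x in leb \<Omega>. \<bar>g x\<bar> \<le> C)" ..
  show "g \<in> borel_measurable (leb \<Omega>)"
    by (rule measurable_restrict_space1) (simp add: borel_measurable_continuous_onI assms)
qed

text \<open>Combine the approximating sequences; the chosen weak gradient of the combination is
  replaced by the combination of the gradients under the integral, where a null set does not
  matter.\<close>

lemma has_trace_lin:
  assumes u: "has_trace \<Omega> \<sigma> u g" and v: "has_trace \<Omega> \<sigma> v h"
  shows "has_trace \<Omega> \<sigma> (\<lambda>x. \<alpha> * u x + \<beta> * v x) (\<lambda>x. \<alpha> * g x + \<beta> * h x)"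
proof -
  obtain f f' where f: "\<And>k::nat. C1_with_gradient (f k) (f' k)"
    "(\<lambda>k. LINT x|leb \<Omega>. (f k x - u x)\<^sup>2) \<longlonglongrightarrow> 0"
    "(\<lambda>k. LINT x|leb \<Omega>. (norm (f' k x - weak_grad \<Omega> u x))\<^sup>2) \<longlonglongrightarrow> 0"
    "(\<lambda>k. LINT x|\<sigma>. (f k x - g x)\<^sup>2) \<longlonglongrightarrow> 0"
    using u unfolding has_trace_def by blast
  obtain e e' where e: "\<And>k::nat. C1_with_gradient (e k) (e' k)"
    "(\<lambda>k. LINT x|leb \<Omega>. (e k x - v x)\<^sup>2) \<longlonglongrightarrow> 0"
    "(\<lambda>k. LINT x|leb \<Omega>. (norm (e' k x - weak_grad \<Omega> v x))\<^sup>2) \<longlonglongrightarrow> 0"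
    "(\<lambda>k. LINT x|\<sigma>. (e k x - h x)\<^sup>2) \<longlonglongrightarrow> 0"
    using v unfolding has_trace_def by blast
  have H: "u \<in> H1 \<Omega>" "v \<in> H1 \<Omega>" "g \<in> L2 \<sigma>" "h \<in> L2 \<sigma>" using u v by (auto simp: has_trace_def)
  have C1: "C1_with_gradient (\<lambda>x. \<alpha> * f k x + \<beta> * e k x) (\<lambda>x. \<alpha> *\<^sub>R f' k x + \<beta> *\<^sub>R e' k x)" for k
    by (intro C1_add C1_cmult f e)
  have 1: "(\<lambda>k. LINT x|leb \<Omega>. ((\<alpha> * f k x + \<beta> * e k x) - (\<alpha> * u x + \<beta> * v x))\<^sup>2) \<longlonglongrightarrow> 0"
    using L2_tendsto_lin[of f "leb \<Omega>" e u v \<alpha> \<beta>] f(2) e(2) C1_L2_domain(1)[OF f(1)] C1_L2_domain(1)[OF e(1)] H1_L2(1)[OF H(1)] H1_L2(1)[OF H(2)] by simp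
  have 3: "(\<lambda>k. LINT x|\<sigma>. ((\<alpha> * f k x + \<beta> * e k x) - (\<alpha> * g x + \<beta> * h x))\<^sup>2) \<longlonglongrightarrow> 0"
    using L2_tendsto_lin[of f \<sigma> e g h \<alpha> \<beta>] f(4) e(4) C1_L2_surface[OF f(1)] C1_L2_surface[OF e(1)] H by simp
  have 2: "(\<lambda>k. LINT x|leb \<Omega>. (norm ((\<alpha> *\<^sub>R f' k x + \<beta> *\<^sub>R e' k x) - weak_grad \<Omega> (\<lambda>x. \<alpha> * u x + \<beta> * v x) x))\<^sup>2) \<longlonglongrightarrow> 0"
  proof -
    have "(LINT x|leb \<Omega>. (norm ((\<alpha> *\<^sub>R f' k x + \<beta> *\<^sub>R e' k x) - weak_grad \<Omega> (\<lambda>x. \<alpha> * u x + \<beta> * v x) x))\<^sup>2)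
      = (LINT x|leb \<Omega>. (norm ((\<alpha> *\<^sub>R f' k x + \<beta> *\<^sub>R e' k x) - (\<alpha> *\<^sub>R weak_grad \<Omega> u x + \<beta> *\<^sub>R weak_grad \<Omega> v x)))\<^sup>2)" for k
    proof (rule integral_cong_AE)
      note [measurable] = C1_L2_domain(2)[OF f(1), THEN L2_measurable] C1_L2_domain(2)[OF e(1), THEN L2_measurable]
        H1_L2(2)[OF H(1), THEN L2_measurable] H1_L2(2)[OF H(2), THEN L2_measurable]
        H1_L2(2)[OF H1_lin[OF open_dom H(1,2)], THEN L2_measurable]
      show "(\<lambda>x. (norm ((\<alpha> *\<^sub>R f' k x + \<beta> *\<^sub>R e' k x) - weak_grad \<Omega> (\<lambda>x. \<alpha> * u x + \<beta> * v x) x))\<^sup>2) \<in> borel_measurable (leb \<Omega>)" by measurable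
      show "(\<lambda>x. (norm ((\<alpha> *\<^sub>R f' k x + \<beta> *\<^sub>R e' k x) - (\<alpha> *\<^sub>R weak_grad \<Omega> u x + \<beta> *\<^sub>R weak_grad \<Omega> v x)))\<^sup>2) \<in> borel_measurable (leb \<Omega>)" by measurable
    qed (use weak_grad_lin[OF open_dom H(1,2), of \<alpha> \<beta>] in \<open>eventually_elim, simp\<close>)
    thus ?thesis
      using L2_tendsto_lin[of f' "leb \<Omega>" e' "weak_grad \<Omega> u" "weak_grad \<Omega> v" \<alpha> \<beta>] f(3) e(3)
        C1_L2_domain(2)[OF f(1)] C1_L2_domain(2)[OF e(1)] H1_L2(2)[OF H(1)] H1_L2(2)[OF H(2)] by simp
  qed
  show ?thesis unfolding has_trace_def
    using H1_lin[OF open_dom H(1,2)] L2_lin_real[OF H(3,4)] C1 1 2 3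
    by (intro conjI exI[of _ "\<lambda>k x. \<alpha> * f k x + \<beta> * e k x"] exI[of _ "\<lambda>k x. \<alpha> *\<^sub>R f' k x + \<beta> *\<^sub>R e' k x"]) auto
qed

lemma H1_vanishing_lin:
  assumes "u \<in> H1_vanishing \<Omega> \<sigma> \<Gamma>" "v \<in> H1_vanishing \<Omega> \<sigma> \<Gamma>"
  shows "(\<lambda>x. \<alpha> * u x + \<beta> * v x) \<in> H1_vanishing \<Omega> \<sigma> \<Gamma>"
proof -
  obtain g h where g: "has_trace \<Omega> \<sigma> u g" "AE x in restrict_space \<sigma> \<Gamma>. g x = 0"
    and h: "has_trace \<Omega> \<sigma> v h" "AE x in restrict_space \<sigma> \<Gamma>. h x = 0"
    using assms by (auto simp: H1_vanishing_def)
  have "AE x in restrict_space \<sigma> \<Gamma>. \<alpha> * g x + \<beta> * h x = 0" using g(2) h(2) by eventually_elim simp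
  thus ?thesis unfolding H1_vanishing_def using has_trace_lin[OF g(1) h(1)] by blast
qed

lemma H1_vanishing_H1: "u \<in> H1_vanishing \<Omega> \<sigma> \<Gamma> \<Longrightarrow> u \<in> H1 \<Omega>"
  by (auto simp: H1_vanishing_def has_trace_def)

lemma boundary_normal_component:
  assumes "e \<in> Basis" "C1_with_gradient \<eta> \<eta>'"
  shows "\<exists>C. (AE x in \<sigma>. \<bar>\<eta> x * (boundary_normal \<Omega> \<nu> x \<bullet> e)\<bar> \<le> C)"
    "(\<lambda>x. \<eta> x * (boundary_normal \<Omega> \<nu> x \<bullet> e)) \<in> borel_measurable \<sigma>"
proof -
  obtain C where C: "\<And>x. norm (boundary_normal \<Omega> \<nu> x) \<le> C" using bounded_boundary_normal by blast
  have nb: "\<bar>boundary_normal \<Omega> \<nu> x \<bullet> e\<bar> \<le> C" for x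
    using Basis_le_norm[OF assms(1), of "boundary_normal \<Omega> \<nu> x"] C[of x] by linarith
  have "bounded (\<eta> ` frontier \<Omega>)"
    by (intro compact_imp_bounded compact_continuous_image C1_continuous[OF assms(2)] compact_frontier_dom)
  then obtain B where B: "\<forall>y\<in>\<eta> ` frontier \<Omega>. norm y \<le> B" unfolding bounded_iff by blast
  have "AE x in \<sigma>. \<bar>\<eta> x * (boundary_normal \<Omega> \<nu> x \<bullet> e)\<bar> \<le> B * C"
    using AE_frontier by eventually_elim (use B nb in \<open>auto simp: abs_mult intro!: mult_mono'\<close>)
  thus "\<exists>C. (AE x in \<sigma>. \<bar>\<eta> x * (boundary_normal \<Omega> \<nu> x \<bullet> e)\<bar> \<le> C)" ..
  note [measurable] = C1_measurable_surface[OF assms(2)]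
  have [measurable]: "boundary_normal \<Omega> \<nu> \<in> borel_measurable \<sigma>"
    by (simp add: measurable_cong_sets[OF sets_surface refl])
  show "(\<lambda>x. \<eta> x * (boundary_normal \<Omega> \<nu> x \<bullet> e)) \<in> borel_measurable \<sigma>" by measurable
qed

text \<open>The divergence theorem for the product of approximants of \<open>v\<close> and
  \<open>p\<close> with \<eta>. Each of the four integrals contains two \<open>L2\<close>-convergent
  factors and one fixed bounded factor, so all pass to the limit; the boundary limits are the given
  traces.\<close>

lemma green_weighted:
  assumes v: "has_trace \<Omega> \<sigma> v g" and p: "has_trace \<Omega> \<sigma> p G" and \<eta>: "C1_with_gradient \<eta> \<eta>'" and e: "e \<in> Basis"
  shows "(LINT x|leb \<Omega>. (weak_grad \<Omega> v x \<bullet> e) * p x * \<eta> x) + (LINT x|leb \<Omega>. v x * (weak_grad \<Omega> p x \<bullet> e) * \<eta> x)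
     + (LINT x|leb \<Omega>. v x * p x * (\<eta>' x \<bullet> e)) = (LINT x|\<sigma>. g x * G x * (\<eta> x * (boundary_normal \<Omega> \<nu> x \<bullet> e)))"
proof -
  obtain f f' where f: "\<And>k::nat. C1_with_gradient (f k) (f' k)"
    "(\<lambda>k. LINT x|leb \<Omega>. (f k x - v x)\<^sup>2) \<longlonglongrightarrow> 0"
    "(\<lambda>k. LINT x|leb \<Omega>. (norm (f' k x - weak_grad \<Omega> v x))\<^sup>2) \<longlonglongrightarrow> 0"
    "(\<lambda>k. LINT x|\<sigma>. (f k x - g x)\<^sup>2) \<longlonglongrightarrow> 0"
    using v unfolding has_trace_def by blast
  obtain h h' where h: "\<And>k::nat. C1_with_gradient (h k) (h' k)"
    "(\<lambda>k. LINT x|leb \<Omega>. (h k x - p x)\<^sup>2) \<longlonglongrightarrow> 0"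
    "(\<lambda>k. LINT x|leb \<Omega>. (norm (h' k x - weak_grad \<Omega> p x))\<^sup>2) \<longlonglongrightarrow> 0"
    "(\<lambda>k. LINT x|\<sigma>. (h k x - G x)\<^sup>2) \<longlonglongrightarrow> 0"
    using p unfolding has_trace_def by blast
  have H: "v \<in> H1 \<Omega>" "p \<in> H1 \<Omega>" "g \<in> L2 \<sigma>" "G \<in> L2 \<sigma>" using v p by (auto simp: has_trace_def)
  \<comment> \<open>Convergence of gradients is given in norm; a component is dominated by
    it.\<close>
  have comp: "(\<lambda>k. LINT x|leb \<Omega>. (q k x \<bullet> e - w x \<bullet> e)\<^sup>2) \<longlonglongrightarrow> 0"
    if lim: "(\<lambda>k. LINT x|leb \<Omega>. (norm (q k x - w x))\<^sup>2) \<longlonglongrightarrow> 0"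
      and L2: "\<And>k. q k \<in> L2 (leb \<Omega>)" "w \<in> L2 (leb \<Omega>)" for q :: "nat \<Rightarrow> 'a \<Rightarrow> 'a" and w
  proof (rule tendsto_sandwich[OF _ _ tendsto_const lim])
    have "(LINT x|leb \<Omega>. (q k x \<bullet> e - w x \<bullet> e)\<^sup>2) \<le> (LINT x|leb \<Omega>. (norm (q k x - w x))\<^sup>2)" for k
    proof (rule integral_mono)
      show "integrable (leb \<Omega>) (\<lambda>x. (norm (q k x - w x))\<^sup>2)" by (intro L2_square_integrable L2_diff L2)
      show "integrable (leb \<Omega>) (\<lambda>x. (q k x \<bullet> e - w x \<bullet> e)\<^sup>2)"
        using L2_square_integrable[OF L2_inner_const[OF L2_diff[OF L2(1)[of k] L2(2)], of e]] by (simp add: inner_diff_left)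
      fix x show "(q k x \<bullet> e - w x \<bullet> e)\<^sup>2 \<le> (norm (q k x - w x))\<^sup>2"
        using Basis_le_norm[OF e, of "q k x - w x"] by (metis abs_le_square_iff abs_norm_cancel inner_diff_left)
    qed
    thus "\<forall>\<^sub>F k in sequentially. (LINT x|leb \<Omega>. (q k x \<bullet> e - w x \<bullet> e)\<^sup>2) \<le> (LINT x|leb \<Omega>. (norm (q k x - w x))\<^sup>2)" by simp
  qed simp
  note fL = C1_L2_domain[OF f(1)] and hL = C1_L2_domain[OF h(1)]
  note vL = H1_L2[OF H(1)] and pL = H1_L2[OF H(2)]
  obtain C where C: "AE x in leb \<Omega>. \<bar>\<eta> x\<bar> \<le> C" using C1_bounded_domain(1)[OF C1_continuous[OF \<eta>]] by blast
  have \<eta>m: "\<eta> \<in> borel_measurable (leb \<Omega>)" by (rule C1_bounded_domain(2)[OF C1_continuous[OF \<eta>]])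
  have c': "continuous_on UNIV (\<lambda>x. \<eta>' x \<bullet> e)" by (intro continuous_intros C1_continuous_gradient[OF \<eta>])
  obtain C' where C': "AE x in leb \<Omega>. \<bar>\<eta>' x \<bullet> e\<bar> \<le> C'" using C1_bounded_domain(1)[OF c'] by blast
  have \<eta>m': "(\<lambda>x. \<eta>' x \<bullet> e) \<in> borel_measurable (leb \<Omega>)" by (rule C1_bounded_domain(2)[OF c'])
  obtain C'' where C'': "AE x in \<sigma>. \<bar>\<eta> x * (boundary_normal \<Omega> \<nu> x \<bullet> e)\<bar> \<le> C''"
    using boundary_normal_component(1)[OF e \<eta>] by blast
  have l1: "(\<lambda>k. LINT x|leb \<Omega>. (f' k x \<bullet> e) * h k x * \<eta> x) \<longlonglongrightarrow> (LINT x|leb \<Omega>. (weak_grad \<Omega> v x \<bullet> e) * p x * \<eta> x)"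
    by (rule L2_tendsto_product[OF _ hL(1) _ pL(1) comp[OF f(3) fL(2) vL(2)] h(2) \<eta>m C]) (intro L2_inner_const fL vL)+
  have l2: "(\<lambda>k. LINT x|leb \<Omega>. f k x * (h' k x \<bullet> e) * \<eta> x) \<longlonglongrightarrow> (LINT x|leb \<Omega>. v x * (weak_grad \<Omega> p x \<bullet> e) * \<eta> x)"
    by (rule L2_tendsto_product[OF fL(1) _ vL(1) _ f(2) comp[OF h(3) hL(2) pL(2)] \<eta>m C]) (intro L2_inner_const hL pL)+
  have l3: "(\<lambda>k. LINT x|leb \<Omega>. f k x * h k x * (\<eta>' x \<bullet> e)) \<longlonglongrightarrow> (LINT x|leb \<Omega>. v x * p x * (\<eta>' x \<bullet> e))"
    by (rule L2_tendsto_product[OF fL(1) hL(1) vL(1) pL(1) f(2) h(2) \<eta>m' C'])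
  have r: "(\<lambda>k. LINT x|\<sigma>. f k x * h k x * (\<eta> x * (boundary_normal \<Omega> \<nu> x \<bullet> e))) \<longlonglongrightarrow>
      (LINT x|\<sigma>. g x * G x * (\<eta> x * (boundary_normal \<Omega> \<nu> x \<bullet> e)))"
    by (rule L2_tendsto_product[OF C1_L2_surface[OF f(1)] C1_L2_surface[OF h(1)] H(3,4) f(4) h(4) boundary_normal_component(2)[OF e \<eta>] C''])
  have eq: "(LINT x|leb \<Omega>. (f' k x \<bullet> e) * h k x * \<eta> x) + (LINT x|leb \<Omega>. f k x * (h' k x \<bullet> e) * \<eta> x)
     + (LINT x|leb \<Omega>. f k x * h k x * (\<eta>' x \<bullet> e)) = (LINT x|\<sigma>. f k x * h k x * (\<eta> x * (boundary_normal \<Omega> \<nu> x \<bullet> e)))" for k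
  proof -
    note div = divergence[OF C1_mult[OF C1_mult[OF f(1)[of k] h(1)[of k]] \<eta>] e]
    have i1: "integrable (leb \<Omega>) (\<lambda>x. (f' k x \<bullet> e) * h k x * \<eta> x)"
      and i2: "integrable (leb \<Omega>) (\<lambda>x. f k x * (h' k x \<bullet> e) * \<eta> x)"
      and i3: "integrable (leb \<Omega>) (\<lambda>x. f k x * h k x * (\<eta>' x \<bullet> e))"
      by (intro C1_domain_integrable continuous_intros C1_continuous[OF f(1)] C1_continuous_gradient[OF f(1)]
          C1_continuous[OF h(1)] C1_continuous_gradient[OF h(1)] C1_continuous[OF \<eta>] C1_continuous_gradient[OF \<eta>])+
    have "(LINT x|leb \<Omega>. (f' k x \<bullet> e) * h k x * \<eta> x) + (LINT x|leb \<Omega>. f k x * (h' k x \<bullet> e) * \<eta> x)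
      + (LINT x|leb \<Omega>. f k x * h k x * (\<eta>' x \<bullet> e)) =
      (LINT x|leb \<Omega>. (f' k x \<bullet> e) * h k x * \<eta> x + f k x * (h' k x \<bullet> e) * \<eta> x + f k x * h k x * (\<eta>' x \<bullet> e))"
      by (simp only: Bochner_Integration.integral_add[OF Bochner_Integration.integrable_add[OF i1 i2] i3] Bochner_Integration.integral_add[OF i1 i2])
    also have "\<dots> = (LINT x|leb \<Omega>. ((f k x * h k x) *\<^sub>R \<eta>' x + \<eta> x *\<^sub>R (f k x *\<^sub>R h' k x + h k x *\<^sub>R f' k x)) \<bullet> e)"
      by (rule Bochner_Integration.integral_cong) (auto simp: inner_add_left algebra_simps)
    also have "\<dots> = (LINT x|\<sigma>. f k x * h k x * \<eta> x * (boundary_normal \<Omega> \<nu> x \<bullet> e))" by (rule div)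
    finally show ?thesis by (simp add: mult.assoc)
  qed
  show ?thesis
    by (rule LIMSEQ_unique[OF tendsto_add[OF tendsto_add[OF l1 l2] l3, unfolded eq] r])
qed

text \<open>The normal field is arbitrary off the boundary. On \<open>\<Gamma>\<close> it agrees
  with the bounded Borel field \<open>boundary_normal\<close>, whose components multiply the traces
  of the partial derivatives.\<close>

lemma has_normal_derivative_L2:
  assumes "has_normal_derivative \<Omega> \<nu> \<sigma> u d" and \<Gamma>: "\<Gamma> \<subseteq> frontier \<Omega>" "closed \<Gamma>"
  shows "d \<in> L2 (restrict_space \<sigma> \<Gamma>)"
proof -
  obtain G where G: "\<And>b. b \<in> Basis \<Longrightarrow> has_trace \<Omega> \<sigma> (weak_partial \<Omega> b u) (\<lambda>x. G x \<bullet> b)" and d: "d = (\<lambda>x. G x \<bullet> \<nu> x)"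
    using assms(1) unfolding has_normal_derivative_def by blast
  have \<Gamma>s: "\<Gamma> \<inter> space \<sigma> \<in> sets \<sigma>" using \<Gamma>(2) by simp
  have L: "(\<lambda>x. (G x \<bullet> b) * (1 * (boundary_normal \<Omega> \<nu> x \<bullet> b))) \<in> L2 \<sigma>" if b: "b \<in> Basis" for b
  proof -
    obtain C where "AE x in \<sigma>. \<bar>1 * (boundary_normal \<Omega> \<nu> x \<bullet> b)\<bar> \<le> C"
      using boundary_normal_component(1)[OF b C1_const[of 1]] by blast
    thus ?thesis using G[OF b] by (intro L2_mult_bounded(1) boundary_normal_component(2)[OF b C1_const[of 1]]) (auto simp: has_trace_def)
  qed
  define d' where "d' x = (\<Sum>b\<in>Basis. (G x \<bullet> b) * (1 * (boundary_normal \<Omega> \<nu> x \<bullet> b)))" for x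
  have "d' \<in> L2 \<sigma>" unfolding d'_def by (rule L2_sum[OF finite_Basis]) (rule L)
  hence d'2: "d' \<in> borel_measurable \<sigma>" "integrable \<sigma> (\<lambda>x. (norm (d' x))\<^sup>2)" by (auto simp: L2_def)
  have "d' \<in> borel_measurable (restrict_space \<sigma> \<Gamma>)" by (rule measurable_restrict_space1[OF d'2(1)])
  moreover have "integrable (restrict_space \<sigma> \<Gamma>) (\<lambda>x. (norm (d' x))\<^sup>2)"
    unfolding integrable_restrict_space[OF \<Gamma>s] by (rule integrable_mult_indicator[OF _ d'2(2)]) (use \<Gamma> in simp)
  moreover have dd: "d x = d' x" if "x \<in> space (restrict_space \<sigma> \<Gamma>)" for x
    using that \<Gamma>(1) by (auto simp: d'_def d boundary_normal_def space_restrict_space indicator_def euclidean_inner[of "G x" "\<nu> x"])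
  ultimately show ?thesis unfolding L2_def
    using measurable_cong[of "restrict_space \<sigma> \<Gamma>" d d'] Bochner_Integration.integrable_cong[of "restrict_space \<sigma> \<Gamma>" _ "\<lambda>x. (norm (d x))\<^sup>2" "\<lambda>x. (norm (d' x))\<^sup>2"] by simp
qed

text \<open>The weights \<eta> and \<theta> add up to 1, so the two weighted formulas, summed over
  the coordinate directions, give the unweighted volume integrals, and the boundary integrand is
  \<open>d * w\<close> on \<open>\<Gamma>1\<close> and 0 on \<open>\<Gamma>0\<close>.\<close>

theorem green:
  assumes fr: "frontier \<Omega> = \<Gamma>0 \<union> \<Gamma>1" "closed \<Gamma>0" "closed \<Gamma>1" "\<Gamma>0 \<inter> \<Gamma>1 = {}"
    and u: "has_normal_derivative \<Omega> \<nu> \<sigma> u d"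
    and v: "v \<in> H1_vanishing \<Omega> \<sigma> \<Gamma>0" and w: "trace_on \<Omega> \<sigma> \<Gamma>1 v w" "w \<in> L2 (restrict_space \<sigma> \<Gamma>1)"
  shows "(LINT x|leb \<Omega>. weak_grad \<Omega> v x \<bullet> weak_grad \<Omega> u x) + (LINT x|leb \<Omega>. weak_laplacian \<Omega> u x * v x) =
    (LINT x|restrict_space \<sigma> \<Gamma>1. d x * w x)"
proof -
  obtain G where u2: "u \<in> H2 \<Omega>" and G: "\<And>b. b \<in> Basis \<Longrightarrow> has_trace \<Omega> \<sigma> (weak_partial \<Omega> b u) (\<lambda>x. G x \<bullet> b)"
    and d: "d = (\<lambda>x. G x \<bullet> \<nu> x)"
    using u unfolding has_normal_derivative_def by blast
  obtain g0 where g0: "has_trace \<Omega> \<sigma> v g0" "AE x in restrict_space \<sigma> \<Gamma>0. g0 x = 0" using v by (auto simp: H1_vanishing_def)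
  obtain g1 where g1: "has_trace \<Omega> \<sigma> v g1" "AE x in restrict_space \<sigma> \<Gamma>1. g1 x = w x" using w by (auto simp: trace_on_def)
  have \<Gamma>s: "\<Gamma>0 \<inter> space \<sigma> \<in> sets \<sigma>" "\<Gamma>1 \<inter> space \<sigma> \<in> sets \<sigma>" using fr by auto
  have "frontier \<Omega> \<inter> \<Gamma>1 = \<Gamma>1" using fr(1) by blast
  hence "compact \<Gamma>1" using compact_Int_closed[OF compact_frontier_dom fr(3)] by simp
  then obtain \<eta> \<eta>' where \<eta>: "C1_with_gradient \<eta> \<eta>'" and \<eta>1: "\<And>x. x \<in> \<Gamma>1 \<Longrightarrow> \<eta> x = 1" and \<eta>0: "\<And>x. x \<in> \<Gamma>0 \<Longrightarrow> \<eta> x = 0"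
    using C1_cutoff[OF _ fr(2), of \<Gamma>1] fr(4) by blast
  define \<theta> where "\<theta> x = 1 + (-1) * \<eta> x" for x
  define \<theta>' where "\<theta>' x = 0 + (-1) *\<^sub>R \<eta>' x" for x
  have \<theta>: "C1_with_gradient \<theta> \<theta>'" unfolding \<theta>_def[abs_def] \<theta>'_def[abs_def] by (intro C1_add C1_const C1_cmult \<eta>)
  have uH: "u \<in> H1 \<Omega>" "\<And>b. b \<in> Basis \<Longrightarrow> weak_partial \<Omega> b u \<in> H1 \<Omega>" using u2 by (auto simp: H2_def)
  have vH: "v \<in> H1 \<Omega>" by (rule H1_vanishing_H1[OF v])
  let ?n = "boundary_normal \<Omega> \<nu>"
  \<comment> \<open>The boundary integrand in direction \<open>b\<close>: the trace known on
    \<open>\<Gamma>1\<close> carries \<eta>, the one known on \<open>\<Gamma>0\<close> carries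
    \<theta>.\<close>
  define R where "R b x = g1 x * (G x \<bullet> b) * (\<eta> x * (?n x \<bullet> b)) + g0 x * (G x \<bullet> b) * (\<theta> x * (?n x \<bullet> b))" for b x
  have key: "integrable \<sigma> (R b) \<and> (LINT x|leb \<Omega>. (weak_grad \<Omega> v x \<bullet> b) * weak_partial \<Omega> b u x) +
      (LINT x|leb \<Omega>. v x * weak_partial \<Omega> b (weak_partial \<Omega> b u) x) = (LINT x|\<sigma>. R b x)" if b: "b \<in> Basis" for b
  proof -
    let ?p = "weak_partial \<Omega> b u"
    have pH: "?p \<in> H1 \<Omega>" by (rule uH(2)[OF b])
    have int: "integrable (leb \<Omega>) (\<lambda>x. f x * h x * q x)"
      if a: "f \<in> L2 (leb \<Omega>)" "h \<in> L2 (leb \<Omega>)" "continuous_on UNIV q" for f h q :: "'a \<Rightarrow> real"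
    proof -
      obtain C where "AE x in leb \<Omega>. \<bar>q x\<bar> \<le> C" using C1_bounded_domain(1)[OF a(3)] by blast
      from L2_mult_integrable[OF a(1) L2_mult_bounded(1)[OF a(2) C1_bounded_domain(2)[OF a(3)] this]]
      show ?thesis by (simp add: mult.assoc)
    qed
    have ints: "integrable \<sigma> (\<lambda>x. f x * h x * (q x * (?n x \<bullet> b)))"
      if a: "f \<in> L2 \<sigma>" "h \<in> L2 \<sigma>" "C1_with_gradient q q'" for f h q q'
    proof -
      obtain C where "AE x in \<sigma>. \<bar>q x * (?n x \<bullet> b)\<bar> \<le> C" using boundary_normal_component(1)[OF b a(3)] by blast
      from L2_mult_integrable[OF a(1) L2_mult_bounded(1)[OF a(2) boundary_normal_component(2)[OF b a(3)] this]]
      show ?thesis by (simp add: mult.assoc)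
    qed
    have gL: "g0 \<in> L2 \<sigma>" "g1 \<in> L2 \<sigma>" "(\<lambda>x. G x \<bullet> b) \<in> L2 \<sigma>" using g0 g1 G[OF b] by (auto simp: has_trace_def)
    note L1 = L2_inner_const[OF H1_L2(2)[OF vH], of b] H1_L2(1)[OF pH]
    note L2' = H1_L2(1)[OF vH] L2_inner_const[OF H1_L2(2)[OF pH], of b]
    note c = C1_continuous[OF \<eta>, of UNIV] C1_continuous[OF \<theta>, of UNIV]
    have s1: "(LINT x|leb \<Omega>. (weak_grad \<Omega> v x \<bullet> b) * ?p x) = (LINT x|leb \<Omega>. (weak_grad \<Omega> v x \<bullet> b) * ?p x * \<eta> x)
        + (LINT x|leb \<Omega>. (weak_grad \<Omega> v x \<bullet> b) * ?p x * \<theta> x)"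
      by (subst Bochner_Integration.integral_add[symmetric, OF int[OF L1 c(1)] int[OF L1 c(2)]])
         (simp add: \<theta>_def algebra_simps)
    have s2: "(LINT x|leb \<Omega>. v x * weak_partial \<Omega> b ?p x) = (LINT x|leb \<Omega>. v x * (weak_grad \<Omega> ?p x \<bullet> b) * \<eta> x)
        + (LINT x|leb \<Omega>. v x * (weak_grad \<Omega> ?p x \<bullet> b) * \<theta> x)"
      by (subst Bochner_Integration.integral_add[symmetric, OF int[OF L2' c(1)] int[OF L2' c(2)]])
         (simp add: \<theta>_def weak_partial_def algebra_simps)
    \<comment> \<open>The two terms with differentiated cutoffs cancel; they contain the function
      \<open>v\<close> itself and no trace.\<close>
    have s3: "(LINT x|leb \<Omega>. v x * ?p x * (\<theta>' x \<bullet> b)) = - (LINT x|leb \<Omega>. v x * ?p x * (\<eta>' x \<bullet> b))"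
      by (simp add: \<theta>'_def)
    have i: "integrable \<sigma> (\<lambda>x. g1 x * (G x \<bullet> b) * (\<eta> x * (?n x \<bullet> b)))" "integrable \<sigma> (\<lambda>x. g0 x * (G x \<bullet> b) * (\<theta> x * (?n x \<bullet> b)))"
      by (rule ints[OF gL(2,3) \<eta>] ints[OF gL(1,3) \<theta>])+
    have "(LINT x|\<sigma>. R b x) = (LINT x|\<sigma>. g1 x * (G x \<bullet> b) * (\<eta> x * (?n x \<bullet> b))) + (LINT x|\<sigma>. g0 x * (G x \<bullet> b) * (\<theta> x * (?n x \<bullet> b)))"
      unfolding R_def by (rule Bochner_Integration.integral_add[OF i])
    moreover have "integrable \<sigma> (R b)" unfolding R_def[abs_def] by (rule Bochner_Integration.integrable_add[OF i])
    ultimately show ?thesis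
      using s1 s2 s3 green_weighted[OF g1(1) G[OF b] \<eta> b] green_weighted[OF g0(1) G[OF b] \<theta> b] by simp
  qed
  have "(LINT x|leb \<Omega>. weak_grad \<Omega> v x \<bullet> weak_grad \<Omega> u x) = (LINT x|leb \<Omega>. (\<Sum>b\<in>Basis. (weak_grad \<Omega> v x \<bullet> b) * weak_partial \<Omega> b u x))"
    by (simp add: weak_partial_def euclidean_inner[of "weak_grad \<Omega> v _" "weak_grad \<Omega> u _"])
  also have "\<dots> = (\<Sum>b\<in>Basis. LINT x|leb \<Omega>. (weak_grad \<Omega> v x \<bullet> b) * weak_partial \<Omega> b u x)"
    by (rule Bochner_Integration.integral_sum) (intro L2_mult_integrable L2_inner_const H1_L2 vH uH)
  finally have e1: "(LINT x|leb \<Omega>. weak_grad \<Omega> v x \<bullet> weak_grad \<Omega> u x) = (\<Sum>b\<in>Basis. LINT x|leb \<Omega>. (weak_grad \<Omega> v x \<bullet> b) * weak_partial \<Omega> b u x)" .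
  have "(LINT x|leb \<Omega>. weak_laplacian \<Omega> u x * v x) = (LINT x|leb \<Omega>. (\<Sum>b\<in>Basis. v x * weak_partial \<Omega> b (weak_partial \<Omega> b u) x))"
    by (simp add: weak_laplacian_def sum_distrib_left mult.commute)
  also have "\<dots> = (\<Sum>b\<in>Basis. LINT x|leb \<Omega>. v x * weak_partial \<Omega> b (weak_partial \<Omega> b u) x)"
    unfolding weak_partial_def[of \<Omega> _ "weak_partial \<Omega> _ u"]
    by (rule Bochner_Integration.integral_sum) (intro L2_mult_integrable L2_inner_const H1_L2 vH uH)
  finally have e2: "(LINT x|leb \<Omega>. weak_laplacian \<Omega> u x * v x) = (\<Sum>b\<in>Basis. LINT x|leb \<Omega>. v x * weak_partial \<Omega> b (weak_partial \<Omega> b u) x)" .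
  have "(LINT x|leb \<Omega>. weak_grad \<Omega> v x \<bullet> weak_grad \<Omega> u x) + (LINT x|leb \<Omega>. weak_laplacian \<Omega> u x * v x) = (\<Sum>b\<in>Basis. LINT x|\<sigma>. R b x)"
    unfolding e1 e2 sum.distrib[symmetric] using key by (intro sum.cong) auto
  also have "\<dots> = (LINT x|\<sigma>. (\<Sum>b\<in>Basis. R b x))" by (rule Bochner_Integration.integral_sum[symmetric]) (use key in auto)
  \<comment> \<open>On \<open>\<Gamma>1\<close> we have \<open>\<theta> = 0\<close>, so
    \<open>g0\<close> drops out; on \<open>\<Gamma>0\<close> the factor \<eta> removes
    \<open>g1\<close> and \<open>g0\<close> vanishes.\<close>
  also have "\<dots> = (LINT x|\<sigma>. indicator \<Gamma>1 x *\<^sub>R (d x * w x))"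
  proof (rule integral_cong_AE)
    have ae0: "AE x in \<sigma>. x \<in> \<Gamma>0 \<longrightarrow> g0 x = 0" using g0(2) by (subst (asm) AE_restrict_space_iff[OF \<Gamma>s(1)]) auto
    have ae1: "AE x in \<sigma>. x \<in> \<Gamma>1 \<longrightarrow> g1 x = w x" using g1(2) by (subst (asm) AE_restrict_space_iff[OF \<Gamma>s(2)]) auto
    show "AE x in \<sigma>. (\<Sum>b\<in>Basis. R b x) = indicator \<Gamma>1 x *\<^sub>R (d x * w x)"
      using AE_frontier ae0 ae1
    proof eventually_elim
      fix x assume x: "x \<in> frontier \<Omega>" "x \<in> \<Gamma>0 \<longrightarrow> g0 x = 0" "x \<in> \<Gamma>1 \<longrightarrow> g1 x = w x"
      show "(\<Sum>b\<in>Basis. R b x) = indicator \<Gamma>1 x *\<^sub>R (d x * w x)"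
      proof (cases "x \<in> \<Gamma>1")
        case True
        hence "R b x = w x * ((G x \<bullet> b) * (\<nu> x \<bullet> b))" for b
          using x \<eta>1 by (simp add: R_def \<theta>_def boundary_normal_def)
        thus ?thesis using True by (simp add: d euclidean_inner[of "G x" "\<nu> x"] sum_distrib_left mult.commute)
      next
        case False
        hence "x \<in> \<Gamma>0" using x(1) fr(1) by blast
        thus ?thesis using x(2) \<eta>0 False by (simp add: R_def)
      qed
    qed
    show "(\<lambda>x. \<Sum>b\<in>Basis. R b x) \<in> borel_measurable \<sigma>"
      by (rule borel_measurable_sum) (use key in \<open>auto intro!: borel_measurable_integrable\<close>)
    have "d \<in> borel_measurable (restrict_space \<sigma> \<Gamma>1)" "w \<in> borel_measurable (restrict_space \<sigma> \<Gamma>1)"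
      using has_normal_derivative_L2[OF u _ fr(3)] fr(1) w(2) by (auto intro!: L2_measurable)
    hence "(\<lambda>x. d x * w x) \<in> borel_measurable (restrict_space \<sigma> \<Gamma>1)" by (rule borel_measurable_times)
    thus "(\<lambda>x. indicator \<Gamma>1 x *\<^sub>R (d x * w x)) \<in> borel_measurable \<sigma>"
      unfolding borel_measurable_restrict_space_iff[OF \<Gamma>s(2)] .
  qed
  also have "\<dots> = (LINT x|restrict_space \<sigma> \<Gamma>1. d x * w x)" by (rule integral_restrict_space[OF \<Gamma>s(2), symmetric])
  finally show ?thesis .
qed

end

section \<open>The energy form and its dissipation\<close>

text \<open>The energy with an affine weight on the delay component. The parameters
  \<open>\<xi>, 0\<close> give the original inner product,
  \<open>\<xi> - \<epsilon>, \<epsilon>\<close> the modified form.\<close>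

fun energy_form ::
  "'a::euclidean_space set \<Rightarrow> 'a measure \<Rightarrow> 'a set \<Rightarrow> real \<Rightarrow> real \<Rightarrow> 'a state \<Rightarrow> 'a state \<Rightarrow> real" where
  "energy_form \<Omega> \<sigma> \<Gamma>1 A B (u1, v1, w1, z1) (u2, v2, w2, z2) =
     (LINT x|leb \<Omega>. weak_grad \<Omega> u1 x \<bullet> weak_grad \<Omega> u2 x) + (LINT x|leb \<Omega>. v1 x * v2 x) +
     (LINT x|restrict_space \<sigma> \<Gamma>1. w1 x * w2 x) +
     (LINT p|cyl \<sigma> \<Gamma>1. (A + B * snd p) * (z1 p * z2 p))"

lemma energy_inner_eq_form: "energy_inner \<Omega> \<sigma> \<Gamma>1 \<xi> V W = energy_form \<Omega> \<sigma> \<Gamma>1 \<xi> 0 V W"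
  by (cases V; cases W) simp

lemma space_cyl: "space (cyl \<sigma> \<Gamma>) = (\<Gamma> \<inter> space \<sigma>) \<times> {0<..<1}"
  by (auto simp: space_pair_measure space_restrict_space)

lemma measurable_cyl_weight: "(\<lambda>p. A + B * snd p) \<in> borel_measurable (cyl \<sigma> \<Gamma>)"
proof -
  have "(\<lambda>x. x) \<in> borel_measurable (leb {0<..<1})" by (rule measurable_restrict_space1) simp
  from measurable_compose[OF measurable_snd this]
  have [measurable]: "(\<lambda>p. snd p) \<in> borel_measurable (cyl \<sigma> \<Gamma>)" .
  show ?thesis by measurable
qed

lemma cyl_weight_integrable:
  assumes "y \<in> L2 (cyl \<sigma> \<Gamma>)" "z \<in> L2 (cyl \<sigma> \<Gamma>)"
  shows "integrable (cyl \<sigma> \<Gamma>) (\<lambda>p. (A + B * snd p) * (y p * z p))"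
proof -
  have "AE p in cyl \<sigma> \<Gamma>. \<bar>A + B * snd p\<bar> \<le> \<bar>A\<bar> + \<bar>B\<bar>"
  proof (rule AE_I2)
    fix p assume "p \<in> space (cyl \<sigma> \<Gamma>)"
    hence "snd p \<in> {0<..<1}" unfolding space_cyl by auto
    hence "\<bar>B * snd p\<bar> \<le> \<bar>B\<bar> * 1" unfolding abs_mult by (intro mult_left_mono) auto
    thus "\<bar>A + B * snd p\<bar> \<le> \<bar>A\<bar> + \<bar>B\<bar>" by linarith
  qed
  from L2_mult_integrable[OF assms(1) L2_mult_bounded(1)[OF assms(2) measurable_cyl_weight this]]
  show ?thesis by (simp add: mult_ac)
qed

lemma weak_laplacian_L2:
  assumes "u \<in> H2 \<Omega>" shows "weak_laplacian \<Omega> u \<in> L2 (leb \<Omega>)"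
  unfolding weak_laplacian_def weak_partial_def[of \<Omega> _ "weak_partial \<Omega> _ u"]
  by (rule L2_sum[OF finite_Basis], rule L2_inner_const, rule H1_L2(2)) (use assms in \<open>auto simp: H2_def\<close>)

context C1_domain
begin

lemma energy_form_semi_inner_product:
  assumes wt: "\<And>\<rho>. 0 < \<rho> \<Longrightarrow> \<rho> < 1 \<Longrightarrow> 0 \<le> A + B * \<rho>"
  shows "semi_inner_product (energy_space \<Omega> \<sigma> \<Gamma>0 \<Gamma>1) state_lin (energy_form \<Omega> \<sigma> \<Gamma>1 A B)"
proof
  fix V W :: "'a state" and \<alpha> \<beta> :: real
  assume V: "V \<in> energy_space \<Omega> \<sigma> \<Gamma>0 \<Gamma>1" and W: "W \<in> energy_space \<Omega> \<sigma> \<Gamma>0 \<Gamma>1"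
  obtain u1 v1 w1 z1 where V_eq: "V = (u1, v1, w1, z1)" by (metis prod_cases4)
  obtain u2 v2 w2 z2 where W_eq: "W = (u2, v2, w2, z2)" by (metis prod_cases4)
  have V': "u1 \<in> H1_vanishing \<Omega> \<sigma> \<Gamma>0" "v1 \<in> L2 (leb \<Omega>)" "w1 \<in> L2 (restrict_space \<sigma> \<Gamma>1)" "z1 \<in> L2 (cyl \<sigma> \<Gamma>1)"
    using V by (auto simp: V_eq energy_space_def)
  have W': "u2 \<in> H1_vanishing \<Omega> \<sigma> \<Gamma>0" "v2 \<in> L2 (leb \<Omega>)" "w2 \<in> L2 (restrict_space \<sigma> \<Gamma>1)" "z2 \<in> L2 (cyl \<sigma> \<Gamma>1)"
    using W by (auto simp: W_eq energy_space_def)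
  show "state_lin \<alpha> V \<beta> W \<in> energy_space \<Omega> \<sigma> \<Gamma>0 \<Gamma>1"
    using V' W' by (simp add: V_eq W_eq energy_space_def H1_vanishing_lin L2_lin_real)
  show "energy_form \<Omega> \<sigma> \<Gamma>1 A B V W = energy_form \<Omega> \<sigma> \<Gamma>1 A B W V"
    by (simp add: V_eq W_eq inner_commute mult_ac)
  show "0 \<le> energy_form \<Omega> \<sigma> \<Gamma>1 A B V V"
    unfolding V_eq energy_form.simps
  proof (intro add_nonneg_nonneg)
    show "0 \<le> (LINT p|cyl \<sigma> \<Gamma>1. (A + B * snd p) * (z1 p * z1 p))"
    proof (rule integral_nonneg_AE, rule AE_I2, rule mult_nonneg_nonneg)
      fix p assume "p \<in> space (cyl \<sigma> \<Gamma>1)"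
      thus "0 \<le> A + B * snd p" unfolding space_cyl by (intro wt) auto
    qed simp
  qed auto
  fix U assume U: "U \<in> energy_space \<Omega> \<sigma> \<Gamma>0 \<Gamma>1"
  obtain u v w z where U_eq: "U = (u, v, w, z)" by (metis prod_cases4)
  have U': "u \<in> H1_vanishing \<Omega> \<sigma> \<Gamma>0" "v \<in> L2 (leb \<Omega>)" "w \<in> L2 (restrict_space \<sigma> \<Gamma>1)" "z \<in> L2 (cyl \<sigma> \<Gamma>1)"
    using U by (auto simp: U_eq energy_space_def)
  have lin: "(\<integral>x. \<alpha> * f x + \<beta> * g x \<partial>M) = \<alpha> * (\<integral>x. f x \<partial>M) + \<beta> * (\<integral>x. g x \<partial>M)"
    if "integrable M f" "integrable M g" for M and f g :: "'b \<Rightarrow> real"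
    using that by simp
  note H = H1_vanishing_H1[OF V'(1)] H1_vanishing_H1[OF W'(1)] H1_vanishing_H1[OF U'(1)]
  have "(LINT x|leb \<Omega>. weak_grad \<Omega> (\<lambda>x. \<alpha> * u1 x + \<beta> * u2 x) x \<bullet> weak_grad \<Omega> u x) =
      (LINT x|leb \<Omega>. \<alpha> * (weak_grad \<Omega> u1 x \<bullet> weak_grad \<Omega> u x) + \<beta> * (weak_grad \<Omega> u2 x \<bullet> weak_grad \<Omega> u x))"
  proof (rule integral_cong_AE)
    note [measurable] = H1_L2(2)[OF H(1), THEN L2_measurable] H1_L2(2)[OF H(2), THEN L2_measurable]
      H1_L2(2)[OF H(3), THEN L2_measurable] H1_L2(2)[OF H1_lin[OF open_dom H(1,2)], THEN L2_measurable]
    show "(\<lambda>x. weak_grad \<Omega> (\<lambda>x. \<alpha> * u1 x + \<beta> * u2 x) x \<bullet> weak_grad \<Omega> u x) \<in> borel_measurable (leb \<Omega>)" by measurable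
    show "(\<lambda>x. \<alpha> * (weak_grad \<Omega> u1 x \<bullet> weak_grad \<Omega> u x) + \<beta> * (weak_grad \<Omega> u2 x \<bullet> weak_grad \<Omega> u x)) \<in> borel_measurable (leb \<Omega>)" by measurable
    show "AE x in leb \<Omega>. weak_grad \<Omega> (\<lambda>x. \<alpha> * u1 x + \<beta> * u2 x) x \<bullet> weak_grad \<Omega> u x =
       \<alpha> * (weak_grad \<Omega> u1 x \<bullet> weak_grad \<Omega> u x) + \<beta> * (weak_grad \<Omega> u2 x \<bullet> weak_grad \<Omega> u x)"
      using weak_grad_lin[OF open_dom H(1,2), of \<alpha> \<beta>] by eventually_elim (simp add: inner_add_left)
  qed
  also have "\<dots> = \<alpha> * (LINT x|leb \<Omega>. weak_grad \<Omega> u1 x \<bullet> weak_grad \<Omega> u x) + \<beta> * (LINT x|leb \<Omega>. weak_grad \<Omega> u2 x \<bullet> weak_grad \<Omega> u x)"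
    by (intro lin L2_inner_integrable H1_L2 H)
  finally have 1: "(LINT x|leb \<Omega>. weak_grad \<Omega> (\<lambda>x. \<alpha> * u1 x + \<beta> * u2 x) x \<bullet> weak_grad \<Omega> u x) =
    \<alpha> * (LINT x|leb \<Omega>. weak_grad \<Omega> u1 x \<bullet> weak_grad \<Omega> u x) + \<beta> * (LINT x|leb \<Omega>. weak_grad \<Omega> u2 x \<bullet> weak_grad \<Omega> u x)" .
  have 4: "(LINT p|cyl \<sigma> \<Gamma>1. (A + B * snd p) * ((\<alpha> * z1 p + \<beta> * z2 p) * z p)) =
     \<alpha> * (LINT p|cyl \<sigma> \<Gamma>1. (A + B * snd p) * (z1 p * z p)) + \<beta> * (LINT p|cyl \<sigma> \<Gamma>1. (A + B * snd p) * (z2 p * z p))"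
  proof -
    have "(LINT p|cyl \<sigma> \<Gamma>1. (A + B * snd p) * ((\<alpha> * z1 p + \<beta> * z2 p) * z p)) =
      (LINT p|cyl \<sigma> \<Gamma>1. \<alpha> * ((A + B * snd p) * (z1 p * z p)) + \<beta> * ((A + B * snd p) * (z2 p * z p)))"
      by (rule Bochner_Integration.integral_cong) (auto simp: algebra_simps)
    also have "\<dots> = (LINT p|cyl \<sigma> \<Gamma>1. \<alpha> * ((A + B * snd p) * (z1 p * z p)))
        + (LINT p|cyl \<sigma> \<Gamma>1. \<beta> * ((A + B * snd p) * (z2 p * z p)))"
      by (intro Bochner_Integration.integral_add integrable_mult_right cyl_weight_integrable V' W' U')
    finally show ?thesis by (simp only: integral_mult_right_zero)
  qed
  have 2: "(LINT x|leb \<Omega>. (\<alpha> * v1 x + \<beta> * v2 x) * v x) = \<alpha> * (LINT x|leb \<Omega>. v1 x * v x) + \<beta> * (LINT x|leb \<Omega>. v2 x * v x)"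
    using Bochner_Integration.integral_add[OF integrable_mult_right[OF L2_mult_integrable[OF V'(2) U'(2)], of \<alpha>]
      integrable_mult_right[OF L2_mult_integrable[OF W'(2) U'(2)], of \<beta>]] by (simp add: algebra_simps)
  have 3: "(LINT x|restrict_space \<sigma> \<Gamma>1. (\<alpha> * w1 x + \<beta> * w2 x) * w x) =
    \<alpha> * (LINT x|restrict_space \<sigma> \<Gamma>1. w1 x * w x) + \<beta> * (LINT x|restrict_space \<sigma> \<Gamma>1. w2 x * w x)"
    using Bochner_Integration.integral_add[OF integrable_mult_right[OF L2_mult_integrable[OF V'(3) U'(3)], of \<alpha>]
      integrable_mult_right[OF L2_mult_integrable[OF W'(3) U'(3)], of \<beta>]] by (simp add: algebra_simps)
  show "energy_form \<Omega> \<sigma> \<Gamma>1 A B (state_lin \<alpha> V \<beta> W) U = \<alpha> * energy_form \<Omega> \<sigma> \<Gamma>1 A B V U + \<beta> * energy_form \<Omega> \<sigma> \<Gamma>1 A B W U"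
    unfolding V_eq W_eq U_eq state_lin.simps energy_form.simps 1 2 3 4 by (simp add: algebra_simps)
qed

text \<open>The one-dimensional identity on almost every fibre, integrated over
  \<open>\<Gamma>\<close> by Fubini; the surface measure is finite, which makes the product
  sigma-finite.\<close>

lemma delay_identity:
  assumes \<Gamma>: "closed \<Gamma>" and z: "L2_H1_derivative \<sigma> \<Gamma> z \<zeta>"
    and w: "w \<in> L2 (restrict_space \<sigma> \<Gamma>)" and z1: "z1 \<in> L2 (restrict_space \<sigma> \<Gamma>)"
    and ends: "AE x in restrict_space \<sigma> \<Gamma>. endpoint_values (\<lambda>\<rho>. z (x, \<rho>)) (w x) (z1 x)"
  shows "(LINT p|cyl \<sigma> \<Gamma>. (A + B * snd p) * (z p * \<zeta> p)) =
    ((A + B) * (LINT x|restrict_space \<sigma> \<Gamma>. (z1 x)\<^sup>2) - A * (LINT x|restrict_space \<sigma> \<Gamma>. (w x)\<^sup>2)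
      - B * (LINT p|cyl \<sigma> \<Gamma>. (z p)\<^sup>2)) / 2"
proof -
  let ?M = "restrict_space \<sigma> \<Gamma>"
  interpret S: finite_measure \<sigma> by (rule finite_surface)
  interpret M: finite_measure ?M by (rule finite_measure_restrict_space[OF finite_surface]) (use \<Gamma> in auto)
  have "emeasure (leb {0<..<1::real}) (space (leb {0<..<1::real})) \<noteq> \<infinity>"
    by (simp add: emeasure_restrict_space space_restrict_space)
  then interpret I: finite_measure "leb {0<..<1::real}" by (rule finite_measureI)
  interpret P: pair_sigma_finite ?M "leb {0<..<1::real}" ..
  have zL: "z \<in> L2 (cyl \<sigma> \<Gamma>)" "\<zeta> \<in> L2 (cyl \<sigma> \<Gamma>)" and H: "AE x in ?M. H1_gradient {0<..<1} (\<lambda>\<rho>. z (x, \<rho>)) (\<lambda>\<rho>. \<zeta> (x, \<rho>))"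
    using z by (auto simp: L2_H1_derivative_def)
  have i1: "integrable (cyl \<sigma> \<Gamma>) (\<lambda>p. (A + B * snd p) * (z p * \<zeta> p))" by (rule cyl_weight_integrable[OF zL])
  have i2: "integrable (cyl \<sigma> \<Gamma>) (\<lambda>p. (z p)\<^sup>2)" using L2_square_integrable[OF zL(1)] by simp
  have iw: "integrable ?M (\<lambda>x. (w x)\<^sup>2)" "integrable ?M (\<lambda>x. (z1 x)\<^sup>2)" using w z1 by (auto simp: L2_def)
  define q where "q x = (LINT \<rho>|leb {0<..<1}. (z (x, \<rho>))\<^sup>2)" for x
  have iq: "integrable ?M q" unfolding q_def using P.integrable_fst'[OF i2] by simp
  have q: "(LINT x|?M. q x) = (LINT p|cyl \<sigma> \<Gamma>. (z p)\<^sup>2)" unfolding q_def using P.integral_fst'[OF i2] by simp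
  have "(LINT p|cyl \<sigma> \<Gamma>. (A + B * snd p) * (z p * \<zeta> p)) =
      (LINT x|?M. (LINT \<rho>|leb {0<..<1}. (A + B * \<rho>) * (z (x, \<rho>) * \<zeta> (x, \<rho>))))"
    using P.integral_fst'[OF i1] by simp
  also have "\<dots> = (LINT x|?M. ((A + B) * (z1 x)\<^sup>2 - A * (w x)\<^sup>2 - B * q x) / 2)"
  proof (rule integral_cong_AE)
    show "AE x in ?M. (LINT \<rho>|leb {0<..<1}. (A + B * \<rho>) * (z (x, \<rho>) * \<zeta> (x, \<rho>))) = ((A + B) * (z1 x)\<^sup>2 - A * (w x)\<^sup>2 - B * q x) / 2"
      using H ends by eventually_elim (simp add: weighted_square_identity q_def)
    show "(\<lambda>x. LINT \<rho>|leb {0<..<1}. (A + B * \<rho>) * (z (x, \<rho>) * \<zeta> (x, \<rho>))) \<in> borel_measurable ?M"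
      using P.integrable_fst'[OF i1] by (auto dest: borel_measurable_integrable)
    note [measurable] = L2_measurable[OF w] L2_measurable[OF z1] borel_measurable_integrable[OF iq]
    show "(\<lambda>x. ((A + B) * (z1 x)\<^sup>2 - A * (w x)\<^sup>2 - B * q x) / 2) \<in> borel_measurable ?M" by measurable
  qed
  also have "\<dots> = ((A + B) * (LINT x|?M. (z1 x)\<^sup>2) - A * (LINT x|?M. (w x)\<^sup>2) - B * (LINT x|?M. q x)) / 2"
    using iw iq by simp
  finally show ?thesis unfolding q .
qed

lemma op_A_energy_space:
  assumes fr: "frontier \<Omega> = \<Gamma>0 \<union> \<Gamma>1" "closed \<Gamma>1" and A: "(V, W) \<in> op_A \<Omega> \<nu> \<sigma> \<Gamma>0 \<Gamma>1 a \<mu> \<tau>"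
  shows "V \<in> energy_space \<Omega> \<sigma> \<Gamma>0 \<Gamma>1" "W \<in> energy_space \<Omega> \<sigma> \<Gamma>0 \<Gamma>1"
proof -
  from A obtain u v w z d z1 \<zeta> where VW: "V = (u, v, w, z)"
      "W = (v, (\<lambda>x. weak_laplacian \<Omega> u x - a * v x), (\<lambda>x. - d x - \<mu> * z1 x), (\<lambda>p. - (1 / \<tau>) * \<zeta> p))"
    and u: "u \<in> H1_vanishing \<Omega> \<sigma> \<Gamma>0" "u \<in> H2 \<Omega>" and v: "v \<in> H1_vanishing \<Omega> \<sigma> \<Gamma>0"
    and w: "w \<in> L2 (restrict_space \<sigma> \<Gamma>1)" and d: "has_normal_derivative \<Omega> \<nu> \<sigma> u d"
    and z: "L2_H1_derivative \<sigma> \<Gamma>1 z \<zeta>" and z1: "z1 \<in> L2 (restrict_space \<sigma> \<Gamma>1)"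
    unfolding op_A_def by blast
  have vL: "v \<in> L2 (leb \<Omega>)" by (rule H1_L2(1)[OF H1_vanishing_H1[OF v]])
  have zL: "z \<in> L2 (cyl \<sigma> \<Gamma>1)" "\<zeta> \<in> L2 (cyl \<sigma> \<Gamma>1)" using z by (auto simp: L2_H1_derivative_def)
  show "V \<in> energy_space \<Omega> \<sigma> \<Gamma>0 \<Gamma>1" using u v w zL vL by (simp add: VW energy_space_def)
  note lap = weak_laplacian_L2[OF u(2)]
  have dL: "d \<in> L2 (restrict_space \<sigma> \<Gamma>1)" by (rule has_normal_derivative_L2[OF d]) (use fr in auto)
  have "(\<lambda>x. weak_laplacian \<Omega> u x - a * v x) \<in> L2 (leb \<Omega>)" using L2_lin_real[OF lap vL, of 1 "- a"] by simp
  moreover have "(\<lambda>x. - d x - \<mu> * z1 x) \<in> L2 (restrict_space \<sigma> \<Gamma>1)" using L2_lin_real[OF dL z1, of "-1" "- \<mu>"] by simp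
  moreover have "(\<lambda>p. - (1 / \<tau>) * \<zeta> p) \<in> L2 (cyl \<sigma> \<Gamma>1)" using L2_lin_real[OF zL(2) zL(2), of "- (1 / \<tau>)" 0] by simp
  ultimately show "W \<in> energy_space \<Omega> \<sigma> \<Gamma>0 \<Gamma>1" using v by (simp add: VW energy_space_def)
qed

text \<open>The weight \<open>\<xi> - \<epsilon> (1 - \<rho>)\<close> differs from \<open>\<xi>\<close> by \<open>\<epsilon>\<close> at the inflow end \<open>\<rho> = 0\<close>. This damps \<open>w\<close>,
  which the original energy does not, at the price of a small multiple of the norm of \<open>z\<close>.\<close>

lemma op_A_dissipation:
  assumes fr: "frontier \<Omega> = \<Gamma>0 \<union> \<Gamma>1" "closed \<Gamma>0" "closed \<Gamma>1" "\<Gamma>0 \<inter> \<Gamma>1 = {}"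
    and A: "(V, W) \<in> op_A \<Omega> \<nu> \<sigma> \<Gamma>0 \<Gamma>1 a \<mu> \<tau>" and par: "a > 0" "\<mu> > 0" "\<tau> > 0" "\<xi> > \<mu> * \<tau>"
    and \<mu>1: "\<mu>1 = \<xi> / (2 * \<tau>) + \<mu> / 2" and \<epsilon>: "0 < \<epsilon>" "\<epsilon> \<le> \<xi> / 2" "\<epsilon> \<le> \<tau> * \<mu>1 * \<xi> / 2"
    and k: "k = min (\<mu>1 / 2) (\<epsilon> / (2 * \<tau>))"
  shows "energy_form \<Omega> \<sigma> \<Gamma>1 (\<xi> - \<epsilon>) \<epsilon> W V - \<mu>1 * energy_form \<Omega> \<sigma> \<Gamma>1 (\<xi> - \<epsilon>) \<epsilon> V V
    \<le> - k * energy_form \<Omega> \<sigma> \<Gamma>1 (\<xi> - \<epsilon>) \<epsilon> V V"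
proof -
  from A obtain u v w z d z1 \<zeta> where VW: "V = (u, v, w, z)"
      "W = (v, (\<lambda>x. weak_laplacian \<Omega> u x - a * v x), (\<lambda>x. - d x - \<mu> * z1 x), (\<lambda>p. - (1 / \<tau>) * \<zeta> p))"
    and u: "u \<in> H1_vanishing \<Omega> \<sigma> \<Gamma>0" "u \<in> H2 \<Omega>" and v: "v \<in> H1_vanishing \<Omega> \<sigma> \<Gamma>0"
    and w: "w \<in> L2 (restrict_space \<sigma> \<Gamma>1)" "trace_on \<Omega> \<sigma> \<Gamma>1 v w" and d: "has_normal_derivative \<Omega> \<nu> \<sigma> u d"
    and z: "L2_H1_derivative \<sigma> \<Gamma>1 z \<zeta>" and z1: "z1 \<in> L2 (restrict_space \<sigma> \<Gamma>1)"
    and ends: "AE x in restrict_space \<sigma> \<Gamma>1. endpoint_values (\<lambda>\<rho>. z (x, \<rho>)) (w x) (z1 x)"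
    unfolding op_A_def by blast
  let ?M = "restrict_space \<sigma> \<Gamma>1"
  have vL: "v \<in> L2 (leb \<Omega>)" by (rule H1_L2(1)[OF H1_vanishing_H1[OF v]])
  have zL: "z \<in> L2 (cyl \<sigma> \<Gamma>1)" "\<zeta> \<in> L2 (cyl \<sigma> \<Gamma>1)" using z by (auto simp: L2_H1_derivative_def)
  note lap = weak_laplacian_L2[OF u(2)]
  have dL: "d \<in> L2 ?M" by (rule has_normal_derivative_L2[OF d]) (use fr in auto)
  define Nu where "Nu = (LINT x|leb \<Omega>. weak_grad \<Omega> u x \<bullet> weak_grad \<Omega> u x)"
  define Nv where "Nv = (LINT x|leb \<Omega>. v x * v x)"
  define Nw where "Nw = (LINT x|?M. w x * w x)"
  define N1 where "N1 = (LINT x|?M. z1 x * z1 x)"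
  define Nz where "Nz = (LINT p|cyl \<sigma> \<Gamma>1. z p * z p)"
  define Mz where "Mz = (LINT p|cyl \<sigma> \<Gamma>1. ((\<xi> - \<epsilon>) + \<epsilon> * snd p) * (z p * z p))"
  define X where "X = (LINT x|?M. z1 x * w x)"
  have VV: "energy_form \<Omega> \<sigma> \<Gamma>1 (\<xi> - \<epsilon>) \<epsilon> V V = Nu + Nv + Nw + Mz"
    by (simp add: VW Nu_def Nv_def Nw_def Mz_def)
  have "(LINT x|leb \<Omega>. (weak_laplacian \<Omega> u x - a * v x) * v x) = (LINT x|leb \<Omega>. weak_laplacian \<Omega> u x * v x) - a * Nv"
    using Bochner_Integration.integral_diff[OF L2_mult_integrable[OF lap vL] integrable_mult_right[OF L2_mult_integrable[OF vL vL], of a]]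
    by (simp add: Nv_def algebra_simps)
  moreover have "(LINT x|?M. (- d x - \<mu> * z1 x) * w x) = - (LINT x|?M. d x * w x) - \<mu> * X"
  proof -
    have "(LINT x|?M. (- d x - \<mu> * z1 x) * w x) = (LINT x|?M. (-1) * (d x * w x) + (- \<mu>) * (z1 x * w x))"
      by (rule Bochner_Integration.integral_cong) (auto simp: algebra_simps)
    also have "\<dots> = (LINT x|?M. (-1) * (d x * w x)) + (LINT x|?M. (- \<mu>) * (z1 x * w x))"
      by (intro Bochner_Integration.integral_add integrable_mult_right L2_mult_integrable dL z1 w(1))
    finally show ?thesis unfolding integral_mult_right_zero X_def by simp
  qed
  moreover have "(LINT p|cyl \<sigma> \<Gamma>1. ((\<xi> - \<epsilon>) + \<epsilon> * snd p) * (- (1 / \<tau>) * \<zeta> p * z p)) =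
      - (1 / \<tau>) * ((\<xi> * N1 - (\<xi> - \<epsilon>) * Nw - \<epsilon> * Nz) / 2)"
  proof -
    have "(LINT p|cyl \<sigma> \<Gamma>1. ((\<xi> - \<epsilon>) + \<epsilon> * snd p) * (- (1 / \<tau>) * \<zeta> p * z p)) =
      (LINT p|cyl \<sigma> \<Gamma>1. - (1 / \<tau>) * (((\<xi> - \<epsilon>) + \<epsilon> * snd p) * (z p * \<zeta> p)))"
      by (rule Bochner_Integration.integral_cong) (auto simp: mult_ac)
    also have "\<dots> = - (1 / \<tau>) * (LINT p|cyl \<sigma> \<Gamma>1. ((\<xi> - \<epsilon>) + \<epsilon> * snd p) * (z p * \<zeta> p))"
      by (rule integral_mult_right_zero)
    also have "(LINT p|cyl \<sigma> \<Gamma>1. ((\<xi> - \<epsilon>) + \<epsilon> * snd p) * (z p * \<zeta> p)) = (\<xi> * N1 - (\<xi> - \<epsilon>) * Nw - \<epsilon> * Nz) / 2"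
      using delay_identity[OF fr(3) z w(1) z1 ends, of "\<xi> - \<epsilon>" \<epsilon>] by (simp add: N1_def Nw_def Nz_def power2_eq_square)
    finally show ?thesis .
  qed
  \<comment> \<open>The boundary integral from Green's formula cancels the term \<open>- d\<close>
    in the third component of the operator.\<close>
  moreover have "(LINT x|leb \<Omega>. weak_grad \<Omega> v x \<bullet> weak_grad \<Omega> u x) + (LINT x|leb \<Omega>. weak_laplacian \<Omega> u x * v x) = (LINT x|?M. d x * w x)"
    by (rule green[OF fr d v w(2,1)])
  ultimately have WV: "energy_form \<Omega> \<sigma> \<Gamma>1 (\<xi> - \<epsilon>) \<epsilon> W V = - a * Nv - \<mu> * X - (1 / \<tau>) * ((\<xi> * N1 - (\<xi> - \<epsilon>) * Nw - \<epsilon> * Nz) / 2)"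
    unfolding VW energy_form.simps by simp
  have pos: "0 \<le> Nu" "0 \<le> Nv" "0 \<le> Nw" "0 \<le> N1" "0 \<le> Nz" by (auto simp: Nu_def Nv_def Nw_def N1_def Nz_def)
  \<comment> \<open>From the nonnegative integral of the square of \<open>z1 + w\<close>.\<close>
  have Young: "- X \<le> (N1 + Nw) / 2"
  proof -
    have "0 \<le> (LINT x|?M. (z1 x + w x) * (z1 x + w x))" by simp
    also have "\<dots> = (LINT x|?M. z1 x * z1 x + 2 * (z1 x * w x) + w x * w x)" by (simp add: algebra_simps)
    also have "\<dots> = N1 + 2 * X + Nw"
      unfolding N1_def X_def Nw_def using L2_mult_integrable[OF z1 z1] L2_mult_integrable[OF z1 w(1)] L2_mult_integrable[OF w(1) w(1)] by simp
    finally show ?thesis by simp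
  qed
  have \<xi>0: "\<xi> > 0" using par by (meson less_trans mult_pos_pos)
  have \<mu>10: "\<mu>1 > 0" using par \<xi>0 by (simp add: \<mu>1 add_pos_pos)
  have Mz: "\<xi> / 2 * Nz \<le> Mz"
  proof -
    have "(LINT p|cyl \<sigma> \<Gamma>1. (\<xi> / 2 + 0 * snd p) * (z p * z p)) \<le> Mz"
      unfolding Mz_def
    proof (rule integral_mono)
      fix p assume "p \<in> space (cyl \<sigma> \<Gamma>1)"
      hence "0 < snd p" unfolding space_cyl by auto
      hence "0 \<le> \<epsilon> * snd p" using \<epsilon>(1) by simp
      thus "(\<xi> / 2 + 0 * snd p) * (z p * z p) \<le> ((\<xi> - \<epsilon>) + \<epsilon> * snd p) * (z p * z p)"
        using \<epsilon>(2) by (intro mult_right_mono) auto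
    qed (rule cyl_weight_integrable[OF zL(1) zL(1)])+
    thus ?thesis by (simp add: Nz_def)
  qed
  have Mz0: "0 \<le> Mz" using Mz pos(5) \<xi>0 by (meson dual_order.trans half_gt_zero less_imp_le mult_nonneg_nonneg)
  \<comment> \<open>The loss caused by the slope of the weight is absorbed by half of the damping of
    the delay component: \<open>\<epsilon> \<le> \<tau> * \<mu>1 * \<xi> / 2\<close> and the weight
    is at least \<open>\<xi> / 2\<close>.\<close>
  have "\<epsilon> / (2 * \<tau>) * Nz \<le> \<mu>1 / 2 * Mz"
  proof -
    have "\<epsilon> / (2 * \<tau>) \<le> \<mu>1 / 2 * (\<xi> / 2)" using \<epsilon>(3) par(3) by (simp add: field_simps)
    hence "\<epsilon> / (2 * \<tau>) * Nz \<le> \<mu>1 / 2 * (\<xi> / 2) * Nz" using pos(5) by (rule mult_right_mono)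
    also have "\<dots> \<le> \<mu>1 / 2 * Mz" using mult_left_mono[OF Mz, of "\<mu>1 / 2"] \<mu>10 by (simp add: mult.assoc)
    finally show ?thesis .
  qed
  \<comment> \<open>Young's share and the outflow term of the delay; the sign is the condition \<xi>
    > \<mu> \<tau>.\<close>
  moreover have "(\<mu> / 2 - \<xi> / (2 * \<tau>)) * N1 \<le> 0"
    using par pos(4) by (intro mult_nonpos_nonneg) (auto simp: field_simps)
  moreover have "\<mu> * (- X) \<le> \<mu> * ((N1 + Nw) / 2)" using Young par(2) by (intro mult_left_mono) auto
  moreover have "- a * Nv \<le> 0" using par(1) pos(2) by simp
  \<comment> \<open>The coefficient of \<open>Nw\<close> is
    \<open>\<mu> / 2 + (\<xi> - \<epsilon>) / (2 * \<tau>) - \<mu>1\<close>, which is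
    \<open>- \<epsilon> / (2 * \<tau>)\<close> by the choice of \<open>\<mu>1\<close>.\<close>
  ultimately have "energy_form \<Omega> \<sigma> \<Gamma>1 (\<xi> - \<epsilon>) \<epsilon> W V - \<mu>1 * (Nu + Nv + Nw + Mz)
      \<le> - \<mu>1 * Nu - \<mu>1 * Nv - \<epsilon> / (2 * \<tau>) * Nw - \<mu>1 / 2 * Mz"
    unfolding WV \<mu>1 by (simp add: algebra_simps diff_divide_distrib add_divide_distrib)
  also have "\<dots> \<le> - k * (Nu + Nv + Nw + Mz)"
  proof -
    have "k \<le> \<mu>1" "k \<le> \<mu>1 / 2" "k \<le> \<epsilon> / (2 * \<tau>)" using k \<mu>10 by auto
    hence "k * Nu \<le> \<mu>1 * Nu" "k * Nv \<le> \<mu>1 * Nv" "k * Nw \<le> \<epsilon> / (2 * \<tau>) * Nw" "k * Mz \<le> \<mu>1 / 2 * Mz"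
      using pos Mz0 by - (rule mult_right_mono; assumption)+
    thus ?thesis by (simp add: algebra_simps)
  qed
  finally show ?thesis unfolding VV .
qed

end

theorem theorem3p1:
  fixes \<Omega> \<Gamma>0 \<Gamma>1 :: "'a::euclidean_space set"
    and \<nu> :: "'a \<Rightarrow> 'a" and \<sigma> :: "'a measure"
    and a \<mu> \<tau> \<xi> :: real
    and T :: "real \<Rightarrow> 'a state \<Rightarrow> 'a state"
  assumes "DIM('a) \<ge> 2"
    and "open \<Omega>" "connected \<Omega>" "bounded \<Omega>" "C1_boundary \<Omega>"
    and "outward_unit_normal \<Omega> \<nu>" "surface_measure \<Omega> \<sigma>"
    and "frontier \<Omega> = \<Gamma>0 \<union> \<Gamma>1" "closed \<Gamma>0" "closed \<Gamma>1" "\<Gamma>0 \<inter> \<Gamma>1 = {}"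
    and "emeasure \<sigma> \<Gamma>0 > 0"
    and "a > 0" "\<mu> > 0" "\<tau> > 0"
    and "\<xi> > \<mu> * \<tau>"
    and "generates (energy_space \<Omega> \<sigma> \<Gamma>0 \<Gamma>1) state_lin (energy_norm \<Omega> \<sigma> \<Gamma>1 \<xi>)
           (op_A_d \<Omega> \<nu> \<sigma> \<Gamma>0 \<Gamma>1 a \<mu> \<tau> \<xi>) T"
  shows "\<exists>C>0. \<forall>V0 \<in> Domain (op_A_d \<Omega> \<nu> \<sigma> \<Gamma>0 \<Gamma>1 a \<mu> \<tau> \<xi>). \<forall>t>0.
           energy_norm \<Omega> \<sigma> \<Gamma>1 \<xi> (T t V0) \<le>
             C / sqrt t * graph_norm (energy_norm \<Omega> \<sigma> \<Gamma>1 \<xi>) (op_A_d \<Omega> \<nu> \<sigma> \<Gamma>0 \<Gamma>1 a \<mu> \<tau> \<xi>) V0"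
proof -
  interpret C1_domain \<Omega> \<nu> \<sigma> by unfold_locales (use assms in auto)
  note fr = assms(8-11) and par = assms(13-16) and gen = assms(17)
  define \<mu>1 where "\<mu>1 = \<xi> / (2 * \<tau>) + \<mu> / 2"
  have \<xi>0: "\<xi> > 0" using par by (meson less_trans mult_pos_pos)
  have \<mu>10: "\<mu>1 > 0" using par \<xi>0 by (simp add: \<mu>1_def add_pos_pos)
  \<comment> \<open>The first bound keeps the weight at least \<open>\<xi> / 2\<close>, the second
    lets the damping of the delay component absorb the loss on \<open>z\<close>.\<close>
  define \<epsilon> where "\<epsilon> = min (\<xi> / 2) (\<tau> * \<mu>1 * \<xi> / 2)"
  have \<epsilon>: "0 < \<epsilon>" "\<epsilon> \<le> \<xi> / 2" "\<epsilon> \<le> \<tau> * \<mu>1 * \<xi> / 2" using \<xi>0 \<mu>10 par by (auto simp: \<epsilon>_def)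
  define k where "k = min (\<mu>1 / 2) (\<epsilon> / (2 * \<tau>))"
  have k: "k > 0" using \<mu>10 \<epsilon> par by (simp add: k_def)
  let ?X = "energy_space \<Omega> \<sigma> \<Gamma>0 \<Gamma>1" and ?A = "op_A_d \<Omega> \<nu> \<sigma> \<Gamma>0 \<Gamma>1 a \<mu> \<tau> \<xi>"
  let ?N = "energy_norm \<Omega> \<sigma> \<Gamma>1 \<xi>" and ?B = "energy_form \<Omega> \<sigma> \<Gamma>1 (\<xi> - \<epsilon>) \<epsilon>"
  have wt: "\<xi> / 2 \<le> (\<xi> - \<epsilon>) + \<epsilon> * \<rho>" "(\<xi> - \<epsilon>) + \<epsilon> * \<rho> \<le> \<xi>" if "0 < \<rho>" "\<rho> < 1" for \<rho>
  proof -
    have "0 \<le> \<epsilon> * \<rho>" "\<epsilon> * \<rho> \<le> \<epsilon> * 1" using that \<epsilon> by (auto intro: mult_left_mono)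
    thus "\<xi> / 2 \<le> (\<xi> - \<epsilon>) + \<epsilon> * \<rho>" "(\<xi> - \<epsilon>) + \<epsilon> * \<rho> \<le> \<xi>" using \<epsilon>(2) by auto
  qed
  interpret semi_inner_product ?X state_lin ?B
    by (rule energy_form_semi_inner_product) (use wt \<xi>0 in force)
  \<comment> \<open>The weight lies between \<open>\<xi> / 2\<close> and \<open>\<xi>\<close>, and
    the other three terms are the same nonnegative quantities in both forms; hence the factor
    2.\<close>
  have N2: "?B V V \<le> (?N V)\<^sup>2" "(?N V)\<^sup>2 \<le> 2 * ?B V V" "0 \<le> ?N V" if "V \<in> ?X" for V
  proof -
    obtain u v w z where V: "V = (u, v, w, z)" by (metis prod_cases4)
    have z: "z \<in> L2 (cyl \<sigma> \<Gamma>1)" using that by (auto simp: V energy_space_def)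
    let ?I = "\<lambda>A B. LINT p|cyl \<sigma> \<Gamma>1. (A + B * snd p) * (z p * z p)"
    have le: "?I A B \<le> ?I A' B'" if "\<And>\<rho>. 0 < \<rho> \<Longrightarrow> \<rho> < 1 \<Longrightarrow> A + B * \<rho> \<le> A' + B' * \<rho>" for A B A' B'
    proof (rule integral_mono)
      fix p assume "p \<in> space (cyl \<sigma> \<Gamma>1)"
      hence "0 < snd p" "snd p < 1" unfolding space_cyl by auto
      thus "(A + B * snd p) * (z p * z p) \<le> (A' + B' * snd p) * (z p * z p)"
        by (intro mult_right_mono that) auto
    qed (rule cyl_weight_integrable[OF z z])+
    have rest: "0 \<le> (LINT x|leb \<Omega>. weak_grad \<Omega> u x \<bullet> weak_grad \<Omega> u x) + (LINT x|leb \<Omega>. v x * v x) +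
      (LINT x|restrict_space \<sigma> \<Gamma>1. w x * w x)" by (intro add_nonneg_nonneg) auto
    have half: "2 * ?I (\<xi> / 2) 0 = ?I \<xi> 0" by simp
    have 1: "?I (\<xi> - \<epsilon>) \<epsilon> \<le> ?I \<xi> 0" and 2: "?I (\<xi> / 2) 0 \<le> ?I (\<xi> - \<epsilon>) \<epsilon>" by (rule le, use wt in simp)+
    have arith: "x + i2 \<le> 2 * (x + i1)" if "0 \<le> x" "i3 \<le> i1" "2 * i3 = i2" for x i1 i2 i3 :: real
    proof -
      have "i2 \<le> 2 * i1" using that(2,3) by simp
      hence "i2 \<le> 2 * i1 + x" using that(1) by (rule add_increasing2[rotated])
      thus ?thesis by (simp add: algebra_simps)
    qed
    have inner: "?B V V \<le> energy_form \<Omega> \<sigma> \<Gamma>1 \<xi> 0 V V" "energy_form \<Omega> \<sigma> \<Gamma>1 \<xi> 0 V V \<le> 2 * ?B V V"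
      unfolding V energy_form.simps by (rule add_left_mono[OF 1]) (rule arith[OF rest 2 half])
    moreover have nn: "0 \<le> energy_form \<Omega> \<sigma> \<Gamma>1 \<xi> 0 V V" using inner(1) nonneg[OF that] by linarith
    ultimately show "?B V V \<le> (?N V)\<^sup>2" "(?N V)\<^sup>2 \<le> 2 * ?B V V" "0 \<le> ?N V"
      by (simp_all add: energy_norm_def energy_inner_eq_form)
  qed
  have NP: "0 \<le> form_norm V \<and> form_norm V \<le> ?N V \<and> ?N V \<le> sqrt 2 * form_norm V" if "V \<in> ?X" for V
  proof (intro conjI form_norm_nonneg that)
    show "form_norm V \<le> ?N V" unfolding form_norm_def by (rule real_le_lsqrt) (use N2[OF that] in auto)
    show "?N V \<le> sqrt 2 * form_norm V" unfolding form_norm_def real_sqrt_mult[symmetric]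
      by (rule real_le_rsqrt) (use N2[OF that] in auto)
  qed
  have A: "V \<in> ?X \<and> W \<in> ?X \<and> ?B W V \<le> - k * ?B V V" if VW: "(V, W) \<in> ?A" for V W
  proof -
    from VW obtain W0 where W0: "(V, W0) \<in> op_A \<Omega> \<nu> \<sigma> \<Gamma>0 \<Gamma>1 a \<mu> \<tau>" and W: "W = state_lin 1 W0 (- \<mu>1) V"
      unfolding op_A_d_def \<mu>1_def by blast
    note E = op_A_energy_space[OF fr(1,3) W0]
    have "?B W V = ?B W0 V - \<mu>1 * ?B V V" unfolding W using lin_left[OF E(2,1,1), of 1 "- \<mu>1"] by simp
    thus ?thesis using op_A_dissipation[OF fr W0 par \<mu>1_def \<epsilon> k_def] E lin_closed[OF E(2,1)] by (simp add: W)
  qed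
  have genP: "generates ?X state_lin form_norm ?A T"
    by (rule generates_equivalent_norm[OF gen lin_closed NP]) (use A in auto)
  have T: "C0_semigroup ?X state_lin form_norm T" and eq: "semigroup_generator ?X state_lin form_norm T = graph_closure ?X state_lin form_norm ?A"
    using genP by (auto simp: generates_def)
  have decay: "?N (T t V) \<le> (1 / sqrt k) / sqrt t * ?N V" if V: "V \<in> Domain ?A" and t: "t > 0" for V t
  proof -
    obtain W where VW: "(V, W) \<in> ?A" using V by blast
    have X: "V \<in> ?X" "W \<in> ?X" using A[OF VW] by auto
    have "form_norm (state_lin 1 U (-1) U) = 0" if "U \<in> ?X" for U
      using that by (simp add: form_norm_def lin_left lin_right lin_closed)
    \<comment> \<open>A point of the graph belongs to its closure by constant sequences.\<close>
    hence "(V, W) \<in> graph_closure ?X state_lin form_norm ?A"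
      unfolding graph_closure_def seq_limit_def using X VW
      by (intro CollectI, simp) (rule exI[of _ "\<lambda>_. V"], rule exI[of _ "\<lambda>_. W"], simp)
    hence g: "(V, W) \<in> semigroup_generator ?X state_lin form_norm T" unfolding eq .
    have d: "?B Z Y \<le> - k * ?B Y Y" if "(Y, Z) \<in> semigroup_generator ?X state_lin form_norm T" for Y Z
      using graph_closure_dissipative[OF A that[unfolded eq]] .
    have TX: "T t V \<in> ?X" using T X t by (auto simp: C0_semigroup_def)
    have x: "2 * k * t > 0" using k t by simp
    \<comment> \<open>Exponential decay is weakened to the required rate by
      \<open>x \<le> exp x\<close>. Its factor 1/2 cancels the factor 2 of the norm comparison,
      which leaves \<open>1 / (k * t)\<close> and explains the constant
      \<open>1 / sqrt k\<close>.\<close>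
    have "exp (- 2 * k * t) \<le> 1 / (2 * k * t)"
    proof -
      have "2 * k * t \<le> exp (2 * k * t)" using exp_ge_add_one_self[of "2 * k * t"] by linarith
      hence "inverse (exp (2 * k * t)) \<le> inverse (2 * k * t)" using x by (intro le_imp_inverse_le)
      moreover have "- 2 * k * t = - (2 * k * t)" by simp
      ultimately show ?thesis by (simp only: exp_minus divide_inverse mult_1_left)
    qed
    hence "exp (- 2 * k * t) * ?B V V \<le> 1 / (2 * k * t) * (?N V)\<^sup>2"
      by (rule mult_mono[OF _ N2(1)[OF X(1)] _ nonneg[OF X(1)]]) (use x in simp)
    moreover have "?B (T t V) (T t V) \<le> exp (- 2 * k * t) * ?B V V"
      by (rule generator_decay[OF T d g]) (use t in auto)
    ultimately have "(?N (T t V))\<^sup>2 \<le> 2 * (1 / (2 * k * t) * (?N V)\<^sup>2)" using N2(2)[OF TX] by linarith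
    also have "\<dots> = ((1 / sqrt k) / sqrt t * ?N V)\<^sup>2"
      using k t by (simp add: power_mult_distrib power_divide)
    finally show ?thesis
      by (rule power2_le_imp_le) (use N2(3)[OF X(1)] k t in auto)
  qed
  show ?thesis
  proof (intro exI[of _ "1 / sqrt k"] conjI ballI allI impI)
    show "0 < 1 / sqrt k" using k by simp
    fix V0 and t :: real assume V0: "V0 \<in> Domain ?A" and t: "0 < t"
    obtain W where "(V0, W) \<in> ?A" using V0 by blast
    \<comment> \<open>The decay was obtained with the norm of \<open>V0\<close> alone. To pass to
      the graph norm, the chosen image must lie in the energy space, where its norm is
      nonnegative.\<close>
    hence "(V0, SOME W. (V0, W) \<in> ?A) \<in> ?A" by (rule someI)
    hence "(SOME W. (V0, W) \<in> ?A) \<in> ?X" by (rule A[THEN conjunct2, THEN conjunct1])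
    hence "0 \<le> ?N (SOME W. (V0, W) \<in> ?A)" by (rule N2(3))
    hence "?N V0 \<le> graph_norm ?N ?A V0" by (simp add: graph_norm_def)
    hence "(1 / sqrt k) / sqrt t * ?N V0 \<le> (1 / sqrt k) / sqrt t * graph_norm ?N ?A V0"
      using k t by (intro mult_left_mono) auto
    thus "?N (T t V0) \<le> (1 / sqrt k) / sqrt t * graph_norm ?N ?A V0" using decay[OF V0 t] by linarith
  qed
qed

end
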